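(* Let $U$ and $V$ be two disjoint balls contained in $\mathcal{O}_F$, and let $u \in U$, $v \in V$. Then for all $n \geq 3$, $$\frac{\mathrm{Cov}(Z_{U,n}, Z_{V,n})}{\mathbb{E}[Z_{U,n}]\cdot\mathbb{E}[Z_{V,n}]} = -1 + \frac{(q+1)^2}{q^2+q+1}\,\|u-v\| - \frac{q}{q^2+q+1}\,\|u-v\|^4.$$
   Context: Let $p$ be a prime, $F$ a finite extension of $\mathbb{Q}_p$ with ring of integers $\mathcal{O}_F$ and residue field of cardinality $q$. Let $\|\cdot\|$ be the absolute value on $F$ normalized by $\|p\| = p^{-[F:\mathbb{Q}_p]}$. For $n \geq 1$, $\Omega_n$ is the set of polynomials of degree at most $n$ with coefficients in $\mathcal{O}_F$, identified with $\mathcal{O}_F^{n+1}$ with the probability measure $\lambda_F^{\otimes(n+1)}$, where $\lambda_F$ is the Haar measure with $\lambda_F(\mathcal{O}_F)=1$. For an open subset $U\subseteq F$, $Z_{U,n}:\Omega_n\to\mathbb{Z}_{\ge0}\cup\{+\infty\}$ sends $P$ to the number of $x\in U$ with $P(x)=0$. Balls are balls of positive radius for $\|\cdot\|$. *)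

theory Defs
  imports "HOL-Analysis.Analysis" "HOL-Computational_Algebra.Computational_Algebra"
begin

definition nonarch_abs_value :: "('a::field \<Rightarrow> real) \<Rightarrow> bool" where
  "nonarch_abs_value f \<longleftrightarrow>
     (\<forall>x. 0 \<le> f x) \<and> (\<forall>x. f x = 0 \<longleftrightarrow> x = 0) \<and>
     (\<forall>x y. f (x * y) = f x * f y) \<and> (\<forall>x y. f (x + y) \<le> max (f x) (f y))"

definition rat_padic_abs :: "nat \<Rightarrow> rat \<Rightarrow> real" where
  "rat_padic_abs p r =
     (if r = 0 then 0
      else real p powi (int (multiplicity (int p) (snd (quotient_of r)))
                        - int (multiplicity (int p) (fst (quotient_of r)))))"

text \<open>
  The type \<open>'k\<close> with the absolute value \<open>absv\<close> is a completion of the rationals with respect to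
  the \<open>p\<close>-adic absolute value, i.e. a copy of the field of \<open>p\<close>-adic numbers.
\<close>

locale padic_numbers =
  fixes p :: nat and absv :: "'k::{field_char_0, metric_space} \<Rightarrow> real"
  assumes prime_p: "prime p"
    and abs_value_absv: "nonarch_abs_value absv"
    and dist_absv: "\<And>x y. dist x y = absv (x - y)"
    and absv_of_rat: "\<And>r. absv (of_rat r) = rat_padic_abs p r"
    and Rats_dense: "closure (\<rat> :: 'k set) = UNIV"
    and complete_padic: "complete (UNIV :: 'k set)"

text \<open>
  The type \<open>'a\<close> is a field extension of \<open>'k\<close> through the embedding \<open>emb\<close>;
  \<open>ext_degree emb\<close> is its degree.
\<close>

definition ext_scale :: "('k::field \<Rightarrow> 'a::field) \<Rightarrow> 'k \<Rightarrow> 'a \<Rightarrow> 'a" where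
  "ext_scale emb = (\<lambda>c x. emb c * x)"

definition ext_degree :: "('k::field \<Rightarrow> 'a::field) \<Rightarrow> nat" where
  "ext_degree emb = vector_space.dim (ext_scale emb) UNIV"

text \<open>
  The absolute value \<open>nrm\<close> of the extension is a power of the \<open>p\<close>-adic one on \<open>'k\<close>; the exponent
  is then determined by the normalization of \<open>nrm\<close> at \<open>p\<close>. Being ultrametric, \<open>nrm\<close> induces a
  metric, and this is the metric of the type \<open>'a\<close>.
\<close>

locale padic_extension = padic_numbers p absv
  for p :: nat and absv :: "'k::{field_char_0, metric_space} \<Rightarrow> real" +
  fixes emb :: "'k \<Rightarrow> 'a::{field, metric_space}" and nrm :: "'a \<Rightarrow> real"
  assumes emb_one: "emb 1 = 1"
    and emb_add: "\<And>x y. emb (x + y) = emb x + emb y"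
    and emb_mult: "\<And>x y. emb (x * y) = emb x * emb y"
    and finite_ext: "\<exists>B. finite_dimensional_vector_space (ext_scale emb) B"
    and abs_value_nrm: "nonarch_abs_value nrm"
    and dist_nrm: "\<And>x y. dist x y = nrm (x - y)"
    and nrm_extends: "\<exists>s>0. \<forall>x. nrm (emb x) = absv x powr s"
    and nrm_normalized: "nrm (of_nat p) = real p powi (- int (ext_degree emb))"

definition integers_ring :: "('a::field \<Rightarrow> real) \<Rightarrow> 'a set" where
  "integers_ring nrm = {x. nrm x \<le> 1}"

definition residue_card :: "('a::field \<Rightarrow> real) \<Rightarrow> nat" where
  "residue_card nrm =
     card (integers_ring nrm //
       {(x, y). x \<in> integers_ring nrm \<and> y \<in> integers_ring nrm \<and> nrm (x - y) < 1})"

text \<open>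
  Regularity is omitted: it is automatic for Borel measures that are finite on compact sets when
  the group is metrizable, locally compact and \<open>\<sigma>\<close>-compact.
\<close>

definition haar_measure :: "'a::{ab_group_add, topological_space} measure \<Rightarrow> bool" where
  "haar_measure M \<longleftrightarrow>
     sets M = sets borel \<and>
     (\<forall>x. \<forall>A\<in>sets borel. emeasure M ((+) x ` A) = emeasure M A) \<and>
     (\<forall>C. compact C \<longrightarrow> emeasure M C < \<infinity>) \<and>
     emeasure M UNIV \<noteq> 0"

definition poly_of_coeffs :: "nat \<Rightarrow> (nat \<Rightarrow> 'a::comm_monoid_add) \<Rightarrow> 'a poly" where
  "poly_of_coeffs n a = (\<Sum>i\<le>n. monom (a i) i)"

text \<open>
  The product measure on coefficient vectors, transported along the bijection
  \<open>poly_of_coeffs n\<close> onto the polynomials of degree at most \<open>n\<close> with coefficients in \<open>R\<close>.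
\<close>

definition poly_measure :: "'a::comm_monoid_add measure \<Rightarrow> 'a set \<Rightarrow> nat \<Rightarrow> 'a poly measure" where
  "poly_measure \<mu> R n =
     embed_measure (\<Pi>\<^sub>M i\<in>{..n}. restrict_space \<mu> R) (poly_of_coeffs n)"

lemma coeff_poly_of_coeffs: "coeff (poly_of_coeffs n a) i = (if i \<le> n then a i else 0)"
  by (simp add: poly_of_coeffs_def coeff_sum)

lemma inj_on_poly_of_coeffs: "inj_on (poly_of_coeffs n) ({..n} \<rightarrow>\<^sub>E R)"
proof (rule inj_onI)
  fix a b assume ab: "a \<in> {..n} \<rightarrow>\<^sub>E R" "b \<in> {..n} \<rightarrow>\<^sub>E R"
    and eq: "poly_of_coeffs n a = poly_of_coeffs n b"
  show "a = b"
  proof (rule PiE_ext[OF ab])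
    fix i assume "i \<in> {..n}"
    then show "a i = b i"
      using arg_cong[OF eq, of "\<lambda>P. coeff P i"] by (simp add: coeff_poly_of_coeffs)
  qed
qed

lemma space_poly_measure:
  assumes "space \<mu> = UNIV"
  shows "space (poly_measure \<mu> R n) = {P. degree P \<le> n \<and> (\<forall>i\<le>n. coeff P i \<in> R)}"
proof -
  have "space (poly_measure \<mu> R n) = poly_of_coeffs n ` ({..n} \<rightarrow>\<^sub>E R)"
    using assms by (simp add: poly_measure_def space_embed_measure space_PiM space_restrict_space)
  also have "\<dots> = {P. degree P \<le> n \<and> (\<forall>i\<le>n. coeff P i \<in> R)}"
  proof (intro equalityI subsetI)
    fix P assume "P \<in> poly_of_coeffs n ` ({..n} \<rightarrow>\<^sub>E R)"
    then show "P \<in> {P. degree P \<le> n \<and> (\<forall>i\<le>n. coeff P i \<in> R)}"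
      by (auto simp: coeff_poly_of_coeffs intro!: degree_le)
  next
    fix P assume P: "P \<in> {P. degree P \<le> n \<and> (\<forall>i\<le>n. coeff P i \<in> R)}"
    have "P = poly_of_coeffs n (restrict (coeff P) {..n})"
      using P by (intro poly_eqI) (auto simp: coeff_poly_of_coeffs coeff_eq_0)
    moreover have "restrict (coeff P) {..n} \<in> {..n} \<rightarrow>\<^sub>E R"
      using P by auto
    ultimately show "P \<in> poly_of_coeffs n ` ({..n} \<rightarrow>\<^sub>E R)"
      by blast
  qed
  finally show ?thesis .
qed

definition zero_count :: "'a::field set \<Rightarrow> 'a poly \<Rightarrow> enat" where
  "zero_count U P =
     (if finite {x \<in> U. poly P x = 0} then enat (card {x \<in> U. poly P x = 0}) else \<infinity>)"

lemma zero_count_eq_infinity: "zero_count U P = \<infinity> \<Longrightarrow> P = 0"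
  by (rule ccontr) (simp add: zero_count_def poly_roots_finite split: if_splits)

text \<open>
  The real-valued version of the zero count; by \<open>zero_count_eq_infinity\<close> it can differ from
  \<open>zero_count\<close> only at the zero polynomial, which is a null event.
\<close>

definition num_zeros :: "'a::field set \<Rightarrow> 'a poly \<Rightarrow> real" where
  "num_zeros U P = real_of_ereal (ereal_of_enat (zero_count U P))"

definition covariance :: "'b measure \<Rightarrow> ('b \<Rightarrow> real) \<Rightarrow> ('b \<Rightarrow> real) \<Rightarrow> real" where
  "covariance M X Y =
     (\<integral>\<omega>. (X \<omega> - integral\<^sup>L M X) * (Y \<omega> - integral\<^sup>L M Y) \<partial>M)"

text \<open>
  For an ultrametric with discrete value set, open and closed balls of positive radius are the
  same sets.
\<close>

definition is_ball :: "'a::metric_space set \<Rightarrow> bool" where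
  "is_ball U \<longleftrightarrow> (\<exists>a r. r > 0 \<and> (U = ball a r \<or> U = cball a r))"

end

theory Submission
  imports Defs "HOL-Probability.Probability_Measure"
begin

text \<open>
  Let \<open>R\<close> be the ring of integers and \<open>P\<close> a uniform random polynomial of degree at most \<open>n\<close> over \<open>R\<close>.
  Integrating over the constant coefficient alone, the one-variable area formula
  \<open>\<integral> h c * #{x \<in> U. T x = c} dc = \<integral>\<^sub>U |T' x| * h (T x) dx\<close> gives, for every \<open>G \<ge> 0\<close>,
  \<open>E[Z_U(P) G(P)] = \<integral>\<^sub>U E[|Q(x)| G((X - x) Q)] dx\<close> with \<open>Q\<close> uniform of degree at most \<open>n - 1\<close>,
  because dividing by \<open>X - x\<close> acts unipotently on the coefficients.
  Taking \<open>G = 1\<close> yields \<open>E[Z_U] = \<mu>(U) * q / (q + 1)\<close>; taking \<open>G = Z_V\<close> and using the formula a second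
  time yields \<open>E[Z_U Z_V] = \<integral>\<^sub>U \<integral>\<^sub>V |x - y| E[|T(x)| |T(y)|] dy dx\<close> with \<open>T\<close> uniform of degree at most
  \<open>n - 2 \<ge> 1\<close>, so that \<open>(T(x), T(y))\<close> is distributed as \<open>(a, a + (y - x) b)\<close> with \<open>a, b\<close> uniform in \<open>R\<close>.

  The Haar measure also gives the structure of the field: with \<open>L\<close> the lattice spanned by a basis
  over the \<open>p\<close>-adic integers, some \<open>R \<inter> c L\<close> has positive measure, hence finite index in \<open>R\<close> and
  in \<open>c L\<close>. So \<open>R\<close> is compact, and \<open>\<mu>(p R)\<close> equals \<open>\<mu>(p L) / \<mu>(L) = p^(-d)\<close>, which identifies the
  normalized absolute value of a uniformizer as \<open>1 / q\<close>.
\<close>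

section \<open>Non-archimedean fields\<close>

text \<open>Two obstacles shape the development. The field carries only the classes
  \<open>field\<close> and \<open>metric_space\<close>, so continuity and measurability of its
  operations are rebuilt from \<open>nrm\<close>. And \<open>padic_extension\<close> does not state
  that \<open>nrm\<close> is discrete or that the ring of integers is compact; both must be won from
  the Haar measure before any probability starts. The locale \<open>local_field\<close> is the
  interface between these two halves. The root count may be infinite at the zero polynomial, so
  counting is done in \<open>ennreal\<close>, where Tonelli and monotone convergence apply at once;
  real integrals appear only at the end. Origin of the constants: for uniform integral a, let
  \<kappa> = q / (q + 1) be the mean of |a| and s = q^2 / (q^2 + q + 1) that of |a|^2. If |d| = D,
  the mean of |a| |a + d b| is s (1 - D^3) + \<kappa>^2 D^3: where |a| > D the second factor equals
  |a|, and on the ball |a| <= D it is D times the absolute value of a uniform element. Multiplying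
  by D and dividing by \<kappa>^2 gives the stated formula, since s / \<kappa>^2 = (q + 1)^2 / (q^2
  + q + 1) exceeds 1 by q / (q^2 + q + 1).\<close>

lemma nonarch_abs_valueD:
  assumes "nonarch_abs_value f"
  shows "0 \<le> f x" "f x = 0 \<longleftrightarrow> x = 0" "f (x * y) = f x * f y" "f (x + y) \<le> max (f x) (f y)"
  using assms by (auto simp: nonarch_abs_value_def)

locale nonarch_field =
  fixes nrm :: "'a::{field, metric_space} \<Rightarrow> real"
  assumes abs_value: "nonarch_abs_value nrm"
    and dist_eq: "\<And>x y. dist x y = nrm (x - y)"
begin

lemma nrm_nonneg [simp]: "0 \<le> nrm x"
  and nrm_eq_0_iff [simp]: "nrm x = 0 \<longleftrightarrow> x = 0"
  and nrm_mult: "nrm (x * y) = nrm x * nrm y"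
  and nrm_add_le: "nrm (x + y) \<le> max (nrm x) (nrm y)"
  using nonarch_abs_valueD[OF abs_value] by auto

lemma nrm_0 [simp]: "nrm 0 = 0"
  by simp

lemma nrm_pos_iff [simp]: "0 < nrm x \<longleftrightarrow> x \<noteq> 0"
  using nrm_nonneg[of x] nrm_eq_0_iff[of x] by linarith

lemma nrm_1 [simp]: "nrm 1 = 1"
  using nrm_mult[of 1 1] by simp

lemma nrm_minus [simp]: "nrm (- x) = nrm x"
proof -
  have "nrm (-1) ^ 2 = 1"
    using nrm_mult[of "-1" "-1"] by (simp add: power2_eq_square)
  then have "nrm (-1) = 1"
    using nrm_nonneg[of "-1"] by (simp add: power2_eq_1_iff)
  then show ?thesis
    using nrm_mult[of "-1" x] by simp
qed

lemma nrm_minus_commute: "nrm (x - y) = nrm (y - x)"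
  using nrm_minus[of "x - y"] by simp

lemma nrm_diff_le: "nrm (x - y) \<le> max (nrm x) (nrm y)"
  using nrm_add_le[of x "- y"] by simp

lemma nrm_triangle: "nrm (x - z) \<le> max (nrm (x - y)) (nrm (y - z))"
  using nrm_add_le[of "x - y" "y - z"] by simp

lemma nrm_power: "nrm (x ^ k) = nrm x ^ k"
  by (induction k) (auto simp: nrm_mult)

lemma nrm_inverse: "nrm (inverse x) = inverse (nrm x)"
proof (cases "x = 0")
  case False
  then show ?thesis
    using nrm_mult[of x "inverse x"] by (simp add: field_simps)
qed auto

lemma nrm_divide: "nrm (x / y) = nrm x / nrm y"
  by (simp add: divide_inverse nrm_mult nrm_inverse)

lemma nrm_add_eq:
  assumes "nrm y < nrm x"
  shows "nrm (x + y) = nrm x"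
proof (rule antisym)
  show "nrm (x + y) \<le> nrm x"
    using nrm_add_le[of x y] assms by simp
  have "nrm x \<le> max (nrm (x + y)) (nrm y)"
    using nrm_diff_le[of "x + y" y] by simp
  then show "nrm x \<le> nrm (x + y)"
    using assms by auto
qed

text \<open>A perturbation smaller than \<open>nrm x\<close> cannot change \<open>nrm x\<close>.
  This rigidity later makes the derivative constant in absolute value on small balls and the
  distance constant between two disjoint balls.\<close>

lemma nrm_eq_if_close: "nrm (x - y) < nrm x \<Longrightarrow> nrm y = nrm x"
  using nrm_add_eq[of "y - x" x] nrm_minus_commute[of x y] by simp

lemma nrm_of_nat_le: "nrm (of_nat k) \<le> 1"
proof (induction k)
  case (Suc k)
  then show ?case
    using nrm_add_le[of 1 "of_nat k"] by simp
qed auto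

lemma mem_cball_iff: "y \<in> cball x r \<longleftrightarrow> nrm (y - x) \<le> r"
  by (simp add: dist_eq nrm_minus_commute)

lemma mem_ball_iff: "y \<in> ball x r \<longleftrightarrow> nrm (y - x) < r"
  by (simp add: dist_eq nrm_minus_commute)

lemma cball_recenter:
  fixes x y :: 'a
  assumes "y \<in> cball x r"
  shows "cball y r = cball x r"
proof -
  have "nrm (z - x) \<le> r \<longleftrightarrow> nrm (z - y) \<le> r" for z
    using assms nrm_triangle[of z x y] nrm_triangle[of z y x] nrm_minus_commute[of x y]
    unfolding mem_cball_iff by auto
  then show ?thesis
    unfolding set_eq_iff mem_cball_iff by simp
qed

lemma open_cball:
  fixes x :: 'a
  assumes "r > 0"
  shows "open (cball x r)"
  unfolding open_contains_cball
proof
  fix y assume "y \<in> cball x r"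
  then show "\<exists>e>0. cball y e \<subseteq> cball x r"
    using assms cball_recenter by blast
qed

lemma integers_ring_eq_cball: "integers_ring nrm = cball 0 1"
  unfolding set_eq_iff mem_cball_iff by (simp add: integers_ring_def)

lemma integers_ringI: "nrm x \<le> 1 \<Longrightarrow> x \<in> integers_ring nrm"
  by (simp add: integers_ring_def)

lemma integers_ring_0 [simp]: "0 \<in> integers_ring nrm"
  and integers_ring_1 [simp]: "1 \<in> integers_ring nrm"
  by (simp_all add: integers_ring_def)

lemma integers_ring_add:
  "x \<in> integers_ring nrm \<Longrightarrow> y \<in> integers_ring nrm \<Longrightarrow> x + y \<in> integers_ring nrm"
  using nrm_add_le[of x y] by (simp add: integers_ring_def)

lemma integers_ring_uminus: "x \<in> integers_ring nrm \<Longrightarrow> - x \<in> integers_ring nrm"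
  by (simp add: integers_ring_def)

lemma integers_ring_diff:
  "x \<in> integers_ring nrm \<Longrightarrow> y \<in> integers_ring nrm \<Longrightarrow> x - y \<in> integers_ring nrm"
  using nrm_diff_le[of x y] by (simp add: integers_ring_def)

lemma integers_ring_mult:
  "x \<in> integers_ring nrm \<Longrightarrow> y \<in> integers_ring nrm \<Longrightarrow> x * y \<in> integers_ring nrm"
  by (simp add: integers_ring_def nrm_mult mult_le_one)

lemma integers_ring_poly:
  assumes "\<And>i. coeff P i \<in> integers_ring nrm" "x \<in> integers_ring nrm"
  shows "poly P x \<in> integers_ring nrm"
  using assms(1)
proof (induction P)
  case (pCons a P)
  have "a \<in> integers_ring nrm" "\<And>i. coeff P i \<in> integers_ring nrm"
    using pCons.prems[of 0] pCons.prems[of "Suc i" for i] by auto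
  then show ?case
    using pCons.IH assms(2) by (auto intro!: integers_ring_add integers_ring_mult)
qed simp

lemma tendsto_0_le_nonneg:
  fixes f g :: "'b \<Rightarrow> real"
  assumes "(g \<longlongrightarrow> 0) F" "\<And>x. 0 \<le> f x" "\<And>x. f x \<le> g x"
  shows "(f \<longlongrightarrow> 0) F"
  by (rule tendsto_sandwich[OF _ _ tendsto_const assms(1)]) (simp_all add: assms)

lemma tendsto_iff_nrm: "(f \<longlongrightarrow> l) F \<longleftrightarrow> ((\<lambda>x. nrm (f x - l)) \<longlongrightarrow> 0) F"
  by (subst tendsto_dist_iff) (simp add: dist_eq)

text \<open>The classes of \<open>'a\<close> do not tie the field operations to the metric, so their
  continuity has to come from the ultrametric inequality.\<close>

lemma tendsto_nrm_add:
  fixes f g :: "'b \<Rightarrow> 'a"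
  assumes "(f \<longlongrightarrow> a) F" "(g \<longlongrightarrow> b) F"
  shows "((\<lambda>x. f x + g x) \<longlongrightarrow> a + b) F"
proof -
  have "((\<lambda>x. nrm (f x - a) + nrm (g x - b)) \<longlongrightarrow> 0) F"
    using tendsto_add[OF assms[unfolded tendsto_iff_nrm]] by simp
  moreover have "nrm (f x + g x - (a + b)) \<le> nrm (f x - a) + nrm (g x - b)" for x
  proof -
    have "nrm (f x + g x - (a + b)) = nrm ((f x - a) + (g x - b))"
      by (simp add: algebra_simps)
    also have "\<dots> \<le> max (nrm (f x - a)) (nrm (g x - b))"
      by (rule nrm_add_le)
    also have "\<dots> \<le> nrm (f x - a) + nrm (g x - b)"
      by simp
    finally show ?thesis .
  qed
  ultimately have "((\<lambda>x. nrm (f x + g x - (a + b))) \<longlongrightarrow> 0) F"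
    using tendsto_0_le_nonneg[where g = "\<lambda>x. nrm (f x - a) + nrm (g x - b)"] by simp
  then show ?thesis
    by (simp only: tendsto_iff_nrm)
qed

lemma tendsto_nrm:
  assumes "(f \<longlongrightarrow> a) F"
  shows "((\<lambda>x. nrm (f x)) \<longlongrightarrow> nrm a) F"
proof -
  have "((\<lambda>x. dist (f x) 0) \<longlongrightarrow> dist a 0) F"
    by (intro tendsto_intros assms)
  then show ?thesis
    by (simp add: dist_eq)
qed

lemma continuous_on_nrm: "continuous_on A nrm"
  unfolding continuous_on_def by (intro ballI tendsto_nrm tendsto_ident_at)

lemma tendsto_nrm_mult:
  fixes f g :: "'b \<Rightarrow> 'a"
  assumes "(f \<longlongrightarrow> a) F" "(g \<longlongrightarrow> b) F"
  shows "((\<lambda>x. f x * g x) \<longlongrightarrow> a * b) F"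
proof -
  have "((\<lambda>x. nrm (f x) * nrm (g x - b) + nrm (f x - a) * nrm b) \<longlongrightarrow> nrm a * 0 + 0 * nrm b) F"
    using assms[unfolded tendsto_iff_nrm] by (intro tendsto_intros tendsto_nrm assms)
  moreover have "nrm (f x * g x - a * b) \<le> nrm (f x) * nrm (g x - b) + nrm (f x - a) * nrm b" for x
  proof -
    have "nrm (f x * g x - a * b) = nrm (f x * (g x - b) + (f x - a) * b)"
      by (simp add: algebra_simps)
    also have "\<dots> \<le> max (nrm (f x * (g x - b))) (nrm ((f x - a) * b))"
      by (rule nrm_add_le)
    also have "\<dots> \<le> nrm (f x * (g x - b)) + nrm ((f x - a) * b)"
      by simp
    finally show ?thesis
      by (simp add: nrm_mult)
  qed
  ultimately have "((\<lambda>x. nrm (f x * g x - a * b)) \<longlongrightarrow> 0) F"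
    using tendsto_0_le_nonneg[where g = "\<lambda>x. nrm (f x) * nrm (g x - b) + nrm (f x - a) * nrm b"] by simp
  then show ?thesis
    by (simp only: tendsto_iff_nrm)
qed

lemma tendsto_poly_nrm:
  fixes f :: "'b \<Rightarrow> 'a"
  assumes "(f \<longlongrightarrow> a) F"
  shows "((\<lambda>x. poly P (f x)) \<longlongrightarrow> poly P a) F"
proof (induction P)
  case (pCons c P)
  then show ?case
    unfolding poly_pCons by (intro tendsto_nrm_add tendsto_nrm_mult tendsto_const assms)
qed simp

lemma continuous_on_poly_nrm: "continuous_on A (poly (P::'a poly))"
  unfolding continuous_on_def by (intro ballI tendsto_poly_nrm tendsto_ident_at)

lemma continuous_on_mult_left_nrm: "continuous_on A ((*) (c::'a))"
  unfolding continuous_on_def by (intro ballI tendsto_nrm_mult tendsto_const tendsto_ident_at)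

lemma continuous_on_add_left_nrm: "continuous_on A ((+) (c::'a))"
  unfolding continuous_on_def by (intro ballI tendsto_nrm_add tendsto_const tendsto_ident_at)

end

section \<open>Haar measure\<close>

locale haar_field = nonarch_field nrm
  for nrm :: "'a::{field, metric_space} \<Rightarrow> real" +
  fixes \<mu> :: "'a measure"
  assumes haar: "haar_measure \<mu>"
begin

lemma sets_mu [measurable_cong, simp]: "sets \<mu> = sets borel"
  using haar by (simp add: haar_measure_def)

lemma space_mu [simp]: "space \<mu> = UNIV"
  using sets_eq_imp_space_eq[OF sets_mu] by simp

lemma emeasure_translate: "A \<in> sets borel \<Longrightarrow> emeasure \<mu> ((+) x ` A) = emeasure \<mu> A"
  using haar by (simp add: haar_measure_def)

lemma emeasure_compact: "compact C \<Longrightarrow> emeasure \<mu> C < \<infinity>"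
  using haar by (simp add: haar_measure_def)

lemma borel_translate:
  assumes "A \<in> sets (borel :: 'a measure)"
  shows "(+) x ` A \<in> sets borel"
proof -
  have "(+) x ` A = (+) (- x) -` A \<inter> space borel"
    by (force simp: image_iff)
  moreover have "(+) (- x) \<in> borel_measurable (borel :: 'a measure)"
    by (intro borel_measurable_continuous_onI continuous_on_add_left_nrm)
  ultimately show ?thesis
    using measurable_sets[OF _ assms] by metis
qed

lemma borel_scale:
  assumes "A \<in> sets (borel :: 'a measure)" "c \<noteq> 0"
  shows "(*) c ` A \<in> sets borel"
proof -
  have "(*) c ` A = (*) (inverse c) -` A \<inter> space borel"
  proof (intro equalityI subsetI)
    fix x assume "x \<in> (*) (inverse c) -` A \<inter> space borel"
    then have "c * (inverse c * x) \<in> (*) c ` A"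
      by blast
    moreover have "c * (inverse c * x) = x"
      using assms(2) by (simp add: mult.assoc[symmetric])
    ultimately show "x \<in> (*) c ` A"
      by simp
  qed (use assms(2) in \<open>auto simp: mult.assoc[symmetric]\<close>)
  moreover have "(*) (inverse c) \<in> borel_measurable (borel :: 'a measure)"
    by (intro borel_measurable_continuous_onI continuous_on_mult_left_nrm)
  ultimately show ?thesis
    using measurable_sets[OF _ assms(1)] by metis
qed

lemma emeasure_cosets:
  assumes T: "finite T" and H: "H \<in> sets borel"
    and disj: "disjoint_family_on (\<lambda>t. (+) (f t) ` H) T"
  shows "emeasure \<mu> (\<Union>t\<in>T. (+) (f t) ` H) = of_nat (card T) * emeasure \<mu> H"
proof -
  have "emeasure \<mu> (\<Union>t\<in>T. (+) (f t) ` H) = (\<Sum>t\<in>T. emeasure \<mu> ((+) (f t) ` H))"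
    using T H disj by (intro sum_emeasure[symmetric]) (auto intro: borel_translate)
  also have "\<dots> = (\<Sum>t\<in>T. emeasure \<mu> H)"
    using H by (simp add: emeasure_translate)
  finally show ?thesis
    by simp
qed

definition add_subgroup :: "'a set \<Rightarrow> bool" where
  "add_subgroup G \<longleftrightarrow> 0 \<in> G \<and> (\<forall>x\<in>G. \<forall>y\<in>G. x - y \<in> G)"

lemma add_subgroupD:
  assumes "add_subgroup G"
  shows "0 \<in> G" "x \<in> G \<Longrightarrow> y \<in> G \<Longrightarrow> x - y \<in> G" "x \<in> G \<Longrightarrow> y \<in> G \<Longrightarrow> x + y \<in> G"
proof -
  show "0 \<in> G" and diff: "x \<in> G \<Longrightarrow> y \<in> G \<Longrightarrow> x - y \<in> G" for x y
    using assms by (auto simp: add_subgroup_def)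
  show "x \<in> G \<Longrightarrow> y \<in> G \<Longrightarrow> x + y \<in> G"
    using diff[OF _ diff[OF \<open>0 \<in> G\<close>, of y], of x] by simp
qed

lemma translate_iff: "z \<in> (+) x ` A \<longleftrightarrow> z - x \<in> (A :: 'a set)"
  by (force simp: image_iff)

lemma coset_eq:
  assumes H: "add_subgroup H" and "z \<in> (+) x ` H"
  shows "(+) z ` H = (+) x ` H"
proof -
  have zx: "z - x \<in> H"
    using assms(2) by (simp add: translate_iff)
  have "y - z \<in> H \<longleftrightarrow> y - x \<in> H" for y
    using add_subgroupD(2)[OF H _ zx, of "y - x"] add_subgroupD(3)[OF H _ zx, of "y - z"] by auto
  then show ?thesis
    unfolding set_eq_iff translate_iff by simp
qed

text \<open>Distinct cosets of \<open>H\<close> are disjoint, have the same positive measure and lie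
  in \<open>G\<close>, so any finite number of them is bounded by the quotient of the measures of
  \<open>G\<close> and \<open>H\<close>. Finiteness of measure thus becomes finiteness of an
  index.\<close>

lemma finite_index:
  assumes G: "add_subgroup G" "G \<in> sets borel" "emeasure \<mu> G < \<infinity>"
    and H: "add_subgroup H" "H \<in> sets borel" "H \<subseteq> G" "emeasure \<mu> H \<noteq> 0"
  obtains T where "finite T" "T \<subseteq> G" "G = (\<Union>t\<in>T. (+) t ` H)"
    "disjoint_family_on (\<lambda>t. (+) t ` H) T"
proof -
  define Q where "Q = (\<lambda>x. (+) x ` H) ` G"
  define rep where "rep C = (SOME x. x \<in> G \<and> C = (+) x ` H)" for C
  have rep: "rep C \<in> G" "(+) (rep C) ` H = C" if "C \<in> Q" for C
  proof -
    have "\<exists>x. x \<in> G \<and> C = (+) x ` H"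
      using that unfolding Q_def by blast
    from someI_ex[OF this] show "rep C \<in> G" "(+) (rep C) ` H = C"
      unfolding rep_def[symmetric] by auto
  qed
  have sub: "(+) x ` H \<subseteq> G" if "x \<in> G" for x
    using add_subgroupD(3)[OF G(1) that] H(3) by auto
  have inj: "inj_on rep Q"
    using rep(2) by (rule inj_on_inverseI)
  have disjQ: "disjoint_family_on (\<lambda>t. (+) t ` H) (rep ` Q)"
    unfolding disjoint_family_on_def
  proof (intro ballI impI)
    fix s t assume st: "s \<in> rep ` Q" "t \<in> rep ` Q" "s \<noteq> t"
    then obtain C D where CD: "C \<in> Q" "D \<in> Q" "s = rep C" "t = rep D" by blast
    show "(+) s ` H \<inter> (+) t ` H = {}"
    proof (rule ccontr)
      assume "(+) s ` H \<inter> (+) t ` H \<noteq> {}"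
      then obtain z where "z \<in> (+) s ` H" "z \<in> (+) t ` H" by blast
      then have "(+) s ` H = (+) t ` H"
        using coset_eq[OF H(1), of z s] coset_eq[OF H(1), of z t] by simp
      then have "C = D"
        using rep(2)[OF CD(1)] rep(2)[OF CD(2)] CD(3,4) by simp
      then show False
        using st CD by simp
    qed
  qed
  obtain g where g: "emeasure \<mu> G = ennreal g" "0 \<le> g"
    using G(3) by (cases "emeasure \<mu> G") auto
  have "emeasure \<mu> H \<le> emeasure \<mu> G"
    using H(3) G(2) by (intro emeasure_mono) simp_all
  then obtain h where h: "emeasure \<mu> H = ennreal h" "0 \<le> h"
    using g by (cases "emeasure \<mu> H") (auto simp: top_unique)
  have h0: "0 < h"
    using h H(4) by (cases "h = 0") auto
  have card: "real (card K) * h \<le> g" if K: "K \<subseteq> Q" "finite K" for K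
  proof -
    have "of_nat (card K) * emeasure \<mu> H = emeasure \<mu> (\<Union>t\<in>rep ` K. (+) t ` H)"
      using emeasure_cosets[of "rep ` K" H "\<lambda>t. t"] K H(2) disjQ
        card_image[OF inj_on_subset[OF inj K(1)]]
      by (simp add: disjoint_family_on_mono[OF image_mono[OF K(1)]])
    also have "\<dots> \<le> emeasure \<mu> G"
    proof (rule emeasure_mono)
      show "(\<Union>t\<in>rep ` K. (+) t ` H) \<subseteq> G"
        using sub rep(1) K(1) by blast
    qed (simp add: G(2))
    finally have "ennreal (real (card K) * h) \<le> ennreal g"
      using g h by (simp add: ennreal_mult ennreal_of_nat_eq_real_of_nat)
    then show ?thesis
      using g by simp
  qed
  have "card K \<le> nat \<lfloor>g / h\<rfloor>" if "K \<subseteq> Q" "finite K" for K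
    using card[OF that] h0 by (simp add: le_nat_floor pos_le_divide_eq)
  then have "finite Q"
    using finite_if_finite_subsets_card_bdd by blast
  moreover have "rep ` Q \<subseteq> G"
    using rep(1) by blast
  moreover have "G = (\<Union>t\<in>rep ` Q. (+) t ` H)"
  proof (intro equalityI subsetI)
    fix x assume x: "x \<in> G"
    then have "(+) x ` H \<in> Q"
      unfolding Q_def by blast
    moreover have "x \<in> (+) x ` H"
      using add_subgroupD(1)[OF H(1)] by (simp add: translate_iff)
    ultimately show "x \<in> (\<Union>t\<in>rep ` Q. (+) t ` H)"
      using rep(2)[of "(+) x ` H"] by blast
  next
    fix x assume "x \<in> (\<Union>t\<in>rep ` Q. (+) t ` H)"
    then show "x \<in> G"
      using rep(1) sub by blast
  qed
  ultimately show ?thesis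
    using disjQ that[of "rep ` Q"] by blast
qed

text \<open>Multiplication by a nonzero \<open>c\<close> is additive and injective, so it carries a
  disjoint coset decomposition to one with equally many cosets.\<close>

lemma scale_cosets:
  assumes "c \<noteq> 0" "G = (\<Union>t\<in>T. (+) t ` H)" "disjoint_family_on (\<lambda>t. (+) t ` H) T"
  shows "(*) c ` G = (\<Union>t\<in>T. (+) (c * t) ` (*) c ` (H :: 'a set))"
    and "disjoint_family_on (\<lambda>t. (+) (c * t) ` (*) c ` H) T"
proof -
  have *: "(+) (c * t) ` (*) c ` H = (*) c ` (+) t ` H" for t
    by (simp add: image_image distrib_left)
  show "(*) c ` G = (\<Union>t\<in>T. (+) (c * t) ` (*) c ` (H :: 'a set))"
    unfolding * assms(2) by blast
  have "inj ((*) c)"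
    using assms(1) by (simp add: inj_def)
  then show "disjoint_family_on (\<lambda>t. (+) (c * t) ` (*) c ` H) T"
    using assms(3) unfolding * disjoint_family_on_def by (simp add: image_Int[symmetric])
qed

text \<open>Scaling preserves the index of \<open>H\<close> in \<open>G\<close>, so multiplication
  by \<open>c\<close> changes both measures by the same factor. This allows the factor of
  \<open>p\<close> to be computed on a lattice and transferred to the ring of integers. The product
  form avoids division in \<open>ennreal\<close>.\<close>

lemma emeasure_scale_ratio:
  assumes G: "add_subgroup G" "G \<in> sets borel" "emeasure \<mu> G < \<infinity>"
    and H: "add_subgroup H" "H \<in> sets borel" "H \<subseteq> G" "emeasure \<mu> H \<noteq> 0" and c: "c \<noteq> 0"
  shows "emeasure \<mu> ((*) c ` G) * emeasure \<mu> H = emeasure \<mu> ((*) c ` H) * emeasure \<mu> G"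
proof -
  obtain T where T: "finite T" "T \<subseteq> G" "G = (\<Union>t\<in>T. (+) t ` H)" "disjoint_family_on (\<lambda>t. (+) t ` H) T"
    using finite_index[OF G H] by blast
  have "emeasure \<mu> G = of_nat (card T) * emeasure \<mu> H"
    using emeasure_cosets[OF T(1) H(2) T(4)] unfolding T(3)[symmetric] .
  moreover have "emeasure \<mu> ((*) c ` G) = of_nat (card T) * emeasure \<mu> ((*) c ` H)"
    using emeasure_cosets[OF T(1) borel_scale[OF H(2) c] scale_cosets(2)[OF c T(3,4)]]
    unfolding scale_cosets(1)[OF c T(3,4), symmetric] .
  ultimately show ?thesis
    by (simp add: mult_ac)
qed

end

section \<open>Uniformizer, value group, residue classes and the measure of balls\<close>

context haar_field
begin

abbreviation R where "R \<equiv> integers_ring nrm"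

lemma add_subgroup_R: "add_subgroup R"
  by (auto simp: add_subgroup_def intro: integers_ring_diff)

lemma borel_R [measurable]: "R \<in> sets borel"
  unfolding integers_ring_eq_cball by (intro borel_closed closed_cball)

lemma scale_R_eq_cball:
  assumes "c \<noteq> 0"
  shows "(*) c ` R = cball 0 (nrm c)"
proof (intro equalityI subsetI)
  fix x :: 'a assume "x \<in> cball 0 (nrm c)"
  then have "nrm x \<le> nrm c"
    unfolding mem_cball_iff by simp
  then have "x / c \<in> R"
    using assms by (intro integers_ringI) (simp add: nrm_divide)
  moreover have "x = c * (x / c)"
    using assms by simp
  ultimately show "x \<in> (*) c ` R"
    by blast
next
  fix x assume "x \<in> (*) c ` R"
  then obtain y where "y \<in> R" "x = c * y" by blast
  then have "nrm x \<le> nrm c"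
    by (simp add: nrm_mult integers_ring_def mult_left_le)
  then show "x \<in> cball 0 (nrm c)"
    unfolding mem_cball_iff by simp
qed

lemma add_subgroup_scale:
  assumes "add_subgroup G"
  shows "add_subgroup ((*) c ` G)"
proof -
  have "c * x - c * y \<in> (*) c ` G" if "x \<in> G" "y \<in> G" for x y
    unfolding right_diff_distrib[symmetric] by (rule imageI[OF add_subgroupD(2)[OF assms that]])
  moreover have "0 \<in> (*) c ` G"
    using imageI[OF add_subgroupD(1)[OF assms], of "(*) c"] by simp
  ultimately show ?thesis
    unfolding add_subgroup_def by blast
qed

text \<open>The open unit ball is also closed, hence compact inside \<open>R\<close>, so
  \<open>nrm\<close> attains its maximum on it. The element \<open>z\<close> keeps this maximum away
  from 0, so the maximizer is a uniformizer.\<close>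

lemma ex_maximal_nrm:
  assumes "compact R" "z \<noteq> 0" "nrm z < 1"
  shows "\<exists>\<pi>. \<pi> \<noteq> 0 \<and> nrm \<pi> < 1 \<and> (\<forall>x. nrm x < 1 \<longrightarrow> nrm x \<le> nrm \<pi>)"
proof -
  have "closed (ball (0::'a) 1)"
    unfolding closed_def open_dist
  proof
    fix x :: 'a assume "x \<in> - ball 0 1"
    then have x: "1 \<le> nrm x"
      unfolding Compl_iff mem_ball_iff by simp
    have "y \<in> - ball 0 1" if "dist y x < 1" for y
    proof -
      have "nrm (x - y) < nrm x"
        using that x by (simp add: dist_eq nrm_minus_commute[of x y])
      then show ?thesis
        using nrm_eq_if_close[of x y] x unfolding Compl_iff mem_ball_iff by simp
    qed
    then show "\<exists>e>0. \<forall>y. dist y x < e \<longrightarrow> y \<in> - ball 0 1"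
      by (intro exI[of _ 1]) simp
  qed
  then have "compact (R \<inter> ball 0 1)"
    using assms(1) by (intro compact_Int_closed)
  moreover have "R \<inter> ball 0 1 = ball 0 1"
    unfolding integers_ring_eq_cball using ball_subset_cball by blast
  ultimately have "compact (ball (0::'a) 1)"
    by simp
  moreover have z: "z \<in> ball 0 1"
    using assms(3) unfolding mem_ball_iff by simp
  ultimately obtain \<pi> where \<pi>: "\<pi> \<in> ball 0 1" "\<And>x. x \<in> ball 0 1 \<Longrightarrow> nrm x \<le> nrm \<pi>"
    using continuous_attains_sup[of "ball 0 1" nrm] continuous_on_nrm by blast
  have "nrm z \<le> nrm \<pi>"
    by (rule \<pi>(2)[OF z])
  then have "\<pi> \<noteq> 0"
    using assms(2) less_le_trans[of 0 "nrm z" "nrm \<pi>"] by simp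
  then show ?thesis
    using \<pi> unfolding mem_ball_iff by (intro exI[of _ \<pi>]) simp
qed

context
  fixes \<pi> :: 'a
  assumes \<pi>: "\<pi> \<noteq> 0" "nrm \<pi> < 1" "\<And>x. nrm x < 1 \<Longrightarrow> nrm x \<le> nrm \<pi>"
begin

text \<open>Discreteness of the value group: dividing \<open>x\<close> by the last power of
  \<open>\<pi>\<close> whose absolute value is not below \<open>nrm x\<close> gives a value above
  \<open>nrm \<pi>\<close> and at most 1. Maximality of \<open>nrm \<pi>\<close> leaves only the
  value 1.\<close>

lemma nrm_eq_power:
  assumes x: "x \<noteq> 0" "nrm x \<le> 1"
  shows "\<exists>k. nrm x = nrm \<pi> ^ k"
proof -
  have ex: "\<exists>k. nrm \<pi> ^ k < nrm x"
    using real_arch_pow_inv[of "nrm x" "nrm \<pi>"] x \<pi> by simp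
  define l where "l = (LEAST k. nrm \<pi> ^ k < nrm x)"
  have l: "nrm \<pi> ^ l < nrm x"
    unfolding l_def by (rule LeastI_ex[OF ex])
  then have "l \<noteq> 0"
    using x(2) by (intro notI) simp
  then obtain k where k: "l = Suc k"
    using not0_implies_Suc by blast
  have "\<not> nrm \<pi> ^ k < nrm x"
    using not_less_Least[of k "\<lambda>k. nrm \<pi> ^ k < nrm x"] k unfolding l_def by simp
  have pos: "0 < nrm \<pi> ^ k"
    using \<pi>(1) by simp
  have y: "nrm (x / \<pi> ^ k) = nrm x / nrm \<pi> ^ k"
    by (simp add: nrm_divide nrm_power)
  have "nrm \<pi> < nrm (x / \<pi> ^ k)"
    using l pos unfolding y k by (simp add: pos_less_divide_eq mult.commute)
  then have "\<not> nrm (x / \<pi> ^ k) < 1"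
    using \<pi>(3)[of "x / \<pi> ^ k"] by linarith
  moreover have "nrm (x / \<pi> ^ k) \<le> 1"
    using \<open>\<not> nrm \<pi> ^ k < nrm x\<close> pos unfolding y by simp
  ultimately have "nrm x / nrm \<pi> ^ k = 1"
    unfolding y by linarith
  then have "nrm x = nrm \<pi> ^ k"
    using pos by simp
  then show ?thesis ..
qed

lemma mem_maximal_ideal_iff: "z \<in> (*) \<pi> ` R \<longleftrightarrow> nrm z < 1"
  unfolding scale_R_eq_cball[OF \<pi>(1)] mem_cball_iff using \<pi>(2) \<pi>(3)[of z] by auto

lemma residue_class_eq:
  assumes "x \<in> R"
  shows "{(x, y). x \<in> R \<and> y \<in> R \<and> nrm (x - y) < 1} `` {x} = (+) x ` (*) \<pi> ` R"
proof -
  have "y \<in> R \<and> nrm (x - y) < 1 \<longleftrightarrow> nrm (y - x) < 1" for y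
    using integers_ring_add[of "y - x" x] assms integers_ringI[of "y - x"] nrm_minus_commute[of x y] by auto
  then show ?thesis
    unfolding set_eq_iff translate_iff mem_maximal_ideal_iff using assms by simp
qed

text \<open>The classes counted by \<open>residue_card\<close> are the cosets of the maximal ideal,
  so \<open>finite_index\<close> applies. At least two exist because 0 and 1 are not congruent.
  Positive measure of the ideal is assumed here and supplied later from the measure of
  \<open>p R\<close>.\<close>

lemma residue_cosets:
  assumes norm: "emeasure \<mu> R = 1" and pos: "emeasure \<mu> ((*) \<pi> ` R) \<noteq> 0"
  obtains T where "finite T" "card T = residue_card nrm" "2 \<le> card T"
    "R = (\<Union>t\<in>T. (+) t ` (*) \<pi> ` R)" "disjoint_family_on (\<lambda>t. (+) t ` (*) \<pi> ` R) T"
proof -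
  have sub: "(*) \<pi> ` R \<subseteq> R"
    by (intro subsetI integers_ringI) (simp only: mem_maximal_ideal_iff less_imp_le)
  obtain T where T: "finite T" "T \<subseteq> R" "R = (\<Union>t\<in>T. (+) t ` (*) \<pi> ` R)"
    "disjoint_family_on (\<lambda>t. (+) t ` (*) \<pi> ` R) T"
    using finite_index[OF add_subgroup_R borel_R _ add_subgroup_scale[OF add_subgroup_R] borel_scale[OF borel_R \<pi>(1)] sub pos]
      norm by auto
  have self: "t \<in> (+) t ` (*) \<pi> ` R" for t
    unfolding translate_iff mem_maximal_ideal_iff by simp
  have "R // {(x, y). x \<in> R \<and> y \<in> R \<and> nrm (x - y) < 1} = (\<lambda>x. (+) x ` (*) \<pi> ` R) ` R"
    unfolding quotient_def using residue_class_eq by blast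
  also have "\<dots> = (\<lambda>x. (+) x ` (*) \<pi> ` R) ` T"
  proof (intro equalityI subsetI)
    fix C assume "C \<in> (\<lambda>x. (+) x ` (*) \<pi> ` R) ` R"
    then obtain x where x: "x \<in> R" "C = (+) x ` (*) \<pi> ` R" by blast
    then obtain t where t: "t \<in> T" "x \<in> (+) t ` (*) \<pi> ` R"
      using T(3) by blast
    then have "C = (+) t ` (*) \<pi> ` R"
      unfolding x(2) by (intro coset_eq add_subgroup_scale add_subgroup_R)
    then show "C \<in> (\<lambda>x. (+) x ` (*) \<pi> ` R) ` T"
      using t(1) by blast
  qed (use T(2) in blast)
  finally have "residue_card nrm = card ((\<lambda>x. (+) x ` (*) \<pi> ` R) ` T)"
    unfolding residue_card_def by simp
  also have "\<dots> = card T"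
  proof (rule card_image, rule inj_onI, rule ccontr)
    fix s t assume st: "s \<in> T" "t \<in> T" "(+) s ` (*) \<pi> ` R = (+) t ` (*) \<pi> ` R" "s \<noteq> t"
    then have "(+) s ` (*) \<pi> ` R \<inter> (+) t ` (*) \<pi> ` R = {}"
      using T(4) unfolding disjoint_family_on_def by blast
    then show False
      using st(3) self[of s] by blast
  qed
  finally have card: "card T = residue_card nrm"
    by (rule sym)
  have "2 \<le> card T"
  proof (rule ccontr)
    obtain s t where st: "s \<in> T" "t \<in> T" "0 \<in> (+) s ` (*) \<pi> ` R" "1 \<in> (+) t ` (*) \<pi> ` R"
      using T(3) integers_ring_0 integers_ring_1 by blast
    assume "\<not> 2 \<le> card T"
    then have "card T \<le> Suc 0"
      by simp
    then have "s = t"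
      using st(1,2) card_le_Suc0_iff_eq[OF T(1)] by blast
    then have "nrm (0 - s) < 1" "nrm (1 - s) < 1"
      using st(3,4) unfolding translate_iff mem_maximal_ideal_iff by simp_all
    then have "nrm ((1 - s) - (0 - s)) < 1"
      using nrm_diff_le[of "1 - s" "0 - s"] by linarith
    then show False
      by simp
  qed
  then show ?thesis
    using that T card by blast
qed

text \<open>Scaling the residue decomposition shows that each ball around 0 of radius
  \<open>nrm \<pi> ^ k\<close> is a disjoint union of \<open>q\<close> translates of the next
  smaller one; induction on \<open>k\<close> then divides the measure by \<open>q\<close> at each
  step.\<close>

lemma emeasure_cball_power:
  assumes norm: "emeasure \<mu> R = 1" and pos: "emeasure \<mu> ((*) \<pi> ` R) \<noteq> 0"
  shows "2 \<le> residue_card nrm"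
    and "emeasure \<mu> (cball x (nrm \<pi> ^ k)) = ennreal (1 / real (residue_card nrm) ^ k)"
proof -
  obtain T where T: "finite T" "card T = residue_card nrm" "2 \<le> card T"
    "R = (\<Union>t\<in>T. (+) t ` (*) \<pi> ` R)" "disjoint_family_on (\<lambda>t. (+) t ` (*) \<pi> ` R) T"
    using residue_cosets[OF norm pos] by blast
  define q where "q = residue_card nrm"
  have q: "2 \<le> q"
    using T by (simp add: q_def)
  then show "2 \<le> residue_card nrm"
    by (simp add: q_def)
  have step: "emeasure \<mu> ((*) (\<pi> ^ k) ` R) = of_nat q * emeasure \<mu> ((*) (\<pi> ^ Suc k) ` R)" for k
  proof -
    have \<pi>k: "\<pi> ^ k \<noteq> 0"
      using \<pi>(1) by simp
    have "(*) (\<pi> ^ k) ` (*) \<pi> ` R = (*) (\<pi> ^ Suc k) ` R"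
      unfolding image_image by (simp add: mult_ac)
    then show ?thesis
      using emeasure_cosets[OF T(1) borel_scale[OF borel_scale[OF borel_R \<pi>(1)] \<pi>k] scale_cosets(2)[OF \<pi>k T(4,5)]]
      unfolding scale_cosets(1)[OF \<pi>k T(4,5), symmetric] T(2) q_def by simp
  qed
  have pow: "emeasure \<mu> ((*) (\<pi> ^ k) ` R) = ennreal (1 / real q ^ k)" for k
  proof (induction k)
    case 0
    then show ?case
      using norm by simp
  next
    case (Suc k)
    have eq: "of_nat q * emeasure \<mu> ((*) (\<pi> ^ Suc k) ` R) = ennreal (1 / real q ^ k)"
      using step[of k] Suc by simp
    then have "emeasure \<mu> ((*) (\<pi> ^ Suc k) ` R) \<noteq> top"
      using q by (auto simp: ennreal_mult_eq_top_iff)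
    then obtain a where a: "emeasure \<mu> ((*) (\<pi> ^ Suc k) ` R) = ennreal a" "0 \<le> a"
      by (cases "emeasure \<mu> ((*) (\<pi> ^ Suc k) ` R)") auto
    have "ennreal (real q * a) = ennreal (1 / real q ^ k)"
      using eq a by (simp add: ennreal_mult ennreal_of_nat_eq_real_of_nat)
    then have "real q * a = 1 / real q ^ k"
      using a by (subst (asm) ennreal_inj) auto
    then have "a = 1 / real q ^ Suc k"
      using q by (simp add: field_simps)
    then show ?case
      using a by simp
  qed
  have "cball x (nrm \<pi> ^ k) = (+) x ` (*) (\<pi> ^ k) ` R"
  proof -
    have "\<pi> ^ k \<noteq> 0"
      using \<pi>(1) by simp
    then have "(*) (\<pi> ^ k) ` R = cball 0 (nrm \<pi> ^ k)"
      by (simp add: scale_R_eq_cball nrm_power)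
    then show ?thesis
      unfolding set_eq_iff translate_iff mem_cball_iff by (simp add: mem_cball_iff del: mem_cball)
  qed
  then show "emeasure \<mu> (cball x (nrm \<pi> ^ k)) = ennreal (1 / real (residue_card nrm) ^ k)"
    using emeasure_translate[OF borel_scale[OF borel_R, of "\<pi> ^ k"]] \<pi>(1) pow[of k]
    by (simp add: q_def)
qed

end

end

section \<open>Local fields\<close>

text \<open>The facts about the field on which the area formula and the moment computations rest.
  The axiom \<open>emeasure_cball\<close> says that the measure of a ball is its radius, that is,
  that \<open>nrm\<close> is the factor by which multiplication scales the Haar measure.\<close>

locale local_field = haar_field nrm \<mu>
  for nrm :: "'a::{field, metric_space} \<Rightarrow> real" and \<mu> :: "'a measure" +
  fixes q :: nat
  assumes compact_integers: "compact (integers_ring nrm)"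
    and of_nat_neq_0: "\<And>m. 0 < m \<Longrightarrow> of_nat m \<noteq> (0::'a)"
    and q_ge_2: "2 \<le> q"
    and nrm_cases: "\<And>x. x \<noteq> 0 \<Longrightarrow> nrm x \<le> 1 \<Longrightarrow> \<exists>k. nrm x = 1 / real q ^ k"
    and ex_uniformizer: "\<exists>\<pi>. nrm \<pi> = 1 / real q"
    and emeasure_cball: "\<And>x k. emeasure \<mu> (cball x (1 / real q ^ k)) = ennreal (1 / real q ^ k)"
begin

definition rad :: "nat \<Rightarrow> real" where "rad k = 1 / real q ^ k"

lemma rad_pos [simp]: "0 < rad k"
  using q_ge_2 by (simp add: rad_def)

lemma rad_nonneg [simp]: "0 \<le> rad k"
  using rad_pos[of k] by linarith

lemma rad_0 [simp]: "rad 0 = 1"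
  by (simp add: rad_def)

lemma rad_antimono: "j \<le> k \<Longrightarrow> rad k \<le> rad j"
  using q_ge_2 by (simp add: rad_def frac_le power_increasing)

lemma rad_le_1: "rad k \<le> 1"
  using rad_antimono[of 0 k] by simp

lemma rad_strict_antimono: "j < k \<Longrightarrow> rad k < rad j"
  using q_ge_2 by (simp add: rad_def frac_less2 power_strict_increasing)

lemma rad_less_iff: "rad k < rad j \<longleftrightarrow> j < k"
  by (metis rad_antimono rad_strict_antimono not_le)

lemma rad_le_iff: "rad k \<le> rad j \<longleftrightarrow> j \<le> k"
  by (metis rad_less_iff not_le)

lemma rad_add: "rad (j + k) = rad j * rad k"
  by (simp add: rad_def power_add)

lemma rad_small: "0 < e \<Longrightarrow> \<exists>k. rad k < e"
  using real_arch_pow_inv[of e "1 / real q"] q_ge_2 by (auto simp: rad_def power_one_over)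

lemma nrm_eq_rad: "x \<noteq> 0 \<Longrightarrow> nrm x \<le> 1 \<Longrightarrow> \<exists>k. nrm x = rad k"
  using nrm_cases by (simp add: rad_def)

lemma emeasure_cball_rad: "emeasure \<mu> (cball x (rad k)) = ennreal (rad k)"
  unfolding rad_def by (rule emeasure_cball)

lemma R_eq_cball: "R = cball 0 (rad 0)"
  by (simp add: integers_ring_eq_cball)

lemma emeasure_R: "emeasure \<mu> R = 1"
  using emeasure_cball_rad[of 0 0] by (simp add: R_eq_cball)

lemma borel_cball [measurable]: "cball (x::'a) r \<in> sets borel"
  by (intro borel_closed closed_cball)

text \<open>Compactness of \<open>R\<close> gives finite nets of every mesh, and dividing them by
  powers of a uniformizer spreads them over the whole field. This separability carries the later
  measurability arguments.\<close>

lemma ex_dense_seq: "\<exists>d :: nat \<Rightarrow> 'a. \<forall>x. \<forall>e>0. \<exists>i. nrm (x - d i) < e"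
proof -
  obtain \<pi> where \<pi>: "nrm \<pi> = 1 / real q"
    using ex_uniformizer by blast
  then have \<pi>0: "\<pi> \<noteq> 0"
    using q_ge_2 by auto
  have "\<forall>m. \<exists>F. finite F \<and> R \<subseteq> (\<Union>x\<in>F. ball x (1 / Suc m))"
    using compact_integers unfolding compact_eq_totally_bounded by auto
  then obtain F where F: "\<And>m. finite (F m)" "\<And>m. R \<subseteq> (\<Union>x\<in>F m. ball x (1 / Suc m))"
    by metis
  define D where "D = (\<Union>j. \<Union>m. (\<lambda>d. d / \<pi> ^ j) ` F m)"
  have cD: "countable D"
    unfolding D_def by (simp add: countable_finite F(1))
  have dense: "\<exists>d\<in>D. nrm (x - d) < e" if "0 < e" for x e
  proof -
    obtain j where j: "nrm x < real q ^ j"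
      using real_arch_pow[of "real q" "nrm x"] q_ge_2 by auto
    have qj: "0 < real q ^ j"
      using q_ge_2 by simp
    have n\<pi>: "nrm (\<pi> ^ j) = 1 / real q ^ j"
      by (simp add: nrm_power \<pi> power_one_over)
    have "\<pi> ^ j * x \<in> R"
      using j qj by (intro integers_ringI) (simp add: nrm_mult n\<pi>)
    moreover obtain m where m: "1 / Suc m < e / real q ^ j"
      using nat_approx_posE[OF divide_pos_pos[OF \<open>0 < e\<close> qj]] by blast
    ultimately obtain d where d: "d \<in> F m" "\<pi> ^ j * x \<in> ball d (1 / Suc m)"
      using F(2) by blast
    then have "nrm (\<pi> ^ j * x - d) < e / real q ^ j"
      using m unfolding mem_ball_iff by simp
    moreover have "nrm (x - d / \<pi> ^ j) = nrm (\<pi> ^ j * x - d) * real q ^ j"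
    proof -
      have "x - d / \<pi> ^ j = (\<pi> ^ j * x - d) / \<pi> ^ j"
        using \<pi>0 by (simp add: field_simps)
      then show ?thesis
        by (simp add: nrm_divide n\<pi>)
    qed
    ultimately have "nrm (x - d / \<pi> ^ j) < e"
      using qj by (simp add: field_simps)
    then show ?thesis
      using d(1) unfolding D_def by blast
  qed
  have "D \<noteq> {}"
    using dense[of 1 0] by auto
  then have "range (from_nat_into D) = D"
    using cD by (rule range_from_nat_into)
  then have "\<forall>x. \<forall>e>0. \<exists>i. nrm (x - from_nat_into D i) < e"
    using dense by (metis rangeE)
  then show ?thesis
    by (rule exI[where P = "\<lambda>d. \<forall>x. \<forall>e>0. \<exists>i. nrm (x - d i) < e"])
qed

definition dseq :: "nat \<Rightarrow> 'a" where
  "dseq = (SOME d. \<forall>x. \<forall>e>0. \<exists>i. nrm (x - d i) < e)"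

lemma dseq: "0 < e \<Longrightarrow> \<exists>i. nrm (x - dseq i) < e"
  using someI_ex[OF ex_dense_seq] unfolding dseq_def by blast

lemma open_eq_Union_cball:
  assumes "open (S :: 'a set)"
  shows "S = (\<Union>(i, k) \<in> {(i, k). cball (dseq i) (rad k) \<subseteq> S}. cball (dseq i) (rad k))"
proof (intro equalityI subsetI)
  fix x assume "x \<in> S"
  then obtain e where e: "e > 0" "cball x e \<subseteq> S"
    using assms open_contains_cball by blast
  obtain k where k: "rad k < e"
    using rad_small e(1) by blast
  obtain i where i: "nrm (x - dseq i) < rad k"
    using dseq rad_pos by blast
  then have x: "x \<in> cball (dseq i) (rad k)"
    unfolding mem_cball_iff by simp
  moreover have "cball (dseq i) (rad k) \<subseteq> S"
    using cball_recenter[OF x] e(2) k subset_cball[of "rad k" e x] by auto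
  ultimately show "x \<in> (\<Union>(i, k) \<in> {(i, k). cball (dseq i) (rad k) \<subseteq> S}. cball (dseq i) (rad k))"
    by blast
qed auto

text \<open>Two balls that meet are nested, so adding the empty set makes this family closed under
  intersection, as uniqueness of measures requires.\<close>

definition rballs :: "'a set set" where
  "rballs = insert {} {cball x (rad k) | x k. True}"

lemma sets_borel_eq_rballs: "sets (borel :: 'a measure) = sigma_sets UNIV rballs"
proof
  show "sets (borel :: 'a measure) \<subseteq> sigma_sets UNIV rballs"
    unfolding borel_def
  proof (subst sets_measure_of, simp, rule sigma_sets_mono, rule subsetI)
    fix S :: "'a set" assume "S \<in> {S. open S}"
    then have "open S" by simp
    have "(\<Union>(i, k) \<in> {(i, k). cball (dseq i) (rad k) \<subseteq> S}. cball (dseq i) (rad k))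
        \<in> sigma_sets UNIV rballs"
      by (rule sigma_sets_UNION) (auto simp: rballs_def intro!: countable_image sigma_sets.Basic)
    then show "S \<in> sigma_sets UNIV rballs"
      using open_eq_Union_cball[OF \<open>open S\<close>] by simp
  qed
  have "rballs \<subseteq> sets (borel :: 'a measure)"
    by (auto simp: rballs_def)
  then show "sigma_sets UNIV rballs \<subseteq> sets (borel :: 'a measure)"
    using sets.sigma_sets_subset[of rballs borel] by simp
qed

lemma Int_stable_rballs: "Int_stable rballs"
proof (rule Int_stableI)
  fix A B assume AB: "A \<in> rballs" "B \<in> rballs"
  show "A \<inter> B \<in> rballs"
  proof (cases "A \<inter> B = {}")
    case False
    then obtain z where z: "z \<in> A" "z \<in> B" by blast
    then obtain x k y j where "A = cball x (rad k)" "B = cball y (rad j)"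
      using AB by (auto simp: rballs_def)
    then have *: "A = cball z (rad k)" "B = cball z (rad j)"
      using z cball_recenter by auto
    have "A \<inter> B = cball z (rad (max k j))"
      unfolding * using rad_antimono[of k j] rad_antimono[of j k]
      by (cases "k \<le> j") (auto simp: max_def)
    then show ?thesis
      by (auto simp: rballs_def)
  qed (simp add: rballs_def)
qed

text \<open>Balls form an intersection-stable generator and countably many unit balls cover the
  field. It serves to identify the push-forward of the Haar measure under a polynomial.\<close>

lemma measure_eqI_rballs:
  assumes "sets M = sets (borel :: 'a measure)" "sets N = sets (borel :: 'a measure)"
    and eq: "\<And>x k. emeasure M (cball x (rad k)) = emeasure N (cball x (rad k))"
    and fin: "\<And>x. emeasure M (cball x (rad 0)) \<noteq> \<infinity>"
  shows "M = N"
proof (rule measure_eqI_generator_eq_countable[OF Int_stable_rballs])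
  show "sets M = sigma_sets UNIV rballs" "sets N = sigma_sets UNIV rballs"
    using assms(1,2) sets_borel_eq_rballs by auto
  show "range (\<lambda>i. cball (dseq i) (rad 0)) \<subseteq> rballs"
    unfolding rballs_def by blast
  show "\<Union> (range (\<lambda>i. cball (dseq i) (rad 0))) = UNIV"
  proof -
    have "\<exists>i. x \<in> cball (dseq i) (rad 0)" for x
      using dseq[of 1 x] unfolding mem_cball_iff by (auto intro: less_imp_le)
    then show ?thesis by blast
  qed
qed (use eq fin in \<open>auto simp: rballs_def\<close>)

section \<open>Measurability of the field operations\<close>

lemma borel_measurable_nrm [measurable]: "nrm \<in> borel_measurable borel"
  by (intro borel_measurable_continuous_onI continuous_on_nrm)

text \<open>A measurable choice of a nearby point of the dense sequence: every Borel function
  becomes a pointwise limit of measurable functions with countable range.\<close>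

definition dindex :: "nat \<Rightarrow> 'a \<Rightarrow> nat" where
  "dindex n x = (LEAST i. nrm (x - dseq i) < 1 / Suc n)"

lemma dindex: "nrm (x - dseq (dindex n x)) < 1 / Suc n"
  unfolding dindex_def by (rule LeastI_ex, rule dseq) simp

lemma dindex_measurable [measurable]: "dindex n \<in> borel \<rightarrow>\<^sub>M count_space UNIV"
proof -
  have "Measurable.pred borel (\<lambda>x. nrm (x - dseq i) < 1 / Suc n)" for i
  proof -
    have "{x. nrm (x - dseq i) < 1 / Suc n} = ball (dseq i) (1 / Suc n)"
      unfolding set_eq_iff mem_ball_iff by simp
    then show ?thesis
      unfolding pred_def by simp
  qed
  then show ?thesis
    unfolding dindex_def by (rule measurable_Least)
qed

lemma dindex_tendsto: "(\<lambda>n. dseq (dindex n x)) \<longlonglongrightarrow> x"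
proof -
  have "(\<lambda>n. 1 / real (Suc n)) \<longlonglongrightarrow> 0"
    using LIMSEQ_inverse_real_of_nat by (simp add: inverse_eq_divide)
  moreover have "nrm (dseq (dindex n x) - x) \<le> 1 / real (Suc n)" for n
    using dindex[of x n] nrm_minus_commute[of x "dseq (dindex n x)"] by simp
  ultimately have "(\<lambda>n. nrm (dseq (dindex n x) - x)) \<longlonglongrightarrow> 0"
    by (rule tendsto_0_le_nonneg[OF _ nrm_nonneg])
  then show ?thesis
    by (simp only: tendsto_iff_nrm)
qed

text \<open>Replacing both arguments by their approximations from the dense sequence leaves
  countably many constant values of \<open>h\<close>. Joint sequential continuity of
  \<open>h\<close> then gives the limit, without passing through the Borel sets of the
  product.\<close>

lemma borel_measurable_continuous_op:
  fixes h :: "'a \<Rightarrow> 'a \<Rightarrow> 'a"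
  assumes [measurable]: "f \<in> borel_measurable M" "g \<in> borel_measurable M"
    and h: "\<And>X Y x y. X \<longlonglongrightarrow> x \<Longrightarrow> Y \<longlonglongrightarrow> y \<Longrightarrow> (\<lambda>n. h (X n) (Y n)) \<longlonglongrightarrow> h x y"
  shows "(\<lambda>\<omega>. h (f \<omega>) (g \<omega>)) \<in> borel_measurable M"
proof (rule borel_measurable_LIMSEQ_metric)
  show "(\<lambda>n. h (dseq (dindex n (f \<omega>))) (dseq (dindex n (g \<omega>)))) \<longlonglongrightarrow> h (f \<omega>) (g \<omega>)" for \<omega>
    by (intro h dindex_tendsto)
  fix n
  have fn: "(\<lambda>\<omega>. dindex n (f \<omega>)) \<in> M \<rightarrow>\<^sub>M count_space UNIV"
    and gn: "(\<lambda>\<omega>. dindex n (g \<omega>)) \<in> M \<rightarrow>\<^sub>M count_space UNIV"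
    by measurable
  have "(\<lambda>\<omega>. h (dseq i) (dseq (dindex n (g \<omega>)))) \<in> borel_measurable M" for i
    by (rule measurable_compose_countable[OF _ gn]) simp
  then show "(\<lambda>\<omega>. h (dseq (dindex n (f \<omega>))) (dseq (dindex n (g \<omega>)))) \<in> borel_measurable M"
    by (rule measurable_compose_countable[OF _ fn])
qed

lemma borel_measurable_add_nrm [measurable]:
  fixes f g :: "'b \<Rightarrow> 'a"
  assumes "f \<in> borel_measurable M" "g \<in> borel_measurable M"
  shows "(\<lambda>\<omega>. f \<omega> + g \<omega>) \<in> borel_measurable M"
  using assms by (rule borel_measurable_continuous_op) (rule tendsto_nrm_add)

lemma borel_measurable_mult_nrm [measurable]:
  fixes f g :: "'b \<Rightarrow> 'a"
  assumes "f \<in> borel_measurable M" "g \<in> borel_measurable M"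
  shows "(\<lambda>\<omega>. f \<omega> * g \<omega>) \<in> borel_measurable M"
  using assms by (rule borel_measurable_continuous_op) (rule tendsto_nrm_mult)

lemma borel_measurable_minus_nrm [measurable]:
  fixes f g :: "'b \<Rightarrow> 'a"
  assumes "f \<in> borel_measurable M" "g \<in> borel_measurable M"
  shows "(\<lambda>\<omega>. f \<omega> - g \<omega>) \<in> borel_measurable M"
proof -
  have "(\<lambda>\<omega>. f \<omega> + (-1) * g \<omega>) \<in> borel_measurable M"
    by (intro borel_measurable_add_nrm borel_measurable_mult_nrm assms borel_measurable_const)
  then show ?thesis
    by simp
qed

lemma borel_measurable_uminus_nrm [measurable]:
  fixes g :: "'b \<Rightarrow> 'a"
  assumes "g \<in> borel_measurable M"
  shows "(\<lambda>\<omega>. - g \<omega>) \<in> borel_measurable M"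
  using borel_measurable_minus_nrm[OF borel_measurable_const[of 0] assms] by simp

lemma borel_measurable_power_nrm [measurable]:
  fixes f :: "'b \<Rightarrow> 'a"
  assumes "f \<in> borel_measurable M"
  shows "(\<lambda>\<omega>. f \<omega> ^ k) \<in> borel_measurable M"
  by (induction k) (simp_all add: borel_measurable_mult_nrm assms)

lemma borel_measurable_sum_nrm [measurable]:
  fixes f :: "'i \<Rightarrow> 'b \<Rightarrow> 'a"
  assumes "\<And>i. i \<in> I \<Longrightarrow> f i \<in> borel_measurable M"
  shows "(\<lambda>\<omega>. \<Sum>i\<in>I. f i \<omega>) \<in> borel_measurable M"
  using assms
  by (induction I rule: infinite_finite_induct) (simp_all add: borel_measurable_add_nrm)

end

section \<open>Random polynomials\<close>

text \<open>Generated by all coefficient functionals on polynomials of every degree at once, so that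
  multiplying by or dividing by a linear factor stays in one measurable space.\<close>

definition poly_borel :: "'a::{zero, topological_space} poly measure" where
  "poly_borel = vimage_algebra UNIV coeff (\<Pi>\<^sub>M i\<in>UNIV. borel)"

lemma space_poly_borel [simp]: "space poly_borel = UNIV"
  by (simp add: poly_borel_def)

lemma measurable_coeff [measurable (raw)]:
  assumes "f \<in> M \<rightarrow>\<^sub>M poly_borel"
  shows "(\<lambda>\<omega>. coeff (f \<omega>) i) \<in> borel_measurable M"
proof -
  have "coeff \<in> poly_borel \<rightarrow>\<^sub>M (\<Pi>\<^sub>M i\<in>UNIV. borel)"
    unfolding poly_borel_def by (rule measurable_vimage_algebra1) (simp add: space_PiM)
  then have "(\<lambda>\<omega>. coeff (f \<omega>)) \<in> M \<rightarrow>\<^sub>M (\<Pi>\<^sub>M i\<in>UNIV. borel)"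
    by (rule measurable_compose[OF assms])
  then show ?thesis
    by (rule measurable_compose[OF _ measurable_component_singleton]) simp
qed

lemma measurable_poly_borelI:
  assumes "\<And>i. (\<lambda>\<omega>. coeff (f \<omega>) i) \<in> borel_measurable M"
  shows "f \<in> M \<rightarrow>\<^sub>M poly_borel"
  unfolding poly_borel_def
proof (rule measurable_vimage_algebra2)
  show "(\<lambda>\<omega>. coeff (f \<omega>)) \<in> M \<rightarrow>\<^sub>M (\<Pi>\<^sub>M i\<in>UNIV. borel)"
    using assms by (intro measurable_PiM_single') (auto simp: space_PiM)
qed simp

lemma measurable_pCons [measurable (raw)]:
  fixes f :: "'b \<Rightarrow> 'a::{zero, topological_space}"
  assumes [measurable]: "f \<in> borel_measurable M" "g \<in> M \<rightarrow>\<^sub>M poly_borel"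
  shows "(\<lambda>\<omega>. pCons (f \<omega>) (g \<omega>)) \<in> M \<rightarrow>\<^sub>M poly_borel"
proof (rule measurable_poly_borelI)
  fix i show "(\<lambda>\<omega>. coeff (pCons (f \<omega>) (g \<omega>)) i) \<in> borel_measurable M"
    by (cases i) simp_all
qed

text \<open>Horner's scheme: each coefficient of the quotient by X - x is the value at
  \<open>x\<close> of a truncation of \<open>P\<close>. In this form the quotient is jointly
  measurable in \<open>P\<close> and \<open>x\<close>.\<close>

lemma coeff_synthetic_div: "coeff (synthetic_div P x) i = poly (poly_shift (Suc i) P) x"
proof (induction P arbitrary: i)
  case (pCons a P)
  have "poly_shift (Suc j) (pCons a P) = poly_shift j P" for j
    by (rule poly_eqI) (simp add: coeff_poly_shift)
  then show ?case
    using pCons.IH by (cases i) simp_all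
qed simp

context local_field
begin

text \<open>The degree is unbounded on \<open>poly_borel\<close>, so evaluation is obtained as the
  limit of truncated sums, which are exact from the degree on.\<close>

lemma measurable_poly_nrm [measurable (raw)]:
  fixes g :: "'b \<Rightarrow> 'a"
  assumes [measurable]: "f \<in> M \<rightarrow>\<^sub>M poly_borel" "g \<in> borel_measurable M"
  shows "(\<lambda>\<omega>. poly (f \<omega>) (g \<omega>)) \<in> borel_measurable M"
proof (rule borel_measurable_LIMSEQ_metric)
  fix n show "(\<lambda>\<omega>. \<Sum>i\<le>n. coeff (f \<omega>) i * g \<omega> ^ i) \<in> borel_measurable M"
    by measurable
next
  fix \<omega>
  have "(\<Sum>i\<le>n. coeff (f \<omega>) i * g \<omega> ^ i) = poly (f \<omega>) (g \<omega>)" if "degree (f \<omega>) \<le> n" for n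
    unfolding poly_altdef
    using that by (intro sum.mono_neutral_right) (auto simp: coeff_eq_0)
  then show "(\<lambda>n. \<Sum>i\<le>n. coeff (f \<omega>) i * g \<omega> ^ i) \<longlonglongrightarrow> poly (f \<omega>) (g \<omega>)"
    by (intro tendsto_eventually eventually_sequentiallyI)
qed

lemma measurable_synthetic_div_nrm [measurable (raw)]:
  fixes g :: "'b \<Rightarrow> 'a"
  assumes [measurable]: "f \<in> M \<rightarrow>\<^sub>M poly_borel" "g \<in> borel_measurable M"
  shows "(\<lambda>\<omega>. synthetic_div (f \<omega>) (g \<omega>)) \<in> M \<rightarrow>\<^sub>M poly_borel"
proof (rule measurable_poly_borelI)
  fix i
  have "(\<lambda>\<omega>. poly_shift (Suc i) (f \<omega>)) \<in> M \<rightarrow>\<^sub>M poly_borel"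
    by (rule measurable_poly_borelI) (simp add: coeff_poly_shift)
  then show "(\<lambda>\<omega>. coeff (synthetic_div (f \<omega>) (g \<omega>)) i) \<in> borel_measurable M"
    unfolding coeff_synthetic_div by measurable
qed

text \<open>A density instead of a restricted space: the underlying space remains the whole field
  with its Borel sets. The restricted version \<open>\<nu>R\<close>, which occurs in
  \<open>poly_measure\<close>, is compared with it in \<open>nn_integral_\<nu>R\<close>.\<close>

definition \<mu>R :: "'a measure" where "\<mu>R = density \<mu> (indicator R)"

lemma sets_\<mu>R [measurable_cong, simp]: "sets \<mu>R = sets borel"
  by (simp add: \<mu>R_def)

lemma space_\<mu>R [simp]: "space \<mu>R = UNIV"
  by (simp add: \<mu>R_def)

lemma nn_integral_\<mu>R: 
  assumes [measurable]: "f \<in> borel_measurable borel"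
  shows "(\<integral>\<^sup>+x. f x \<partial>\<mu>R) = (\<integral>\<^sup>+x. f x * indicator R x \<partial>\<mu>)"
  unfolding \<mu>R_def by (subst nn_integral_density) (simp_all add: mult.commute)

lemma prob_space_\<mu>R: "prob_space \<mu>R"
proof (rule prob_spaceI)
  have "emeasure \<mu>R (space \<mu>R) = (\<integral>\<^sup>+x. 1 \<partial>\<mu>R)"
    by simp
  also have "\<dots> = emeasure \<mu> R"
    by (subst nn_integral_\<mu>R) simp_all
  finally show "emeasure \<mu>R (space \<mu>R) = 1"
    by (simp add: emeasure_R)
qed

sublocale \<mu>R: prob_space \<mu>R
  by (rule prob_space_\<mu>R)

lemma AE_\<mu>R: "AE a in \<mu>R. a \<in> R"
  unfolding \<mu>R_def by (subst AE_density) (simp_all add: indicator_def)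

lemma nn_integral_translate:
  assumes [measurable]: "f \<in> borel_measurable borel"
  shows "(\<integral>\<^sup>+x. f (x + t) \<partial>\<mu>) = (\<integral>\<^sup>+x. f x \<partial>\<mu>)"
proof -
  have [measurable]: "(\<lambda>x. x + t) \<in> borel_measurable \<mu>"
    by measurable
  have "distr \<mu> borel (\<lambda>x. x + t) = \<mu>"
  proof (rule measure_eqI)
    fix A :: "'a set" assume "A \<in> sets (distr \<mu> borel (\<lambda>x. x + t))"
    then have [measurable]: "A \<in> sets borel"
      by simp
    have *: "(\<lambda>x. x + t) -` A = (+) (-t) ` A"
      by (auto simp: image_iff algebra_simps intro!: bexI[of _ "_ + t"])
    have "emeasure (distr \<mu> borel (\<lambda>x. x + t)) A = emeasure \<mu> ((\<lambda>x. x + t) -` A)"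
      by (subst emeasure_distr) simp_all
    also have "\<dots> = emeasure \<mu> A"
      unfolding * by (rule emeasure_translate) simp
    finally show "emeasure (distr \<mu> borel (\<lambda>x. x + t)) A = emeasure \<mu> A" .
  qed simp
  then have "(\<integral>\<^sup>+x. f x \<partial>\<mu>) = (\<integral>\<^sup>+x. f x \<partial>distr \<mu> borel (\<lambda>x. x + t))"
    by simp
  also have "\<dots> = (\<integral>\<^sup>+x. f (x + t) \<partial>\<mu>)"
    by (rule nn_integral_distr) measurable
  finally show ?thesis ..
qed

lemma nn_integral_\<mu>R_translate:
  assumes [measurable]: "f \<in> borel_measurable borel" and t: "t \<in> R"
  shows "(\<integral>\<^sup>+x. f (x + t) \<partial>\<mu>R) = (\<integral>\<^sup>+x. f x \<partial>\<mu>R)"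
proof -
  have "x + t \<in> R \<longleftrightarrow> x \<in> R" for x
    using integers_ring_add[of x t] integers_ring_diff[of "x + t" t] t by auto
  then have ind: "indicator R (x + t) = (indicator R x :: ennreal)" for x
    by (simp add: indicator_def)
  have "(\<integral>\<^sup>+x. f (x + t) \<partial>\<mu>R) = (\<integral>\<^sup>+x. f (x + t) * indicator R (x + t) \<partial>\<mu>)"
    unfolding ind by (rule nn_integral_\<mu>R) measurable
  also have "\<dots> = (\<integral>\<^sup>+x. f x * indicator R x \<partial>\<mu>)"
    by (rule nn_integral_translate) measurable
  finally show ?thesis
    by (simp add: nn_integral_\<mu>R)
qed

text \<open>The uniform law on integral coefficient vectors of length \<open>n + 1\<close>,
  adjoining the constant coefficient last. This matches the recursion of \<open>newton\<close> and
  isolates the coefficient to which the area formula is applied; \<open>nn_integral_law\<close>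
  identifies it with \<open>poly_measure\<close>.\<close>

fun PM :: "nat \<Rightarrow> 'a poly measure" where
  "PM 0 = distr \<mu>R poly_borel (\<lambda>a. [:a:])"
| "PM (Suc n) = distr (\<mu>R \<Otimes>\<^sub>M PM n) poly_borel (\<lambda>(a, P). pCons a P)"

lemma sets_PM [measurable_cong, simp]: "sets (PM n) = sets poly_borel"
  by (cases n) simp_all

lemma space_PM [simp]: "space (PM n) = UNIV"
  by (cases n) simp_all

lemma prob_space_PM: "prob_space (PM n)"
proof (induction n)
  case 0
  show ?case
    by (simp add: \<mu>R.prob_space_distr)
next
  case (Suc n)
  interpret P: prob_space "PM n" by fact
  interpret Q: pair_prob_space \<mu>R "PM n" ..
  show ?case
    by (simp add: Q.P.prob_space_distr)
qed

sublocale PM: prob_space "PM n" for n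
  by (rule prob_space_PM)

sublocale \<mu>P: pair_prob_space \<mu>R "PM n" for n ..

lemma nn_integral_PM_0:
  assumes [measurable]: "G \<in> borel_measurable poly_borel"
  shows "(\<integral>\<^sup>+P. G P \<partial>PM 0) = (\<integral>\<^sup>+a. G [:a:] \<partial>\<mu>R)"
  by (simp add: nn_integral_distr)

lemma nn_integral_PM_Suc:
  assumes [measurable]: "G \<in> borel_measurable poly_borel"
  shows "(\<integral>\<^sup>+P. G P \<partial>PM (Suc n)) = (\<integral>\<^sup>+P. \<integral>\<^sup>+a. G (pCons a P) \<partial>\<mu>R \<partial>PM n)"
    and "(\<integral>\<^sup>+P. G P \<partial>PM (Suc n)) = (\<integral>\<^sup>+a. \<integral>\<^sup>+P. G (pCons a P) \<partial>PM n \<partial>\<mu>R)"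
proof -
  have *: "(\<integral>\<^sup>+P. G P \<partial>PM (Suc n)) = (\<integral>\<^sup>+z. (\<lambda>(a, P). G (pCons a P)) z \<partial>(\<mu>R \<Otimes>\<^sub>M PM n))"
    by (simp add: nn_integral_distr case_prod_unfold)
  show "(\<integral>\<^sup>+P. G P \<partial>PM (Suc n)) = (\<integral>\<^sup>+P. \<integral>\<^sup>+a. G (pCons a P) \<partial>\<mu>R \<partial>PM n)"
    unfolding * by (subst \<mu>P.nn_integral_snd[symmetric]) simp_all
  show "(\<integral>\<^sup>+P. G P \<partial>PM (Suc n)) = (\<integral>\<^sup>+a. \<integral>\<^sup>+P. G (pCons a P) \<partial>PM n \<partial>\<mu>R)"
    unfolding * by (subst PM.nn_integral_fst[symmetric]) simp_all
qed

lemma sets_integral_polys [measurable]: "{P. \<forall>i. coeff P i \<in> R} \<in> sets poly_borel"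
proof -
  have "{P \<in> space poly_borel. \<forall>i. coeff P i \<in> R} \<in> sets poly_borel"
    by measurable
  then show ?thesis
    by simp
qed

lemma AE_PM_integral: "AE P in PM n. \<forall>i. coeff P i \<in> R"
proof (induction n)
  case 0
  show ?case
    unfolding PM.simps
    using AE_\<mu>R by (subst AE_distr_iff) (auto simp: coeff_pCons split: nat.splits)
next
  case (Suc n)
  have "AE z in \<mu>R \<Otimes>\<^sub>M PM n. \<forall>i. coeff (pCons (fst z) (snd z)) i \<in> R"
  proof (rule \<mu>P.AE_pair_measure)
    show "{z \<in> space (\<mu>R \<Otimes>\<^sub>M PM n). \<forall>i. coeff (pCons (fst z) (snd z)) i \<in> R} \<in> sets (\<mu>R \<Otimes>\<^sub>M PM n)"
      by measurable
    show "AE a in \<mu>R. AE P in PM n. \<forall>i. coeff (pCons (fst (a, P)) (snd (a, P))) i \<in> R"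
      using AE_\<mu>R
    proof eventually_elim
      case (elim a)
      show ?case
        using Suc by eventually_elim (use elim in \<open>auto simp: coeff_pCons split: nat.splits\<close>)
    qed
  qed
  then show ?case
    unfolding PM.simps by (subst AE_distr_iff) (simp_all add: case_prod_unfold)
qed

text \<open>This is the coefficient vector of the expansion of \<open>P\<close> in the basis
  \<open>1, (X - x), (X - x) X, (X - x) X^2, \<dots>\<close>.\<close>

definition newton :: "'a \<Rightarrow> 'a poly \<Rightarrow> 'a poly" where
  "newton x P = pCons (poly P x) (synthetic_div P x)"

text \<open>The triangular shape of the change of basis: \<open>a\<close> is merely translated by a
  quantity depending on \<open>P\<close> alone, while the remaining entries do not involve
  \<open>a\<close>.\<close>

lemma newton_pCons: "newton x (pCons a P) = pCons (a + x * poly P x) (newton x P)"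
  by (simp add: newton_def)

lemma measurable_newton [measurable (raw)]:
  assumes [measurable]: "f \<in> M \<rightarrow>\<^sub>M poly_borel" "g \<in> borel_measurable M"
  shows "(\<lambda>\<omega>. newton (g \<omega>) (f \<omega>)) \<in> M \<rightarrow>\<^sub>M poly_borel"
  unfolding newton_def by measurable

text \<open>For fixed \<open>P\<close>, \<open>newton_pCons\<close> translates \<open>a\<close> by
  the integral element \<open>x * poly P x\<close>, which \<open>\<mu>R\<close> does not see.
  Exchanging the integrals lets the induction hypothesis remove \<open>newton\<close> from
  \<open>P\<close>.\<close>

lemma nn_integral_newton:
  assumes x: "x \<in> R" and G: "G \<in> borel_measurable poly_borel"
  shows "(\<integral>\<^sup>+P. G (newton x P) \<partial>PM n) = (\<integral>\<^sup>+P. G P \<partial>PM n)"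
  using G
proof (induction n arbitrary: G)
  case 0
  note [measurable] = 0
  show ?case
    by (subst (1 2) nn_integral_PM_0) (simp_all add: newton_def)
next
  case (Suc n)
  note [measurable] = Suc.prems
  have "(\<integral>\<^sup>+P. G (newton x P) \<partial>PM (Suc n)) = (\<integral>\<^sup>+P. \<integral>\<^sup>+a. G (newton x (pCons a P)) \<partial>\<mu>R \<partial>PM n)"
    by (rule nn_integral_PM_Suc) measurable
  also have "\<dots> = (\<integral>\<^sup>+P. \<integral>\<^sup>+a. G (pCons a (newton x P)) \<partial>\<mu>R \<partial>PM n)"
  proof (rule nn_integral_cong_AE, use AE_PM_integral in eventually_elim)
    fix P :: "'a poly" assume "\<forall>i. coeff P i \<in> R"
    then have "x * poly P x \<in> R"
      using x by (intro integers_ring_mult integers_ring_poly) auto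
    then show "(\<integral>\<^sup>+a. G (newton x (pCons a P)) \<partial>\<mu>R) = (\<integral>\<^sup>+a. G (pCons a (newton x P)) \<partial>\<mu>R)"
      unfolding newton_pCons by (intro nn_integral_\<mu>R_translate) measurable
  qed
  also have "\<dots> = (\<integral>\<^sup>+a. \<integral>\<^sup>+P. G (pCons a (newton x P)) \<partial>PM n \<partial>\<mu>R)"
    by (rule \<mu>P.Fubini') measurable
  also have "\<dots> = (\<integral>\<^sup>+a. \<integral>\<^sup>+P. G (pCons a P) \<partial>PM n \<partial>\<mu>R)"
    by (intro nn_integral_cong Suc.IH) measurable
  also have "\<dots> = (\<integral>\<^sup>+P. G P \<partial>PM (Suc n))"
    by (rule nn_integral_PM_Suc[symmetric]) measurable
  finally show ?case .
qed

end

section \<open>The area formula\<close>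

context nonarch_field
begin

lemma poly_diff_factor:
  assumes "\<And>i. coeff P i \<in> integers_ring nrm" "x \<in> integers_ring nrm" "y \<in> integers_ring nrm"
  shows "\<exists>w\<in>integers_ring nrm. poly P x - poly P y = (x - y) * w"
  using assms(1)
proof (induction P)
  case 0
  show ?case
    by (rule bexI[of _ 0]) auto
next
  case (pCons a P)
  have P: "coeff P i \<in> integers_ring nrm" for i
    using pCons.prems[of "Suc i"] by simp
  then obtain w where w: "w \<in> integers_ring nrm" "poly P x - poly P y = (x - y) * w"
    using pCons.IH by blast
  have "x * w + poly P y \<in> integers_ring nrm"
    using w(1) assms(2,3) P by (intro integers_ring_add integers_ring_mult integers_ring_poly)
  moreover have "poly (pCons a P) x - poly (pCons a P) y = x * (poly P x - poly P y) + (x - y) * poly P y"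
    by (simp add: algebra_simps)
  then have "poly (pCons a P) x - poly (pCons a P) y = (x - y) * (x * w + poly P y)"
    unfolding w(2) by (simp add: algebra_simps)
  ultimately show ?case
    by blast
qed

lemma poly_lipschitz:
  assumes "\<And>i. coeff P i \<in> integers_ring nrm" "x \<in> integers_ring nrm" "y \<in> integers_ring nrm"
  shows "nrm (poly P x - poly P y) \<le> nrm (x - y)"
  using poly_diff_factor[OF assms] by (auto simp: nrm_mult integers_ring_def mult_left_le)

lemma coeff_pderiv_integral:
  assumes "\<And>i. coeff P i \<in> integers_ring nrm"
  shows "coeff (pderiv P) i \<in> integers_ring nrm"
  unfolding coeff_pderiv
  by (intro integers_ring_mult assms integers_ringI nrm_of_nat_le)

text \<open>The divided difference is an integral polynomial in two variables that equals the
  derivative on the diagonal, and integral polynomials do not expand distances. Writing it as a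
  factor \<open>w\<close> treats the case \<open>x = y\<close> along with the others.\<close>

lemma poly_diff_pderiv:
  assumes "\<And>i. coeff P i \<in> integers_ring nrm"
    and x: "x \<in> integers_ring nrm" and y: "y \<in> integers_ring nrm" and z: "z \<in> integers_ring nrm"
    and "nrm (x - z) \<le> r" "nrm (y - z) \<le> r"
  shows "\<exists>w. poly P x - poly P y = (x - y) * w \<and> nrm (w - poly (pderiv P) z) \<le> r"
  using assms(1)
proof (induction P)
  case 0
  have "0 \<le> r"
    using order_trans[OF nrm_nonneg assms(5)] .
  then show ?case
    by (intro exI[of _ 0]) auto
next
  case (pCons a P)
  have P: "coeff P i \<in> integers_ring nrm" for i
    using pCons.prems[of "Suc i"] by simp
  then obtain w where w: "poly P x - poly P y = (x - y) * w" "nrm (w - poly (pderiv P) z) \<le> r"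
    using pCons.IH by blast
  \<comment> \<open>The new divided difference is \<open>x * w + poly P y\<close>, while the new
    derivative at \<open>z\<close> is \<open>poly P z + z * poly (pderiv P) z\<close>. The three
    terms are the errors from \<open>w\<close>, from replacing \<open>z\<close> by \<open>x\<close>,
    and from replacing \<open>z\<close> by \<open>y\<close>.\<close>
  define A B C where "A = x * (w - poly (pderiv P) z)" and "B = (x - z) * poly (pderiv P) z"
    and "C = poly P y - poly P z"
  have "nrm A \<le> r"
    using w(2) x mult_mono[of "nrm x" 1 "nrm (w - poly (pderiv P) z)" r]
    by (simp add: A_def nrm_mult integers_ring_def)
  moreover have "nrm B \<le> r"
  proof -
    have "poly (pderiv P) z \<in> integers_ring nrm"
      using P z by (intro integers_ring_poly coeff_pderiv_integral)
    then have "nrm B \<le> nrm (x - z)"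
      by (simp add: B_def nrm_mult integers_ring_def mult_left_le)
    then show ?thesis
      using assms(5) by simp
  qed
  moreover have "nrm C \<le> r"
    using poly_lipschitz[OF P y z] assms(6) by (simp add: C_def)
  ultimately have "nrm (A + B + C) \<le> r"
    using nrm_add_le[of "A + B" C] nrm_add_le[of A B] by simp
  moreover have "x * w + poly P y - poly (pderiv (pCons a P)) z = A + B + C"
    by (simp add: A_def B_def C_def pderiv_pCons algebra_simps)
  moreover have "poly (pCons a P) x - poly (pCons a P) y = x * (poly P x - poly P y) + (x - y) * poly P y"
    by (simp add: algebra_simps)
  then have "poly (pCons a P) x - poly (pCons a P) y = (x - y) * (x * w + poly P y)"
    unfolding w(1) by (simp add: algebra_simps)
  ultimately show ?case
    by (intro exI[of _ "x * w + poly P y"]) simp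
qed

lemma cball_subset_integers:
  "x \<in> integers_ring nrm \<Longrightarrow> r \<le> 1 \<Longrightarrow> cball x r \<subseteq> integers_ring nrm"
  unfolding integers_ring_eq_cball using cball_recenter[of x 0 1] subset_cball[of r 1 x] by auto

text \<open>The divided difference is within \<open>r\<close> of the derivative at \<open>z\<close>,
  which is larger than \<open>r\<close>, so both have the same absolute value: the polynomial is a
  similarity on the ball.\<close>

lemma nrm_poly_diff_eq:
  assumes P: "\<And>i. coeff P i \<in> integers_ring nrm" and z: "z \<in> integers_ring nrm"
    and r: "r < nrm (poly (pderiv P) z)" "r \<le> 1"
    and xy: "x \<in> cball z r" "y \<in> cball z r"
  shows "nrm (poly P x - poly P y) = nrm (poly (pderiv P) z) * nrm (x - y)"
proof -
  have R: "x \<in> integers_ring nrm" "y \<in> integers_ring nrm"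
    using xy cball_subset_integers[OF z r(2)] by auto
  obtain w where w: "poly P x - poly P y = (x - y) * w" "nrm (w - poly (pderiv P) z) \<le> r"
    using poly_diff_pderiv[OF P R z] xy unfolding mem_cball_iff by blast
  have "nrm w = nrm (poly (pderiv P) z)"
    using w(2) r(1) by (intro nrm_eq_if_close) (simp add: nrm_minus_commute)
  then show ?thesis
    using w(1) by (simp add: nrm_mult)
qed

lemma nrm_pderiv_eq:
  assumes P: "\<And>i. coeff P i \<in> integers_ring nrm" and z: "z \<in> integers_ring nrm"
    and r: "r < nrm (poly (pderiv P) z)" "r \<le> 1" and x: "x \<in> cball z r"
  shows "nrm (poly (pderiv P) x) = nrm (poly (pderiv P) z)"
proof (rule nrm_eq_if_close)
  have "nrm (poly (pderiv P) z - poly (pderiv P) x) \<le> nrm (z - x)"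
    using P z x cball_subset_integers[OF z r(2)] by (intro poly_lipschitz coeff_pderiv_integral) auto
  also have "\<dots> \<le> r"
    using x unfolding mem_cball_iff by (simp add: nrm_minus_commute)
  finally show "nrm (poly (pderiv P) z - poly (pderiv P) x) < nrm (poly (pderiv P) z)"
    using r(1) by simp
qed

text \<open>A form of Hensel's lemma. One inclusion is the similarity property; for the other, every
  target value is reached by a contraction of the complete ball \<open>cball z r\<close>.\<close>

lemma poly_image_cball:
  assumes compl: "complete (integers_ring nrm)"
    and P: "\<And>i. coeff P i \<in> integers_ring nrm" and z: "z \<in> integers_ring nrm"
    and r: "0 < r" "r < nrm (poly (pderiv P) z)" "r \<le> 1"
  shows "poly P ` cball z r = cball (poly P z) (nrm (poly (pderiv P) z) * r)"
proof (intro equalityI subsetI)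
  define \<delta> where "\<delta> = nrm (poly (pderiv P) z)"
  have zz: "z \<in> cball z r"
    using r by simp
  fix c
  {
    assume "c \<in> poly P ` cball z r"
    then obtain x where x: "x \<in> cball z r" "c = poly P x" by blast
    have "nrm (poly P x - poly P z) = \<delta> * nrm (x - z)"
      unfolding \<delta>_def by (rule nrm_poly_diff_eq[OF P z r(2,3) x(1) zz])
    moreover have "nrm (x - z) \<le> r"
      using x(1) unfolding mem_cball_iff .
    ultimately show "c \<in> cball (poly P z) (nrm (poly (pderiv P) z) * r)"
      unfolding mem_cball_iff x(2) by (simp add: \<delta>_def mult_left_mono)
  }
  assume "c \<in> cball (poly P z) (nrm (poly (pderiv P) z) * r)"
  then have c: "nrm (c - poly P z) \<le> \<delta> * r"
    unfolding mem_cball_iff \<delta>_def .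
  have \<delta>: "0 < \<delta>"
    unfolding \<delta>_def using r(1,2) by (rule less_trans)
  then have d0: "poly (pderiv P) z \<noteq> 0"
    by (auto simp: \<delta>_def)
  \<comment> \<open>Newton's iteration for the equation \<open>poly P x = c\<close> with the
    derivative frozen at \<open>z\<close>: its fixed points are the solutions, and its contraction
    ratio is \<open>r / \<delta>\<close>.\<close>
  define \<phi> where "\<phi> x = x - (poly P x - c) / poly (pderiv P) z" for x
  have "\<exists>!x\<in>cball z r. \<phi> x = x"
  proof (rule Banach_fix[of _ "r / \<delta>"])
    show "complete (cball z r)"
      using closed_cball cball_subset_integers[OF z r(3)] compl by (rule complete_closed_subset)
    show "0 \<le> r / \<delta>" "r / \<delta> < 1"
      using r \<delta> by (simp_all add: \<delta>_def)
    show lip: "dist (\<phi> x) (\<phi> y) \<le> r / \<delta> * dist x y" if xy: "x \<in> cball z r" "y \<in> cball z r" for x y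
    proof -
      have R: "x \<in> integers_ring nrm" "y \<in> integers_ring nrm"
        using xy cball_subset_integers[OF z r(3)] by auto
      obtain w where w: "poly P x - poly P y = (x - y) * w" "nrm (w - poly (pderiv P) z) \<le> r"
        using poly_diff_pderiv[OF P R z] xy unfolding mem_cball_iff by blast
      have "\<phi> x - \<phi> y = (x - y) - (poly P x - poly P y) / poly (pderiv P) z"
        by (simp add: \<phi>_def diff_divide_distrib)
      also have "\<dots> = (x - y) * (poly (pderiv P) z - w) / poly (pderiv P) z"
        unfolding w(1) using d0 by (simp add: field_simps)
      finally have "nrm (\<phi> x - \<phi> y) = nrm (x - y) * nrm (w - poly (pderiv P) z) / \<delta>"
        by (simp add: nrm_mult nrm_divide \<delta>_def nrm_minus_commute)
      also have "\<dots> \<le> nrm (x - y) * r / \<delta>"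
        using w(2) \<delta> by (intro divide_right_mono mult_left_mono) auto
      finally show ?thesis
        by (simp add: dist_eq mult.commute)
    qed
    show "\<phi> ` cball z r \<subseteq> cball z r"
    proof safe
      fix x assume x: "x \<in> cball z r"
      have "dist (\<phi> x) (\<phi> z) \<le> r / \<delta> * dist x z"
        by (rule lip[OF x zz])
      also have "\<dots> \<le> 1 * r"
        using x r \<delta> by (intro mult_mono) (auto simp: \<delta>_def dist_commute)
      finally have "nrm (\<phi> x - \<phi> z) \<le> r"
        by (simp add: dist_eq)
      moreover have "nrm (\<phi> z - z) \<le> r"
      proof -
        have "nrm (\<phi> z - z) = nrm (c - poly P z) / \<delta>"
          by (simp add: \<phi>_def nrm_divide \<delta>_def nrm_minus_commute)
        then show ?thesis
          using c \<delta> by (simp add: pos_divide_le_eq mult.commute)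
      qed
      ultimately have "nrm (\<phi> x - z) \<le> r"
        using nrm_triangle[of "\<phi> x" z "\<phi> z"] by simp
      then show "\<phi> x \<in> cball z r"
        unfolding mem_cball_iff .
    qed
  qed (use zz in auto)
  then obtain x where x: "x \<in> cball z r" "\<phi> x = x"
    by blast
  then have "poly P x = c"
    using d0 by (simp add: \<phi>_def)
  then show "c \<in> poly P ` cball z r"
    using x(1) by blast
qed

end

section \<open>Push-forward of the Haar measure by a polynomial on a small ball\<close>

context local_field
begin

lemma emeasure_point: "emeasure \<mu> {x} = 0"
proof -
  have "emeasure \<mu> {x} \<le> ennreal e" if "0 < e" for e
  proof -
    obtain k where k: "rad k < e"
      using rad_small \<open>0 < e\<close> by blast
    have "emeasure \<mu> {x} \<le> emeasure \<mu> (cball x (rad k))"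
      by (rule emeasure_mono) auto
    also have "\<dots> \<le> ennreal e"
      using k by (simp add: emeasure_cball_rad ennreal_leI)
    finally show ?thesis .
  qed
  then have "emeasure \<mu> {x} \<le> 0"
    using ennreal_le_epsilon[of 0 "emeasure \<mu> {x}"] by simp
  then show ?thesis
    by simp
qed

lemma AE_notin_finite: "finite F \<Longrightarrow> AE x in \<mu>. x \<notin> F"
proof (induction F rule: finite_induct)
  case (insert a F)
  have "AE x in \<mu>. x \<noteq> a"
    by (rule AE_I[of _ _ "{a}"]) (auto simp: emeasure_point)
  then show ?case
    using insert.IH by eventually_elim simp
qed simp

text \<open>On the ball the polynomial is a similarity onto a ball, and its ratio \<delta> is a
  value \<open>rad j\<close>. It multiplies the measure of each smaller ball by \<delta>, and
  measures are determined by their values on balls.\<close>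

lemma distr_poly_cball:
  assumes P: "\<And>i. coeff P i \<in> R" and z: "z \<in> R" and k: "rad k < nrm (poly (pderiv P) z)"
  shows "distr (density \<mu> (\<lambda>x. ennreal (nrm (poly (pderiv P) z)) * indicator (cball z (rad k)) x)) borel (poly P)
    = density \<mu> (indicator (poly P ` cball z (rad k)))" (is "?M = ?N")
proof -
  define B where "B = cball z (rad k)"
  define \<delta> where "\<delta> = nrm (poly (pderiv P) z)"
  have "poly (pderiv P) z \<in> R"
    using P z by (intro integers_ring_poly coeff_pderiv_integral)
  moreover have "poly (pderiv P) z \<noteq> 0"
    using less_trans[OF rad_pos k] by simp
  ultimately obtain j where j: "\<delta> = rad j"
    using nrm_eq_rad unfolding \<delta>_def integers_ring_def by blast
  have zB: "z \<in> B"
    by (simp add: B_def)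
  have img: "poly P ` B = cball (poly P z) (rad (j + k))"
    unfolding B_def rad_add j[symmetric] \<delta>_def
    using compact_imp_complete[OF compact_integers] P z k rad_le_1
    by (intro poly_image_cball) auto
  have [measurable]: "B \<in> sets borel" "poly P \<in> borel_measurable borel" "poly P ` B \<in> sets borel"
    unfolding img by (simp_all add: B_def borel_measurable_continuous_onI continuous_on_poly_nrm)
  have eM: "emeasure (distr (density \<mu> (\<lambda>x. ennreal \<delta> * indicator B x)) borel (poly P)) A
      = ennreal \<delta> * emeasure \<mu> (B \<inter> poly P -` A)" if [measurable]: "A \<in> sets borel" for A
  proof -
    have [measurable]: "poly P -` A \<in> sets borel"
      using measurable_sets[of "poly P" borel borel A] by simp
    have "emeasure (distr (density \<mu> (\<lambda>x. ennreal \<delta> * indicator B x)) borel (poly P)) A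
      = emeasure (density \<mu> (\<lambda>x. ennreal \<delta> * indicator B x)) (poly P -` A)"
      by (subst emeasure_distr) simp_all
    also have "\<dots> = (\<integral>\<^sup>+x. ennreal \<delta> * indicator (B \<inter> poly P -` A) x \<partial>\<mu>)"
      by (subst emeasure_density) (auto intro!: nn_integral_cong simp: indicator_def)
    also have "\<dots> = ennreal \<delta> * emeasure \<mu> (B \<inter> poly P -` A)"
      by (subst nn_integral_cmult) simp_all
    finally show ?thesis .
  qed
  have eN: "emeasure (density \<mu> (indicator (poly P ` B))) A = emeasure \<mu> (poly P ` B \<inter> A)"
    if [measurable]: "A \<in> sets borel" for A
  proof -
    have "emeasure (density \<mu> (indicator (poly P ` B))) A = (\<integral>\<^sup>+x. indicator (poly P ` B \<inter> A) x \<partial>\<mu>)"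
      by (subst emeasure_density, simp, simp, rule nn_integral_cong, simp only: indicator_inter_arith)
    then show ?thesis
      by simp
  qed
  have "distr (density \<mu> (\<lambda>x. ennreal \<delta> * indicator B x)) borel (poly P)
      = density \<mu> (indicator (poly P ` B))"
  proof (rule measure_eqI_rballs)
    fix c i
    show "emeasure (distr (density \<mu> (\<lambda>x. ennreal \<delta> * indicator B x)) borel (poly P)) (cball c (rad i))
      = emeasure (density \<mu> (indicator (poly P ` B))) (cball c (rad i))"
    proof (cases "poly P ` B \<inter> cball c (rad i) = {}")
      case True
      then have "B \<inter> poly P -` cball c (rad i) = {}"
        by blast
      then show ?thesis
        using True by (simp add: eM eN)
    next
      case False
      then obtain x where x: "x \<in> B" "poly P x \<in> cball c (rad i)"
        by blast
      have c: "cball c (rad i) = cball (poly P x) (rad i)"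
        using cball_recenter[OF x(2)] by simp
      have "poly P x \<in> cball (poly P z) (rad (j + k))"
        using x(1) img by blast
      then have PB: "poly P ` B = cball (poly P x) (rad (j + k))"
        using cball_recenter img by simp
      have Bx: "B = cball x (rad k)"
        using cball_recenter[of x z "rad k"] x(1) by (simp add: B_def)
      have dist: "nrm (poly P y - poly P x) = rad j * nrm (y - x)" if "y \<in> B" for y
        using nrm_poly_diff_eq[OF P z k rad_le_1, of y x] that x(1)
        unfolding B_def j[symmetric] \<delta>_def by simp
      \<comment> \<open>The test ball meets the image of \<open>B\<close>, which has radius
        \<open>rad (j + k)\<close>, so one contains the other. If the test ball is the smaller one,
        its preimage is a ball of radius \<open>rad i / rad j\<close>; otherwise the preimage is all
        of \<open>B\<close>.\<close>
      show ?thesis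
      proof (cases "j + k \<le> i")
        case True
        have "poly P ` B \<inter> cball c (rad i) = cball (poly P x) (rad i)"
          unfolding PB c using subset_cball[OF rad_antimono[OF True]] by blast
        moreover have "B \<inter> poly P -` cball c (rad i) = cball x (rad (i - j))"
        proof -
          have "rad i = rad j * rad (i - j)"
            using True by (simp add: rad_add[symmetric])
          then have *: "poly P y \<in> cball (poly P x) (rad i) \<longleftrightarrow> y \<in> cball x (rad (i - j))" if "y \<in> B" for y
            unfolding mem_cball_iff dist[OF that] by simp
          have "cball x (rad (i - j)) \<subseteq> B"
            unfolding Bx using True by (intro subset_cball rad_antimono) simp
          then show ?thesis
            unfolding c using * by blast
        qed
        moreover have "rad j * rad (i - j) = rad i"
          using True by (simp add: rad_add[symmetric])
        ultimately show ?thesis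
          unfolding eM[OF borel_cball] eN[OF borel_cball]
          by (simp add: emeasure_cball_rad j ennreal_mult[symmetric])
      next
        case False
        then have "rad (j + k) \<le> rad i"
          by (intro rad_antimono) simp
        then have sub: "poly P ` B \<subseteq> cball c (rad i)"
          unfolding PB c by (rule subset_cball)
        then have "poly P ` B \<inter> cball c (rad i) = poly P ` B" "B \<inter> poly P -` cball c (rad i) = B"
          by blast+
        then show ?thesis
          unfolding eM[OF borel_cball] eN[OF borel_cball]
          by (simp add: PB) (simp add: Bx emeasure_cball_rad j ennreal_mult[symmetric] rad_add[symmetric])
      qed
    qed
  next
    fix c
    have "emeasure \<mu> (B \<inter> poly P -` cball c (rad 0)) \<le> emeasure \<mu> B"
      by (rule emeasure_mono) auto
    then have "emeasure \<mu> (B \<inter> poly P -` cball c (rad 0)) \<noteq> \<infinity>"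
      by (auto simp: B_def emeasure_cball_rad top_unique)
    then show "emeasure (distr (density \<mu> (\<lambda>x. ennreal \<delta> * indicator B x)) borel (poly P)) (cball c (rad 0)) \<noteq> \<infinity>"
      unfolding eM[OF borel_cball] by (simp add: ennreal_mult_eq_top_iff)
  qed simp_all
  then show ?thesis
    by (simp add: B_def \<delta>_def)
qed

lemma nn_integral_poly_cball:
  assumes P: "\<And>i. coeff P i \<in> R" and z: "z \<in> R" and k: "rad k < nrm (poly (pderiv P) z)"
    and [measurable]: "h \<in> borel_measurable borel"
  shows "(\<integral>\<^sup>+x. h (poly P x) * (ennreal (nrm (poly (pderiv P) x)) * indicator (cball z (rad k)) x) \<partial>\<mu>)
    = (\<integral>\<^sup>+c. h c * indicator (poly P ` cball z (rad k)) c \<partial>\<mu>)"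
proof -
  have [measurable]: "poly P \<in> borel_measurable borel"
    by (simp add: borel_measurable_continuous_onI continuous_on_poly_nrm)
  have [measurable]: "poly P ` cball z (rad k) \<in> sets borel"
    unfolding poly_image_cball[OF compact_imp_complete[OF compact_integers] P z rad_pos k rad_le_1]
    by (rule borel_cball)
  have "(\<integral>\<^sup>+x. h (poly P x) * (ennreal (nrm (poly (pderiv P) x)) * indicator (cball z (rad k)) x) \<partial>\<mu>)
      = (\<integral>\<^sup>+x. (ennreal (nrm (poly (pderiv P) z)) * indicator (cball z (rad k)) x) * h (poly P x) \<partial>\<mu>)"
  proof (rule nn_integral_cong)
    fix x
    show "h (poly P x) * (ennreal (nrm (poly (pderiv P) x)) * indicator (cball z (rad k)) x)
      = (ennreal (nrm (poly (pderiv P) z)) * indicator (cball z (rad k)) x) * h (poly P x)"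
    proof (cases "x \<in> cball z (rad k)")
      case True
      show ?thesis
        unfolding nrm_pderiv_eq[OF P z k rad_le_1 True] by (rule mult.commute)
    qed simp
  qed
  also have "\<dots> = (\<integral>\<^sup>+x. h (poly P x)
      \<partial>density \<mu> (\<lambda>x. ennreal (nrm (poly (pderiv P) z)) * indicator (cball z (rad k)) x))"
    by (rule nn_integral_density[symmetric]) measurable
  also have "\<dots> = (\<integral>\<^sup>+c. h c
      \<partial>distr (density \<mu> (\<lambda>x. ennreal (nrm (poly (pderiv P) z)) * indicator (cball z (rad k)) x)) borel (poly P))"
    by (rule nn_integral_distr[symmetric]) measurable
  also have "\<dots> = (\<integral>\<^sup>+c. indicator (poly P ` cball z (rad k)) c * h c \<partial>\<mu>)"
    unfolding distr_poly_cball[OF P z k] by (rule nn_integral_density) measurable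
  finally show ?thesis
    by (simp only: mult.commute)
qed

end

section \<open>Finite nets of balls and measurability of the number of roots\<close>

context local_field
begin

lemma ex_net:
  "\<exists>N. finite N \<and> N \<subseteq> R \<and> (\<forall>x\<in>R. \<exists>!y. y \<in> N \<and> x \<in> cball y (rad k))"
proof -
  \<comment> \<open>The representative is chosen from the ball as a set, so all points of one ball
    share it. This is the source of uniqueness; total boundedness makes the set of representatives
    finite.\<close>
  define rep where "rep B = (SOME x. x \<in> R \<and> x \<in> B)" for B :: "'a set"
  define N where "N = (\<lambda>x. rep (cball x (rad k))) ` R"
  have "\<exists>F. finite F \<and> R \<subseteq> (\<Union>x\<in>F. ball x (rad k))"
    using compact_integers rad_pos[of k] unfolding compact_eq_totally_bounded by simp
  then obtain F where F: "finite F" "R \<subseteq> (\<Union>x\<in>F. ball x (rad k))"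
    by (elim exE conjE)
  have rep: "rep (cball x (rad k)) \<in> R \<and> rep (cball x (rad k)) \<in> cball x (rad k)" if "x \<in> R" for x
    unfolding rep_def by (rule someI[of _ x]) (simp add: that)
  have ball: "cball (rep (cball x (rad k))) (rad k) = cball x (rad k)" if "x \<in> R" for x
    by (rule cball_recenter, rule conjunct2[OF rep[OF that]])
  have "N \<subseteq> (\<lambda>x. rep (cball x (rad k))) ` F"
  proof
    fix y assume "y \<in> N"
    then obtain x where x: "x \<in> R" "y = rep (cball x (rad k))"
      unfolding N_def by (elim imageE)
    obtain z where z: "z \<in> F" "x \<in> ball z (rad k)"
      using F(2) x(1) by (elim subsetD[THEN UN_E])
    have "cball x (rad k) = cball z (rad k)"
      by (rule cball_recenter, rule subsetD[OF ball_subset_cball z(2)])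
    then show "y \<in> (\<lambda>x. rep (cball x (rad k))) ` F"
      using z(1) x(2) by (intro image_eqI[of _ _ z]) simp_all
  qed
  then have "finite N"
    using F(1) by (rule finite_surj[rotated])
  moreover have "N \<subseteq> R"
    unfolding N_def using rep by (intro image_subsetI) simp
  moreover have "\<exists>!y. y \<in> N \<and> x \<in> cball y (rad k)" if "x \<in> R" for x
  proof (rule ex1I)
    show "rep (cball x (rad k)) \<in> N \<and> x \<in> cball (rep (cball x (rad k))) (rad k)"
      unfolding ball[OF that] N_def using that by (intro conjI imageI) simp_all
    fix y assume y: "y \<in> N \<and> x \<in> cball y (rad k)"
    then obtain z where z: "z \<in> R" "y = rep (cball z (rad k))"
      unfolding N_def by (elim conjE imageE)
    have "cball z (rad k) = cball y (rad k)"
      unfolding z(2) by (rule ball[OF z(1), symmetric])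
    also have "\<dots> = cball x (rad k)"
      by (rule cball_recenter[symmetric], rule conjunct2[OF y])
    finally show "y = rep (cball x (rad k))"
      using z(2) by simp
  qed
  ultimately show ?thesis
    by (intro exI[of _ N] conjI ballI)
qed

definition net :: "nat \<Rightarrow> 'a set" where
  "net k = (SOME N. finite N \<and> N \<subseteq> R \<and> (\<forall>x\<in>R. \<exists>!y. y \<in> N \<and> x \<in> cball y (rad k)))"

lemma finite_net: "finite (net k)"
  and net_subset: "net k \<subseteq> R"
  and net_ex1: "x \<in> R \<Longrightarrow> \<exists>!y. y \<in> net k \<and> x \<in> cball y (rad k)"
  using someI_ex[OF ex_net[of k]] unfolding net_def by blast+

lemma net_disjoint: "disjoint_family_on (\<lambda>y. cball y (rad k)) (net k)"
  unfolding disjoint_family_on_def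
proof (intro ballI impI)
  fix y z assume yz: "y \<in> net k" "z \<in> net k" "y \<noteq> z"
  have "x \<in> R" if "x \<in> cball y (rad k)" for x
    using cball_subset_integers[of y "rad k"] rad_le_1 net_subset yz(1) that by blast
  then show "cball y (rad k) \<inter> cball z (rad k) = {}"
    using net_ex1[of _ k] yz by blast
qed

text \<open>The subsets of \<open>R\<close> that are open and closed, given by one radius that works
  at all points. The uniform radius lets finite nets describe \<open>U\<close> at every fine enough
  scale.\<close>

definition fat :: "'a set \<Rightarrow> bool" where
  "fat U \<longleftrightarrow> U \<subseteq> R \<and> (\<exists>k. \<forall>x\<in>U. cball x (rad k) \<subseteq> U)"

lemma fat_subset: "fat U \<Longrightarrow> U \<subseteq> R"
  by (simp add: fat_def)

lemma fat_borel [measurable]: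
  assumes "fat U"
  shows "U \<in> sets borel"
proof (rule borel_open)
  obtain k where "\<forall>x\<in>U. cball x (rad k) \<subseteq> U"
    using assms unfolding fat_def by blast
  then show "open U"
    unfolding open_contains_cball using rad_pos by blast
qed

text \<open>The count is taken in \<open>ennreal\<close> so that infinitely many roots are a
  legitimate value and nonnegative integration applies directly.\<close>

definition nz :: "'a set \<Rightarrow> 'a poly \<Rightarrow> ennreal" where
  "nz U P = emeasure (count_space UNIV) {x \<in> U. poly P x = 0}"

text \<open>This turns the existence of a root into countably many strict inequalities on the dense
  sequence. The converse direction is compactness: points with ever smaller values accumulate at a
  root.\<close>

lemma ex_root_iff:
  assumes "y \<in> R"
  shows "(\<exists>x\<in>cball y (rad k). poly P x = 0) \<longleftrightarrow>
    (\<forall>m. \<exists>i. dseq i \<in> cball y (rad k) \<and> nrm (poly P (dseq i)) < 1 / Suc m)"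
proof
  assume "\<exists>x\<in>cball y (rad k). poly P x = 0"
  then obtain x where x: "x \<in> cball y (rad k)" "poly P x = 0" by blast
  show "\<forall>m. \<exists>i. dseq i \<in> cball y (rad k) \<and> nrm (poly P (dseq i)) < 1 / Suc m"
  proof
    fix m
    have "(\<lambda>n. nrm (poly P (dseq (dindex n x)))) \<longlonglongrightarrow> nrm (poly P x)"
      by (intro tendsto_nrm tendsto_poly_nrm dindex_tendsto)
    then have "\<forall>\<^sub>F n in sequentially. nrm (poly P (dseq (dindex n x))) < 1 / Suc m"
      by (rule order_tendstoD) (simp add: x(2))
    moreover have "\<forall>\<^sub>F n in sequentially. dseq (dindex n x) \<in> cball y (rad k)"
      by (rule topological_tendstoD[OF dindex_tendsto open_cball[OF rad_pos] x(1)])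
    ultimately have "\<forall>\<^sub>F n in sequentially.
        dseq (dindex n x) \<in> cball y (rad k) \<and> nrm (poly P (dseq (dindex n x))) < 1 / Suc m"
      by eventually_elim simp
    then obtain n where "dseq (dindex n x) \<in> cball y (rad k) \<and> nrm (poly P (dseq (dindex n x))) < 1 / Suc m"
      using eventually_happens'[OF sequentially_bot] by blast
    then show "\<exists>i. dseq i \<in> cball y (rad k) \<and> nrm (poly P (dseq i)) < 1 / Suc m"
      by blast
  qed
next
  assume "\<forall>m. \<exists>i. dseq i \<in> cball y (rad k) \<and> nrm (poly P (dseq i)) < 1 / Suc m"
  then obtain i where i: "\<And>m. dseq (i m) \<in> cball y (rad k) \<and> nrm (poly P (dseq (i m))) < 1 / Suc m"
    using choice[of "\<lambda>m i. dseq i \<in> cball y (rad k) \<and> nrm (poly P (dseq i)) < 1 / Suc m"] by blast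
  define s where "s m = dseq (i m)" for m
  have s: "\<And>m. s m \<in> cball y (rad k)" "\<And>m. nrm (poly P (s m)) < 1 / Suc m"
    using i unfolding s_def by blast+
  have "compact (R \<inter> cball y (rad k))"
    by (intro compact_Int_closed compact_integers closed_cball)
  moreover have "R \<inter> cball y (rad k) = cball y (rad k)"
    using cball_subset_integers[OF assms rad_le_1] by blast
  ultimately have "compact (cball y (rad k))"
    by simp
  then obtain l r where l: "l \<in> cball y (rad k)" "strict_mono r" "(s \<circ> r) \<longlonglongrightarrow> l"
    using s(1) seq_compactE[of "cball y (rad k)" s] unfolding compact_eq_seq_compact_metric by blast
  have "(\<lambda>n. nrm (poly P ((s \<circ> r) n))) \<longlonglongrightarrow> nrm (poly P l)"
    by (intro tendsto_nrm tendsto_poly_nrm l)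
  moreover have "(\<lambda>n. nrm (poly P ((s \<circ> r) n))) \<longlonglongrightarrow> 0"
  proof (rule tendsto_0_le_nonneg)
    show "(\<lambda>n. 1 / real (Suc n)) \<longlonglongrightarrow> 0"
      using LIMSEQ_inverse_real_of_nat by (simp add: inverse_eq_divide)
    fix n
    have "nrm (poly P ((s \<circ> r) n)) \<le> 1 / real (Suc (r n))"
      using s(2)[of "r n"] by simp
    also have "\<dots> \<le> 1 / real (Suc n)"
      using seq_suble[OF l(2), of n] by (intro divide_left_mono) auto
    finally show "nrm (poly P ((s \<circ> r) n)) \<le> 1 / real (Suc n)" .
  qed simp
  ultimately have "nrm (poly P l) = 0"
    by (rule LIMSEQ_unique)
  then show "\<exists>x\<in>cball y (rad k). poly P x = 0"
    using l(1) by auto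
qed

lemma pred_ex_root:
  assumes "y \<in> R"
  shows "{P. \<exists>x\<in>cball y (rad k). poly P x = 0} \<in> sets poly_borel"
proof -
  have "{P \<in> space poly_borel. \<forall>m. \<exists>i. dseq i \<in> cball y (rad k) \<and> nrm (poly P (dseq i)) < 1 / Suc m}
      \<in> sets poly_borel"
    by measurable
  then show ?thesis
    unfolding ex_root_iff[OF assms] by simp
qed

lemma finite_separated:
  assumes "finite (F :: 'a set)"
  shows "\<exists>k. \<forall>x\<in>F. \<forall>y\<in>F. x \<noteq> y \<longrightarrow> rad k < nrm (x - y)"
  using assms
proof (induction F rule: finite_induct)
  case (insert a F)
  obtain k where k: "\<And>x y. x \<in> F \<Longrightarrow> y \<in> F \<Longrightarrow> x \<noteq> y \<Longrightarrow> rad k < nrm (x - y)"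
    using insert.IH by blast
  obtain d where d: "d > 0" "\<And>x. x \<in> F \<Longrightarrow> x \<noteq> a \<Longrightarrow> d \<le> dist a x"
    using finite_set_avoid[OF insert.hyps(1), of a] by blast
  obtain j where j: "rad j < d"
    using rad_small d(1) by blast
  have a: "rad j < nrm (a - x)" "rad j < nrm (x - a)" if "x \<in> F" "x \<noteq> a" for x
    using d(2)[OF that] j by (auto simp: dist_eq nrm_minus_commute)
  have "rad (max j k) < nrm (x - y)" if "x \<in> insert a F" "y \<in> insert a F" "x \<noteq> y" for x y
  proof (cases "x = a \<or> y = a")
    case True
    then have "rad j < nrm (x - y)"
      using a that by auto
    then show ?thesis
      using rad_antimono[of j "max j k"] by simp
  next
    case False
    then have "rad k < nrm (x - y)"
      using k that by blast
    then show ?thesis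
      using rad_antimono[of k "max j k"] by simp
  qed
  then show ?case
    by blast
qed simp

text \<open>The number of disjoint net balls containing a root bounds the number of roots from
  below. Below the mutual distances of any finite set of roots, each of them has its own ball. The
  shift by \<open>k0\<close> keeps every ball centred in \<open>U\<close> inside
  \<open>U\<close>.\<close>

lemma nz_eq_SUP:
  assumes U: "U \<subseteq> R" "\<forall>x\<in>U. cball x (rad k0) \<subseteq> U"
  shows "nz U P = (SUP k. \<Sum>y\<in>net (k0 + k) \<inter> U. indicator {P. \<exists>x\<in>cball y (rad (k0 + k)). poly P x = 0} P)"
    (is "_ = (SUP k. ?c k)")
proof (rule antisym)
  define S where "S = {x \<in> U. poly P x = 0}"
  have sub: "cball x (rad (k0 + k)) \<subseteq> U" if "x \<in> U" for x k
    using U(2) that subset_cball[OF rad_antimono[of k0 "k0 + k"], of x] by auto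
  show "(SUP k. ?c k) \<le> nz U P"
  proof (rule SUP_least)
    fix k
    have disj: "disjoint_family_on (\<lambda>y. cball y (rad (k0 + k)) \<inter> S) (net (k0 + k) \<inter> U)"
      using net_disjoint[of "k0 + k"] unfolding disjoint_family_on_def by blast
    have "?c k \<le> (\<Sum>y\<in>net (k0 + k) \<inter> U. emeasure (count_space UNIV) (cball y (rad (k0 + k)) \<inter> S))"
    proof (rule sum_mono)
      fix y assume y: "y \<in> net (k0 + k) \<inter> U"
      show "indicator {P. \<exists>x\<in>cball y (rad (k0 + k)). poly P x = 0} P
        \<le> emeasure (count_space UNIV) (cball y (rad (k0 + k)) \<inter> S)"
      proof (cases "\<exists>x\<in>cball y (rad (k0 + k)). poly P x = 0")
        case True
        then obtain x where x: "x \<in> cball y (rad (k0 + k)) \<inter> S"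
          using sub[of y k] y unfolding S_def by blast
        have "1 = emeasure (count_space UNIV) {x}"
          by simp
        also have "\<dots> \<le> emeasure (count_space UNIV) (cball y (rad (k0 + k)) \<inter> S)"
          using x by (intro emeasure_mono) auto
        finally show ?thesis
          using True by simp
      qed simp
    qed
    also have "\<dots> = emeasure (count_space UNIV) (\<Union>y\<in>net (k0 + k) \<inter> U. cball y (rad (k0 + k)) \<inter> S)"
      using disj finite_net by (intro sum_emeasure) auto
    also have "\<dots> \<le> nz U P"
      unfolding nz_def S_def by (intro emeasure_mono) auto
    finally show "?c k \<le> nz U P" .
  qed
  have fin: "of_nat (card F) \<le> (SUP k. ?c k)" if F: "finite F" "F \<subseteq> S" for F
  proof -
    obtain k where k: "\<forall>x\<in>F. \<forall>y\<in>F. x \<noteq> y \<longrightarrow> rad k < nrm (x - y)"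
      using finite_separated[OF F(1)] by blast
    define Y where "Y = {y \<in> net (k0 + k) \<inter> U. \<exists>x\<in>cball y (rad (k0 + k)). poly P x = 0}"
    have "\<forall>x\<in>F. \<exists>y. y \<in> Y \<and> x \<in> cball y (rad (k0 + k))"
    proof
      fix x assume "x \<in> F"
      then have x: "x \<in> U" "poly P x = 0"
        using F(2) unfolding S_def by auto
      obtain y where y: "y \<in> net (k0 + k)" "x \<in> cball y (rad (k0 + k))"
        using net_ex1 x(1) U(1) by blast
      have "y \<in> U"
        using sub[OF x(1), of k] cball_recenter[OF y(2)] by auto
      then show "\<exists>y. y \<in> Y \<and> x \<in> cball y (rad (k0 + k))"
        using x y unfolding Y_def by blast
    qed
    then obtain f where f: "\<And>x. x \<in> F \<Longrightarrow> f x \<in> Y \<and> x \<in> cball (f x) (rad (k0 + k))"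
      by metis
    have "inj_on f F"
    proof (rule inj_onI, rule ccontr)
      fix x x' assume xx: "x \<in> F" "x' \<in> F" "f x = f x'" "x \<noteq> x'"
      have "nrm (x - f x) \<le> rad (k0 + k)" "nrm (f x - x') \<le> rad (k0 + k)"
        using f[OF xx(1)] f[OF xx(2)] xx(3) unfolding mem_cball_iff by (auto simp: nrm_minus_commute)
      then have "nrm (x - x') \<le> rad (k0 + k)"
        using nrm_triangle[of x x' "f x"] by simp
      also have "\<dots> \<le> rad k"
        by (rule rad_antimono) simp
      finally show False
        using k xx by force
    qed
    moreover have "f ` F \<subseteq> Y"
      using f by blast
    moreover have fY: "finite Y"
      using finite_net unfolding Y_def by auto
    ultimately have "card F \<le> card Y"
      by (rule card_inj_on_le)
    then have "of_nat (card F) \<le> (of_nat (card Y) :: ennreal)"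
      by simp
    also have "\<dots> = ?c k"
    proof -
      have "?c k = (\<Sum>y\<in>net (k0 + k) \<inter> U. if y \<in> Y then 1 else 0)"
        by (rule sum.cong) (auto simp: Y_def indicator_def)
      also have "\<dots> = (\<Sum>y\<in>net (k0 + k) \<inter> U \<inter> Y. 1)"
        using finite_net by (intro sum.inter_restrict[symmetric]) simp
      also have "net (k0 + k) \<inter> U \<inter> Y = Y"
        unfolding Y_def by blast
      finally show ?thesis by simp
    qed
    also have "\<dots> \<le> (SUP k. ?c k)"
      by (rule SUP_upper) simp
    finally show ?thesis .
  qed
  show "nz U P \<le> (SUP k. ?c k)"
  proof (cases "finite S")
    case True
    then show ?thesis
      using fin[of S] unfolding nz_def S_def by simp
  next
    case False
    have "of_nat n \<le> (SUP k. ?c k)" for n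
    proof -
      obtain F where "finite F" "F \<subseteq> S" "card F = n"
        using infinite_arbitrarily_large[OF False, of n] by blast
      then show ?thesis
        using fin[of F] by simp
    qed
    then have "\<not> (SUP k. ?c k) < top"
      using ennreal_Ex_less_of_nat leD by blast
    then have "(SUP k. ?c k) = top"
      using less_top by blast
    then show ?thesis
      by (simp only: top_greatest)
  qed
qed

lemma measurable_nz':
  assumes "fat U"
  shows "nz U \<in> borel_measurable poly_borel"
proof -
  obtain k0 where k0: "\<forall>x\<in>U. cball x (rad k0) \<subseteq> U"
    using assms unfolding fat_def by blast
  have "(\<lambda>P. SUP k. \<Sum>y\<in>net (k0 + k) \<inter> U. indicator {P. \<exists>x\<in>cball y (rad (k0 + k)). poly P x = 0} P :: ennreal)
    \<in> borel_measurable poly_borel"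
  proof (intro borel_measurable_SUP borel_measurable_sum borel_measurable_indicator pred_ex_root)
    fix y k assume "y \<in> net (k0 + k) \<inter> U"
    then show "y \<in> R"
      using net_subset by blast
  qed simp
  then show ?thesis
    unfolding nz_eq_SUP[OF fat_subset[OF assms] k0, abs_def] .
qed

lemma measurable_nz [measurable (raw)]:
  "fat U \<Longrightarrow> f \<in> M \<rightarrow>\<^sub>M poly_borel \<Longrightarrow> (\<lambda>\<omega>. nz U (f \<omega>)) \<in> borel_measurable M"
  using measurable_compose measurable_nz' by blast

end

section \<open>The area formula on the whole domain\<close>

context local_field
begin

lemma measurable_poly_const [measurable]: "poly (P :: 'a poly) \<in> borel_measurable borel"
  by (simp add: borel_measurable_continuous_onI continuous_on_poly_nrm)

lemma pderiv_eq_0_imp_const: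
  assumes "pderiv P = (0 :: 'a poly)"
  shows "P = [:coeff P 0:]"
proof (rule poly_eqI)
  fix i
  show "coeff P i = coeff [:coeff P 0:] i"
  proof (cases i)
    case (Suc j)
    have "coeff (pderiv P) j = 0"
      using assms by simp
    then have "of_nat (Suc j) * coeff P (Suc j) = 0"
      by (simp only: coeff_pderiv)
    then show ?thesis
      using of_nat_neq_0[of "Suc j"] Suc by (simp del: of_nat_Suc)
  qed simp
qed

text \<open>The area formula: at level \<open>k\<close>, only the balls on which the derivative exceeds
  the radius are used; there the polynomial is a similarity onto a ball.\<close>

lemma area_formula:
  assumes P: "\<And>i. coeff P i \<in> R" and U: "fat U"
    and h [measurable]: "h \<in> borel_measurable borel"
  shows "(\<integral>\<^sup>+c. h c * nz U (P - [:c:]) \<partial>\<mu>)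
    = (\<integral>\<^sup>+x. h (poly P x) * (ennreal (nrm (poly (pderiv P) x)) * indicator U x) \<partial>\<mu>)"
proof (cases "pderiv P = 0")
  \<comment> \<open>In characteristic 0 the polynomial is constant: the left integrand vanishes off
    a single value of \<open>c\<close>, a null set, and the right integrand has weight 0.\<close>
  case True
  then have PC: "P = [:coeff P 0:]"
    by (rule pderiv_eq_0_imp_const)
  have nz0: "nz U (P - [:c:]) = 0" if "c \<noteq> coeff P 0" for c
  proof -
    have "poly (P - [:c:]) x \<noteq> 0" for x
      using that by (subst PC) simp
    then show ?thesis
      unfolding nz_def by simp
  qed
  have "AE c in \<mu>. c \<notin> {coeff P 0}"
    by (rule AE_notin_finite) simp
  then have "AE c in \<mu>. h c * nz U (P - [:c:]) = 0"
    by eventually_elim (simp add: nz0)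
  then have "(\<integral>\<^sup>+c. h c * nz U (P - [:c:]) \<partial>\<mu>) = (\<integral>\<^sup>+c. 0 \<partial>\<mu>)"
    by (rule nn_integral_cong_AE)
  then show ?thesis
    using True by simp
next
  case False
  note [measurable] = fat_borel[OF U]
  define bad where "bad = {x. poly (pderiv P) x = 0}"
  have bad: "finite bad"
    unfolding bad_def by (rule poly_roots_finite[OF False])
  have [measurable]: "bad \<in> sets borel"
    using bad by (intro borel_closed finite_imp_closed)
  obtain k0 where k0: "\<forall>x\<in>U. cball x (rad k0) \<subseteq> U"
    using U unfolding fat_def by blast
  have UR: "U \<subseteq> R"
    using U by (rule fat_subset)
  \<comment> \<open>The balls of radius \<open>rad k\<close> on which the polynomial is a similarity
    and which fit into \<open>U\<close>. These sets increase with \<open>k\<close> and exhaust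
    \<open>U\<close> without the critical points.\<close>
  define W where "W k = {x \<in> U. rad k < nrm (poly (pderiv P) x) \<and> cball x (rad k) \<subseteq> U}" for k
  have WR: "W k \<subseteq> R" for k
    using UR unfolding W_def by blast
  have W_ball: "cball x (rad k) \<subseteq> W k" if x: "x \<in> W k" for x k
  proof
    fix y assume y: "y \<in> cball x (rad k)"
    have x': "x \<in> R" "rad k < nrm (poly (pderiv P) x)" "cball x (rad k) \<subseteq> U"
      using x WR unfolding W_def by blast+
    have "nrm (poly (pderiv P) y) = nrm (poly (pderiv P) x)"
      by (rule nrm_pderiv_eq[OF P x'(1,2) rad_le_1 y])
    moreover have "cball y (rad k) = cball x (rad k)"
      by (rule cball_recenter[OF y])
    ultimately show "y \<in> W k"
      using x'(2,3) subsetD[OF x'(3) y] unfolding W_def by (simp del: mem_cball)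
  qed
  define N where "N k = net k \<inter> W k" for k
  have finN: "finite (N k)" for k
    using finite_net unfolding N_def by auto
  have N_R: "y \<in> R" and N_rad: "rad k < nrm (poly (pderiv P) y)" if "y \<in> N k" for y k
    using that UR unfolding N_def W_def by auto
  have disj: "disjoint_family_on (\<lambda>y. cball y (rad k)) (N k)" for k
    using net_disjoint[of k] unfolding N_def disjoint_family_on_def by blast
  have W_eq: "W k = (\<Union>y\<in>N k. cball y (rad k))" for k
  proof (intro equalityI subsetI)
    fix x assume x: "x \<in> W k"
    then obtain y where y: "y \<in> net k" "x \<in> cball y (rad k)"
      using net_ex1 WR by blast
    have "y \<in> cball x (rad k)"
      unfolding cball_recenter[OF y(2)] by simp
    then have "y \<in> W k"
      by (rule subsetD[OF W_ball[OF x]])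
    then show "x \<in> (\<Union>y\<in>N k. cball y (rad k))"
      using y unfolding N_def by blast
  next
    fix x assume "x \<in> (\<Union>y\<in>N k. cball y (rad k))"
    then obtain y where "y \<in> W k" "x \<in> cball y (rad k)"
      unfolding N_def by blast
    then show "x \<in> W k"
      using W_ball by blast
  qed
  have [measurable]: "W k \<in> sets borel" for k
    unfolding W_eq using finN by (intro sets.finite_UN) auto
  define cnt where "cnt k c = emeasure (count_space UNIV) {x \<in> W k. poly P x = c}" for k c
  have img [measurable]: "poly P ` cball y (rad k) \<in> sets borel" if "y \<in> N k" for y k
    unfolding poly_image_cball[OF compact_imp_complete[OF compact_integers] P N_R[OF that] rad_pos N_rad[OF that] rad_le_1]
    by (rule borel_cball)
  \<comment> \<open>The polynomial is injective on each ball of the net, so the number of solutions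
    there is the indicator of the image.\<close>
  have cnt_eq: "cnt k c = (\<Sum>y\<in>N k. indicator (poly P ` cball y (rad k)) c)" for k c
  proof -
    have "cnt k c = emeasure (count_space UNIV) (\<Union>y\<in>N k. {x \<in> cball y (rad k). poly P x = c})"
      unfolding cnt_def W_eq by (rule arg_cong[of _ _ "emeasure _"]) blast
    also have "\<dots> = (\<Sum>y\<in>N k. emeasure (count_space UNIV) {x \<in> cball y (rad k). poly P x = c})"
    proof (rule sum_emeasure[symmetric])
      show "disjoint_family_on (\<lambda>y. {x \<in> cball y (rad k). poly P x = c}) (N k)"
        using disj[of k] unfolding disjoint_family_on_def by blast
    qed (use finN in auto)
    also have "\<dots> = (\<Sum>y\<in>N k. indicator (poly P ` cball y (rad k)) c)"
    proof (rule sum.cong)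
      fix y assume y: "y \<in> N k"
      show "emeasure (count_space UNIV) {x \<in> cball y (rad k). poly P x = c}
        = indicator (poly P ` cball y (rad k)) c"
      proof (cases "c \<in> poly P ` cball y (rad k)")
        case True
        then obtain x where x: "x \<in> cball y (rad k)" "c = poly P x" by blast
        have "x' = x" if "x' \<in> cball y (rad k)" "poly P x' = c" for x'
        proof -
          have "nrm (poly P x' - poly P x) = nrm (poly (pderiv P) y) * nrm (x' - x)"
            by (rule nrm_poly_diff_eq[OF P N_R[OF y] N_rad[OF y] rad_le_1 that(1) x(1)])
          then have "nrm (poly (pderiv P) y) * nrm (x' - x) = 0"
            using that(2) x(2) by simp
          moreover have "nrm (poly (pderiv P) y) \<noteq> 0"
            using less_trans[OF rad_pos N_rad[OF y]] by simp
          ultimately show ?thesis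
            by simp
        qed
        then have "{x \<in> cball y (rad k). poly P x = c} = {x}"
          using x by blast
        then have "emeasure (count_space UNIV) {x \<in> cball y (rad k). poly P x = c} = emeasure (count_space UNIV) {x}"
          by (rule arg_cong)
        then show ?thesis
          using True by simp
      next
        case False
        then have "{x \<in> cball y (rad k). poly P x = c} = {}"
          by blast
        then show ?thesis
          using False by (simp only: emeasure_empty indicator_simps not_False_eq_True)
      qed
    qed simp
    finally show ?thesis .
  qed
  have [measurable]: "cnt k \<in> borel_measurable borel" for k
    unfolding cnt_eq[abs_def] by (intro borel_measurable_sum borel_measurable_indicator img)
  have ind_W: "indicator (W k) x = (\<Sum>y\<in>N k. indicator (cball y (rad k)) x :: ennreal)" for k x
    unfolding W_eq using finN disj by (intro indicator_UN_disjoint)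
  have level: "(\<integral>\<^sup>+c. h c * cnt k c \<partial>\<mu>)
    = (\<integral>\<^sup>+x. h (poly P x) * (ennreal (nrm (poly (pderiv P) x)) * indicator (W k) x) \<partial>\<mu>)" for k
  proof -
    have "(\<integral>\<^sup>+c. h c * cnt k c \<partial>\<mu>) = (\<integral>\<^sup>+c. (\<Sum>y\<in>N k. h c * indicator (poly P ` cball y (rad k)) c) \<partial>\<mu>)"
      unfolding cnt_eq by (simp only: sum_distrib_left)
    also have "\<dots> = (\<Sum>y\<in>N k. \<integral>\<^sup>+c. h c * indicator (poly P ` cball y (rad k)) c \<partial>\<mu>)"
    proof (rule nn_integral_sum)
      fix y assume "y \<in> N k"
      note [measurable] = img[OF this]
      show "(\<lambda>c. h c * indicator (poly P ` cball y (rad k)) c) \<in> borel_measurable \<mu>"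
        by measurable
    qed
    also have "\<dots> = (\<Sum>y\<in>N k. \<integral>\<^sup>+x. h (poly P x) *
        (ennreal (nrm (poly (pderiv P) x)) * indicator (cball y (rad k)) x) \<partial>\<mu>)"
      by (intro sum.cong refl nn_integral_poly_cball[symmetric] P N_R N_rad h)
    also have "\<dots> = (\<integral>\<^sup>+x. (\<Sum>y\<in>N k. h (poly P x) *
        (ennreal (nrm (poly (pderiv P) x)) * indicator (cball y (rad k)) x)) \<partial>\<mu>)"
      by (intro nn_integral_sum[symmetric]) measurable
    finally show ?thesis
      unfolding ind_W by (simp only: sum_distrib_left)
  qed
  have W_mono: "W j \<subseteq> W k" if "j \<le> k" for j k
  proof
    fix x assume "x \<in> W j"
    then show "x \<in> W k"
      using rad_antimono[OF that] subset_cball[OF rad_antimono[OF that], of x] unfolding W_def by auto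
  qed
  have W_UN: "(\<Union>k. W k) = U - bad"
  proof (intro equalityI subsetI)
    fix x assume "x \<in> (\<Union>k. W k)"
    then obtain k where "x \<in> U" "rad k < nrm (poly (pderiv P) x)"
      unfolding W_def by blast
    then show "x \<in> U - bad"
      using less_trans[OF rad_pos[of k], of "nrm (poly (pderiv P) x)"] unfolding bad_def by simp
  next
    fix x assume x: "x \<in> U - bad"
    then have "0 < nrm (poly (pderiv P) x)"
      unfolding bad_def by simp
    then obtain k where k: "rad k < nrm (poly (pderiv P) x)"
      using rad_small by blast
    have "rad (max k0 k) \<le> rad k0" "rad (max k0 k) \<le> rad k"
      by (simp_all add: rad_antimono)
    then have "x \<in> W (max k0 k)"
      using x k k0 subset_cball[of "rad (max k0 k)" "rad k0" x] unfolding W_def by auto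
    then show "x \<in> (\<Union>k. W k)"
      by blast
  qed
  have cnt_SUP: "(SUP k. cnt k c) = emeasure (count_space UNIV) {x \<in> U - bad. poly P x = c}" for c
  proof -
    have "(SUP k. cnt k c) = emeasure (count_space UNIV) (\<Union>k. {x \<in> W k. poly P x = c})"
      unfolding cnt_def using W_mono by (intro SUP_emeasure_incseq) (auto simp: incseq_def)
    also have "(\<Union>k. {x \<in> W k. poly P x = c}) = {x \<in> U - bad. poly P x = c}"
      using W_UN by blast
    finally show ?thesis .
  qed
  have cnt_mono: "cnt j c \<le> cnt k c" if "j \<le> k" for j k c
    unfolding cnt_def using W_mono[OF that] by (intro emeasure_mono) auto
  have ind_SUP: "(SUP k. indicator (W k) x) = (indicator (U - bad) x :: ennreal)" for x
  proof (cases "x \<in> U - bad")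
    case True
    then obtain k where "x \<in> W k"
      using W_UN by blast
    then have "1 \<le> (SUP k. indicator (W k) x :: ennreal)"
      by (intro SUP_upper2[of k]) simp_all
    moreover have "(SUP k. indicator (W k) x :: ennreal) \<le> 1"
      by (intro SUP_least) (simp add: indicator_def)
    ultimately have "(SUP k. indicator (W k) x :: ennreal) = 1"
      by (rule antisym[rotated])
    then show ?thesis
      using True by simp
  next
    case False
    then have "x \<notin> W k" for k
      using W_UN by blast
    then show ?thesis
      using False by simp
  qed
  have lhs: "(\<integral>\<^sup>+c. h c * emeasure (count_space UNIV) {x \<in> U - bad. poly P x = c} \<partial>\<mu>)
      = (SUP k. \<integral>\<^sup>+c. h c * cnt k c \<partial>\<mu>)"
    unfolding cnt_SUP[symmetric] SUP_mult_left_ennreal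
    by (rule nn_integral_monotone_convergence_SUP)
      (auto simp: incseq_def le_fun_def intro: mult_left_mono[OF cnt_mono])
  have rhs: "(\<integral>\<^sup>+x. h (poly P x) * (ennreal (nrm (poly (pderiv P) x)) * indicator (U - bad) x) \<partial>\<mu>)
      = (SUP k. \<integral>\<^sup>+x. h (poly P x) * (ennreal (nrm (poly (pderiv P) x)) * indicator (W k) x) \<partial>\<mu>)"
    unfolding ind_SUP[symmetric] SUP_mult_left_ennreal
  proof (rule nn_integral_monotone_convergence_SUP)
    show "incseq (\<lambda>k x. h (poly P x) * (ennreal (nrm (poly (pderiv P) x)) * indicator (W k) x))"
      unfolding incseq_def le_fun_def
    proof (intro allI impI mult_left_mono)
      fix j k :: nat and x assume "j \<le> k"
      then show "indicator (W j) x \<le> (indicator (W k) x :: ennreal)"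
        using W_mono[of j k] by (cases "x \<in> W j") auto
    qed simp_all
  qed measurable
  have "(\<integral>\<^sup>+c. h c * nz U (P - [:c:]) \<partial>\<mu>)
      = (\<integral>\<^sup>+c. h c * emeasure (count_space UNIV) {x \<in> U - bad. poly P x = c} \<partial>\<mu>)"
  proof (rule nn_integral_cong_AE)
    \<comment> \<open>Discarding the critical points affects the count only at critical values, of
      which there are finitely many.\<close>
    have "AE c in \<mu>. c \<notin> poly P ` bad"
      using bad by (intro AE_notin_finite) simp
    then show "AE c in \<mu>. h c * nz U (P - [:c:])
        = h c * emeasure (count_space UNIV) {x \<in> U - bad. poly P x = c}"
    proof eventually_elim
      case (elim c)
      then have "{x \<in> U. poly (P - [:c:]) x = 0} = {x \<in> U - bad. poly P x = c}"
        by auto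
      then show ?case
        unfolding nz_def by simp
    qed
  qed
  also have "\<dots> = (\<integral>\<^sup>+x. h (poly P x) * (ennreal (nrm (poly (pderiv P) x)) * indicator (U - bad) x) \<partial>\<mu>)"
    unfolding lhs rhs level ..
  also have "\<dots> = (\<integral>\<^sup>+x. h (poly P x) * (ennreal (nrm (poly (pderiv P) x)) * indicator U x) \<partial>\<mu>)"
    by (rule nn_integral_cong) (auto simp: bad_def indicator_def)
  finally show ?thesis .
qed

end

section \<open>Moments of the number of zeros\<close>

text \<open>Differentiate the division identity by X - x and evaluate at \<open>x\<close>. This
  converts the derivative weight of the area formula into a value of the quotient.\<close>

lemma poly_synthetic_div_self: "poly (synthetic_div P x) x = poly (pderiv P) (x :: 'a :: idom)"
proof -
  have "pderiv P = pderiv ([:-x, 1:] * synthetic_div P x + [:poly P x:])"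
    by (simp only: synthetic_div_correct')
  also have "\<dots> = [:-x, 1:] * pderiv (synthetic_div P x) + synthetic_div P x"
    unfolding pderiv_add pderiv_mult by (simp add: pderiv_pCons)
  finally show ?thesis
    by simp
qed

context local_field
begin

lemma measurable_linear_factor [measurable (raw)]:
  fixes f :: "'b \<Rightarrow> 'a"
  assumes [measurable]: "f \<in> borel_measurable M" "g \<in> M \<rightarrow>\<^sub>M poly_borel"
  shows "(\<lambda>\<omega>. [:- f \<omega>, 1:] * g \<omega>) \<in> M \<rightarrow>\<^sub>M poly_borel"
proof (rule measurable_poly_borelI)
  fix i
  have "(\<lambda>\<omega>. - f \<omega> * coeff (g \<omega>) i + coeff (pCons 0 (g \<omega>)) i) \<in> borel_measurable M"
    by measurable
  then show "(\<lambda>\<omega>. coeff ([:- f \<omega>, 1:] * g \<omega>) i) \<in> borel_measurable M"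
    by simp
qed

lemma nz_mult_linear: "x \<notin> V \<Longrightarrow> nz V ([:-x, 1:] * Q) = nz V Q"
  unfolding nz_def by (rule arg_cong[of _ _ "emeasure _"]) auto

text \<open>With \<open>P\<close> fixed, \<open>x\<close> is a root of \<open>pCons a P\<close>
  exactly when \<open>a\<close> is the value at \<open>x\<close> of \<open>T = - pCons 0 P\<close>,
  so the area formula applies to \<open>T\<close>. For that \<open>a\<close> the polynomial is
  divisible by X - x with quotient \<open>newton x P\<close>.\<close>

lemma nn_integral_roots_pCons:
  assumes P: "\<And>i. coeff P i \<in> R" and U: "fat U"
    and [measurable]: "G \<in> borel_measurable poly_borel"
  shows "(\<integral>\<^sup>+a. nz U (pCons a P) * G (pCons a P) \<partial>\<mu>R)
    = (\<integral>\<^sup>+x. ennreal (nrm (poly (newton x P) x)) * G ([:-x, 1:] * newton x P) * indicator U x \<partial>\<mu>R)"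
proof -
  note [measurable] = fat_borel[OF U]
  have UR: "U \<subseteq> R"
    using U by (rule fat_subset)
  define T where "T = - pCons 0 P"
  have T: "coeff T i \<in> R" for i
    using P by (cases i) (auto simp: T_def intro: integers_ring_uminus)
  have nzT: "nz U (pCons a P) = nz U (T - [:a:])" for a
  proof -
    have "poly (T - [:a:]) x = - poly (pCons a P) x" for x
      by (simp add: T_def)
    then show ?thesis
      unfolding nz_def by (simp only: neg_equal_0_iff_equal)
  qed
  \<comment> \<open>Values of \<open>T\<close> on \<open>U\<close> are integral, so restricting the
    integration to \<open>R\<close> loses no roots and the integral may run over the whole field, as
    in the area formula.\<close>
  have nz0: "nz U (T - [:a:]) = 0" if "a \<notin> R" for a
  proof -
    have "poly (T - [:a:]) x \<noteq> 0" if "x \<in> U" for x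
      using integers_ring_poly[OF T, of x] UR that \<open>a \<notin> R\<close> by auto
    then have "{x \<in> U. poly (T - [:a:]) x = 0} = {}"
      by blast
    then show ?thesis
      unfolding nz_def by (simp only: emeasure_empty)
  qed
  have "(\<integral>\<^sup>+a. nz U (pCons a P) * G (pCons a P) \<partial>\<mu>R)
      = (\<integral>\<^sup>+a. nz U (pCons a P) * G (pCons a P) * indicator R a \<partial>\<mu>)"
    using U by (intro nn_integral_\<mu>R) measurable
  also have "\<dots> = (\<integral>\<^sup>+a. G (pCons a P) * nz U (T - [:a:]) \<partial>\<mu>)"
  proof (rule nn_integral_cong)
    fix a
    show "nz U (pCons a P) * G (pCons a P) * indicator R a = G (pCons a P) * nz U (T - [:a:])"
      unfolding nzT using nz0[of a] by (cases "a \<in> R") (simp_all add: mult.commute)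
  qed
  also have "\<dots> = (\<integral>\<^sup>+x. G (pCons (poly T x) P) * (ennreal (nrm (poly (pderiv T) x)) * indicator U x) \<partial>\<mu>)"
    by (rule area_formula[OF T U]) measurable
  also have "\<dots> = (\<integral>\<^sup>+x. ennreal (nrm (poly (newton x P) x)) * G ([:-x, 1:] * newton x P) * indicator U x
      * indicator R x \<partial>\<mu>)"
  proof (rule nn_integral_cong)
    fix x
    have "[:-x, 1:] * newton x P = pCons (poly T x) P"
      using synthetic_div_correct'[of x "pCons (poly T x) P"]
      by (simp add: newton_def T_def)
    moreover have "poly (newton x P) x = - poly (pderiv T) x"
      by (simp add: newton_def T_def pderiv_minus pderiv_pCons poly_synthetic_div_self)
    ultimately show "G (pCons (poly T x) P) * (ennreal (nrm (poly (pderiv T) x)) * indicator U x)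
        = ennreal (nrm (poly (newton x P) x)) * G ([:-x, 1:] * newton x P) * indicator U x * indicator R x"
      using UR by (cases "x \<in> U") (auto simp: mult.commute)
  qed
  also have "\<dots> = (\<integral>\<^sup>+x. ennreal (nrm (poly (newton x P) x)) * G ([:-x, 1:] * newton x P) * indicator U x \<partial>\<mu>R)"
    by (rule nn_integral_\<mu>R[symmetric]) measurable
  finally show ?thesis .
qed

text \<open>A root is traded for a linear factor: the weight \<open>nrm (poly Q x)\<close> is the absolute value
  of the derivative of \<open>(X - x) Q\<close> at \<open>x\<close>.\<close>

lemma nn_integral_roots:
  assumes U: "fat U" and [measurable]: "G \<in> borel_measurable poly_borel"
  shows "(\<integral>\<^sup>+P. nz U P * G P \<partial>PM (Suc n))
    = (\<integral>\<^sup>+x. (\<integral>\<^sup>+Q. ennreal (nrm (poly Q x)) * G ([:-x, 1:] * Q) \<partial>PM n) * indicator U x \<partial>\<mu>R)"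
proof -
  note [measurable] = fat_borel[OF U] measurable_nz[OF U]
  have "(\<integral>\<^sup>+P. nz U P * G P \<partial>PM (Suc n)) = (\<integral>\<^sup>+P. \<integral>\<^sup>+a. nz U (pCons a P) * G (pCons a P) \<partial>\<mu>R \<partial>PM n)"
    by (rule nn_integral_PM_Suc(1)) measurable
  also have "\<dots> = (\<integral>\<^sup>+P. \<integral>\<^sup>+x. ennreal (nrm (poly (newton x P) x)) * G ([:-x, 1:] * newton x P) * indicator U x
      \<partial>\<mu>R \<partial>PM n)"
  proof (rule nn_integral_cong_AE, use AE_PM_integral in eventually_elim)
    fix P :: "'a poly" assume "\<forall>i. coeff P i \<in> R"
    then show "(\<integral>\<^sup>+a. nz U (pCons a P) * G (pCons a P) \<partial>\<mu>R)
      = (\<integral>\<^sup>+x. ennreal (nrm (poly (newton x P) x)) * G ([:-x, 1:] * newton x P) * indicator U x \<partial>\<mu>R)"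
      by (intro nn_integral_roots_pCons U) auto
  qed
  also have "\<dots> = (\<integral>\<^sup>+x. \<integral>\<^sup>+P. ennreal (nrm (poly (newton x P) x)) * G ([:-x, 1:] * newton x P) * indicator U x
      \<partial>PM n \<partial>\<mu>R)"
    by (rule \<mu>P.Fubini') measurable
  also have "\<dots> = (\<integral>\<^sup>+x. (\<integral>\<^sup>+Q. ennreal (nrm (poly Q x)) * G ([:-x, 1:] * Q) \<partial>PM n) * indicator U x \<partial>\<mu>R)"
  proof (rule nn_integral_cong)
    fix x
    have "(\<integral>\<^sup>+P. ennreal (nrm (poly (newton x P) x)) * G ([:-x, 1:] * newton x P) \<partial>PM n)
        = (\<integral>\<^sup>+Q. ennreal (nrm (poly Q x)) * G ([:-x, 1:] * Q) \<partial>PM n)" if "x \<in> U"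
    proof (rule nn_integral_newton[where G = "\<lambda>Q. ennreal (nrm (poly Q x)) * G ([:-x, 1:] * Q)"])
      show "x \<in> R"
        using fat_subset[OF U] that by blast
    qed measurable
    then show "(\<integral>\<^sup>+P. ennreal (nrm (poly (newton x P) x)) * G ([:-x, 1:] * newton x P) * indicator U x \<partial>PM n)
        = (\<integral>\<^sup>+Q. ennreal (nrm (poly Q x)) * G ([:-x, 1:] * Q) \<partial>PM n) * indicator U x"
      by (cases "x \<in> U") simp_all
  qed
  finally show ?thesis .
qed

lemma nn_integral_coeff_0:
  assumes [measurable]: "g \<in> borel_measurable borel"
  shows "(\<integral>\<^sup>+P. g (coeff P 0) \<partial>PM n) = (\<integral>\<^sup>+a. g a \<partial>\<mu>R)"
proof (cases n)
  case 0
  then show ?thesis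
    using nn_integral_PM_0[of "\<lambda>P. g (coeff P 0)"] by simp
next
  case (Suc m)
  have "(\<integral>\<^sup>+P. g (coeff P 0) \<partial>PM (Suc m)) = (\<integral>\<^sup>+a. \<integral>\<^sup>+P. g (coeff (pCons a P) 0) \<partial>PM m \<partial>\<mu>R)"
    by (rule nn_integral_PM_Suc(2)) measurable
  then show ?thesis
    using Suc PM.emeasure_space_1[of m] by simp
qed

text \<open>The value at \<open>x\<close> is the constant coefficient of \<open>newton x P\<close>,
  hence uniform for every degree bound.\<close>

lemma nn_integral_poly_PM:
  assumes [measurable]: "g \<in> borel_measurable borel" and x: "x \<in> R"
  shows "(\<integral>\<^sup>+P. g (poly P x) \<partial>PM n) = (\<integral>\<^sup>+a. g a \<partial>\<mu>R)"
proof -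
  have "(\<integral>\<^sup>+P. g (poly P x) \<partial>PM n) = (\<integral>\<^sup>+P. g (coeff (newton x P) 0) \<partial>PM n)"
    by (simp add: newton_def)
  also have "\<dots> = (\<integral>\<^sup>+P. g (coeff P 0) \<partial>PM n)"
    by (rule nn_integral_newton[OF x, where G = "\<lambda>P. g (coeff P 0)"]) measurable
  finally show ?thesis
    by (simp add: nn_integral_coeff_0)
qed

text \<open>Division by X - x gives P(y) = P(x) + (y - x) S(y). By \<open>nn_integral_newton\<close>
  the value P(x) and the quotient S are independent and uniform, and S(y) is uniform by
  \<open>nn_integral_poly_PM\<close>. The bound \<open>Suc n\<close> leaves a coefficient for
  S.\<close>

lemma nn_integral_two_points:
  assumes x: "x \<in> R" and y: "y \<in> R"
  shows "(\<integral>\<^sup>+P. ennreal (nrm (poly P x)) * ennreal (nrm (poly P y)) \<partial>PM (Suc n))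
    = (\<integral>\<^sup>+a. \<integral>\<^sup>+b. ennreal (nrm a) * ennreal (nrm (a + (y - x) * b)) \<partial>\<mu>R \<partial>\<mu>R)"
proof -
  \<comment> \<open>Written so that \<open>G (newton x P)\<close> is the given integrand: the shift
    by 1 recovers the quotient from the entries of \<open>newton x P\<close>.\<close>
  define G where "G P = ennreal (nrm (coeff P 0))
    * ennreal (nrm (coeff P 0 + (y - x) * poly (poly_shift 1 P) y))" for P
  have [measurable]: "poly_shift 1 \<in> poly_borel \<rightarrow>\<^sub>M (poly_borel :: 'a poly measure)"
    by (rule measurable_poly_borelI) (simp add: coeff_poly_shift)
  have [measurable]: "G \<in> borel_measurable poly_borel"
    unfolding G_def by measurable
  have shift: "poly_shift 1 (pCons a P) = P" for a :: 'a and P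
    by (rule poly_eqI) (simp add: coeff_poly_shift)
  have expand: "poly P y = poly P x + (y - x) * poly (synthetic_div P x) y" for P
  proof -
    have "poly P y = poly ([:- x, 1:] * synthetic_div P x + [:poly P x:]) y"
      by (simp only: synthetic_div_correct')
    then show ?thesis
      unfolding poly_add poly_mult by (simp add: algebra_simps)
  qed
  have "(\<integral>\<^sup>+P. ennreal (nrm (poly P x)) * ennreal (nrm (poly P y)) \<partial>PM (Suc n))
      = (\<integral>\<^sup>+P. G (newton x P) \<partial>PM (Suc n))"
    unfolding G_def newton_def shift coeff_pCons_0 expand[symmetric] ..
  also have "\<dots> = (\<integral>\<^sup>+P. G P \<partial>PM (Suc n))"
    by (rule nn_integral_newton[OF x]) measurable
  also have "\<dots> = (\<integral>\<^sup>+a. \<integral>\<^sup>+P. G (pCons a P) \<partial>PM n \<partial>\<mu>R)"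
    by (rule nn_integral_PM_Suc(2)) measurable
  also have "\<dots> = (\<integral>\<^sup>+a. \<integral>\<^sup>+b. ennreal (nrm a) * ennreal (nrm (a + (y - x) * b)) \<partial>\<mu>R \<partial>\<mu>R)"
  proof (rule nn_integral_cong)
    fix a
    show "(\<integral>\<^sup>+P. G (pCons a P) \<partial>PM n) = (\<integral>\<^sup>+b. ennreal (nrm a) * ennreal (nrm (a + (y - x) * b)) \<partial>\<mu>R)"
      unfolding G_def shift coeff_pCons_0 using y
      by (intro nn_integral_poly_PM[where g = "\<lambda>b. ennreal (nrm a) * ennreal (nrm (a + (y - x) * b))"]) measurable
  qed
  finally show ?thesis .
qed

lemma emeasure_sphere:
  "emeasure \<mu> (cball 0 (rad k) - cball 0 (rad (Suc k))) = ennreal (rad k - rad (Suc k))"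
proof -
  have "emeasure \<mu> (cball 0 (rad k) - cball 0 (rad (Suc k)))
      = emeasure \<mu> (cball 0 (rad k)) - emeasure \<mu> (cball 0 (rad (Suc k)))"
    using rad_antimono[of k "Suc k"] by (intro emeasure_Diff) (auto simp: emeasure_cball_rad)
  then show ?thesis
    by (simp add: emeasure_cball_rad ennreal_minus)
qed

text \<open>Between consecutive radii \<open>nrm\<close> takes a single value, so the integral is a
  finite sum over spheres. Exponent 1 serves the mean and exponent 2 the second moment.\<close>

lemma nn_integral_nrm_power_shell:
  "(\<integral>\<^sup>+a. ennreal (nrm a ^ e) * indicator (R - cball 0 (rad m)) a \<partial>\<mu>)
    = ennreal (\<Sum>k<m. rad k ^ e * (rad k - rad (Suc k)))"
proof (induction m)
  case 0
  then show ?case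
    by (simp add: R_eq_cball)
next
  case (Suc m)
  define S where "S = cball (0::'a) (rad m) - cball 0 (rad (Suc m))"
  have S: "nrm a = rad m" if "a \<in> S" for a
  proof -
    have a: "nrm a \<le> rad m" "\<not> nrm a \<le> rad (Suc m)"
      using that unfolding S_def Diff_iff mem_cball_iff by auto
    then have "a \<noteq> 0"
      by auto
    then obtain k where k: "nrm a = rad k"
      using nrm_eq_rad a(1) rad_le_1[of m] by fastforce
    then show ?thesis
      using a by (simp add: rad_le_iff not_le less_Suc_eq_le)
  qed
  have [measurable]: "S \<in> sets borel"
    unfolding S_def by measurable
  have "cball (0::'a) (rad (Suc m)) \<subseteq> cball 0 (rad m)" "cball (0::'a) (rad m) \<subseteq> R"
    unfolding R_eq_cball by (intro subset_cball rad_antimono; simp)+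
  then have split: "indicator (R - cball 0 (rad (Suc m))) a
      = (indicator (R - cball 0 (rad m)) a + indicator S a :: ennreal)" for a
    unfolding S_def by (auto simp: indicator_def simp del: mem_cball)
  have "(\<integral>\<^sup>+a. ennreal (nrm a ^ e) * indicator (R - cball 0 (rad (Suc m))) a \<partial>\<mu>)
      = (\<integral>\<^sup>+a. ennreal (nrm a ^ e) * indicator (R - cball 0 (rad m)) a + ennreal (rad m ^ e) * indicator S a \<partial>\<mu>)"
  proof (rule nn_integral_cong)
    fix a
    show "ennreal (nrm a ^ e) * indicator (R - cball 0 (rad (Suc m))) a
      = ennreal (nrm a ^ e) * indicator (R - cball 0 (rad m)) a + ennreal (rad m ^ e) * indicator S a"
      unfolding split distrib_left using S[of a] by (cases "a \<in> S") simp_all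
  qed
  also have "\<dots> = ennreal (\<Sum>k<m. rad k ^ e * (rad k - rad (Suc k))) + ennreal (rad m ^ e) * emeasure \<mu> S"
    by (subst nn_integral_add) (simp_all add: Suc nn_integral_cmult)
  also have "\<dots> = ennreal (\<Sum>k<m. rad k ^ e * (rad k - rad (Suc k))) + ennreal (rad m ^ e * (rad m - rad (Suc m)))"
    unfolding S_def emeasure_sphere by (simp add: ennreal_mult' rad_antimono)
  also have "\<dots> = ennreal (\<Sum>k<Suc m. rad k ^ e * (rad k - rad (Suc k)))"
    by (simp add: ennreal_plus[symmetric] sum_nonneg rad_antimono del: ennreal_plus)
  finally show ?case .
qed

end

section \<open>Explicit integrals of the absolute value and the two moments\<close>

context local_field
begin

text \<open>The mean of \<open>nrm\<close> on \<open>R\<close>: the series of the terms (1 - 1/q)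
  q^(-2k) has this sum.\<close>

definition \<kappa> :: real where "\<kappa> = real q / (real q + 1)"

lemma \<kappa>_pos: "0 < \<kappa>"
  using q_ge_2 by (simp add: \<kappa>_def)

lemma rad_Suc: "rad (Suc k) = rad k / real q"
  by (simp add: rad_def)

lemma shell_sum_1: "(\<Sum>k<m. rad k ^ 1 * (rad k - rad (Suc k))) = \<kappa> * (1 - rad m ^ 2)"
proof (induction m)
  case (Suc m)
  have "\<kappa> * (1 - rad m ^ 2) + rad m * (rad m - rad m / real q) = \<kappa> * (1 - (rad m / real q) ^ 2)"
    using q_ge_2 by (simp add: \<kappa>_def divide_simps power2_eq_square) algebra
  then show ?case
    using Suc by (simp add: rad_Suc)
qed simp

text \<open>A geometric series of ratio q^(-3). Its constant (1 - 1/q) / (1 - q^(-3)) simplifies to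
  the second moment of \<open>nrm\<close> on \<open>R\<close>.\<close>

lemma shell_sum_2:
  "(\<Sum>k<m. rad k ^ 2 * (rad k - rad (Suc k)))
    = real q ^ 2 / (real q ^ 2 + real q + 1) * (1 - rad m ^ 3)"
proof (induction m)
  case (Suc m)
  have pos: "real q ^ 2 + real q + 1 \<noteq> 0" "real q \<noteq> 0"
    using q_ge_2 zero_le_power2[of "real q"] by linarith+
  have "real q ^ 2 / (real q ^ 2 + real q + 1) * (1 - rad m ^ 3) + rad m ^ 2 * (rad m - rad m / real q)
      = real q ^ 2 / (real q ^ 2 + real q + 1) * (1 - (rad m / real q) ^ 3)"
    using pos by (simp add: divide_simps power2_eq_square power3_eq_cube) algebra
  then show ?case
    using Suc by (simp add: rad_Suc)
qed simp

lemma nn_integral_nrm_split: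
  "(\<integral>\<^sup>+a. ennreal (nrm a) \<partial>\<mu>R) = ennreal (\<kappa> * (1 - rad m ^ 2))
    + (\<integral>\<^sup>+a. ennreal (nrm a) * indicator (cball 0 (rad m)) a \<partial>\<mu>)"
proof -
  have sub: "cball (0::'a) (rad m) \<subseteq> R"
    unfolding R_eq_cball by (intro subset_cball rad_antimono) simp
  have "(\<integral>\<^sup>+a. ennreal (nrm a) \<partial>\<mu>R) = (\<integral>\<^sup>+a. ennreal (nrm a) * indicator R a \<partial>\<mu>)"
    by (rule nn_integral_\<mu>R) measurable
  also have "\<dots> = (\<integral>\<^sup>+a. ennreal (nrm a ^ 1) * indicator (R - cball 0 (rad m)) a
      + ennreal (nrm a) * indicator (cball 0 (rad m)) a \<partial>\<mu>)"
  proof (rule nn_integral_cong)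
    fix a
    show "ennreal (nrm a) * indicator R a = ennreal (nrm a ^ 1) * indicator (R - cball 0 (rad m)) a
      + ennreal (nrm a) * indicator (cball 0 (rad m)) a"
      using subsetD[OF sub, of a] by (cases "a \<in> R"; cases "a \<in> cball 0 (rad m)") (simp_all del: mem_cball)
  qed
  also have "\<dots> = ennreal (\<Sum>k<m. rad k ^ 1 * (rad k - rad (Suc k)))
      + (\<integral>\<^sup>+a. ennreal (nrm a) * indicator (cball 0 (rad m)) a \<partial>\<mu>)"
    by (subst nn_integral_add) (measurable, simp only: nn_integral_nrm_power_shell)
  finally show ?thesis
    unfolding shell_sum_1 .
qed

lemma nn_integral_nrm_cball_le:
  "(\<integral>\<^sup>+a. ennreal (nrm a) * indicator (cball 0 (rad m)) a \<partial>\<mu>) \<le> ennreal (rad m * rad m)"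
proof -
  have "(\<integral>\<^sup>+a. ennreal (nrm a) * indicator (cball 0 (rad m)) a \<partial>\<mu>)
      \<le> (\<integral>\<^sup>+a. ennreal (rad m) * indicator (cball 0 (rad m)) a \<partial>\<mu>)"
  proof (rule nn_integral_mono)
    fix a :: 'a
    have "nrm a \<le> rad m" if "a \<in> cball 0 (rad m)"
      using that unfolding mem_cball_iff by simp
    then show "ennreal (nrm a) * indicator (cball 0 (rad m)) a \<le> ennreal (rad m) * indicator (cball 0 (rad m)) a"
      by (cases "a \<in> cball 0 (rad m)") (simp_all add: ennreal_leI del: mem_cball)
  qed
  also have "\<dots> = ennreal (rad m) * emeasure \<mu> (cball 0 (rad m))"
    by (rule nn_integral_cmult_indicator) simp
  finally show ?thesis
    by (simp add: emeasure_cball_rad ennreal_mult)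
qed

text \<open>The integral lies between the shell sum and the shell sum plus
  \<open>rad m * rad m\<close>; both bounds tend to \<kappa> as \<open>m\<close> grows.\<close>

lemma nn_integral_nrm: "(\<integral>\<^sup>+a. ennreal (nrm a) \<partial>\<mu>R) = ennreal \<kappa>"
proof -
  define I where "I = (\<integral>\<^sup>+a. ennreal (nrm a) \<partial>\<mu>R)"
  have bound: "I \<le> ennreal (\<kappa> * (1 - rad m ^ 2)) + ennreal (rad m * rad m)" for m
    unfolding I_def nn_integral_nrm_split[of m] by (intro add_left_mono nn_integral_nrm_cball_le)
  have "I < top"
    using bound[of 0] by (simp add: le_less_trans)
  then obtain i where i: "I = ennreal i" "0 \<le> i"
    by (cases I) auto
  have rad2: "rad m ^ 2 \<le> 1" for m
    using rad_le_1[of m] by (simp add: power_le_one)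
  have up: "i \<le> \<kappa> * (1 - rad m ^ 2) + rad m * rad m" for m
  proof -
    have "ennreal i \<le> ennreal (\<kappa> * (1 - rad m ^ 2) + rad m * rad m)"
      using bound[of m] rad2[of m] \<kappa>_pos by (simp add: i ennreal_plus)
    then show ?thesis
      using rad2[of m] \<kappa>_pos by (subst (asm) ennreal_le_iff) auto
  qed
  have lo: "\<kappa> * (1 - rad m ^ 2) \<le> i" for m
  proof -
    have "ennreal (\<kappa> * (1 - rad m ^ 2)) \<le> I"
      unfolding I_def nn_integral_nrm_split[of m] by simp
    then show ?thesis
      using i by (simp add: ennreal_le_iff)
  qed
  have "rad \<longlonglongrightarrow> 0"
    unfolding rad_def[abs_def] using LIMSEQ_inverse_realpow_zero[of "real q"] q_ge_2
    by (simp add: inverse_eq_divide)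
  then have "(\<lambda>m. \<kappa> * (1 - rad m ^ 2) + rad m * rad m) \<longlonglongrightarrow> \<kappa> * (1 - 0 ^ 2) + 0 * 0"
    and "(\<lambda>m. \<kappa> * (1 - rad m ^ 2)) \<longlonglongrightarrow> \<kappa> * (1 - 0 ^ 2)"
    by (intro tendsto_intros; simp)+
  then have "i \<le> \<kappa> * (1 - 0 ^ 2) + 0 * 0" "\<kappa> * (1 - 0 ^ 2) \<le> i"
    using up lo by (auto intro: LIMSEQ_le_const LIMSEQ_le_const2)
  then show ?thesis
    using i unfolding I_def by simp
qed

text \<open>Subtract the shell sum from the total, which is now known exactly; the total is finite,
  so the subtraction may be done over the reals.\<close>

lemma nn_integral_nrm_cball:
  "(\<integral>\<^sup>+a. ennreal (nrm a) * indicator (cball 0 (rad m)) a \<partial>\<mu>) = ennreal (\<kappa> * rad m ^ 2)"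
proof -
  define J where "J = (\<integral>\<^sup>+a. ennreal (nrm a) * indicator (cball 0 (rad m)) a \<partial>\<mu>)"
  have "J < top"
    using nn_integral_nrm_cball_le[of m] unfolding J_def by (simp add: le_less_trans)
  then obtain j where j: "J = ennreal j" "0 \<le> j"
    by (cases J) auto
  have r: "0 \<le> \<kappa> * (1 - rad m ^ 2)"
    using \<kappa>_pos rad_le_1[of m] by (simp add: power_le_one)
  have "ennreal \<kappa> = ennreal (\<kappa> * (1 - rad m ^ 2)) + J"
    using nn_integral_nrm_split[of m] unfolding nn_integral_nrm J_def .
  also have "\<dots> = ennreal (\<kappa> * (1 - rad m ^ 2) + j)"
    using r j by (simp add: ennreal_plus)
  finally have "\<kappa> = \<kappa> * (1 - rad m ^ 2) + j"
    using r j \<kappa>_pos by (subst (asm) ennreal_inj) auto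
  then show ?thesis
    using j unfolding J_def by (simp add: algebra_simps)
qed

text \<open>The mean of |a| |a + d b| when |d| = \<open>D\<close>. The first term is the second
  moment of \<open>nrm\<close> outside the ball of radius \<open>D\<close>; on that ball the
  integral of |a| is \<open>\<kappa> * D ^ 2\<close> and the second factor has mean
  \<open>D * \<kappa>\<close>.\<close>

definition \<rho> :: "real \<Rightarrow> real" where
  "\<rho> D = real q ^ 2 / (real q ^ 2 + real q + 1) * (1 - D ^ 3) + \<kappa> ^ 2 * D ^ 3"

lemma nn_integral_pair:
  assumes d: "nrm d = rad m"
  shows "(\<integral>\<^sup>+a. \<integral>\<^sup>+b. ennreal (nrm a) * ennreal (nrm (a + d * b)) \<partial>\<mu>R \<partial>\<mu>R) = ennreal (\<rho> (rad m))"
proof -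
  have d0: "d \<noteq> 0"
    using d less_imp_neq[OF rad_pos[of m]] by auto
  have sub: "cball (0::'a) (rad m) \<subseteq> R"
    unfolding R_eq_cball by (intro subset_cball rad_antimono) simp
  have big: "(\<integral>\<^sup>+b. ennreal (nrm a) * ennreal (nrm (a + d * b)) \<partial>\<mu>R) = ennreal (nrm a ^ 2)"
    if a: "a \<notin> cball 0 (rad m)" for a
  proof -
    have "AE b in \<mu>R. ennreal (nrm a) * ennreal (nrm (a + d * b)) = ennreal (nrm a ^ 2)"
      using AE_\<mu>R
    proof eventually_elim
      case (elim b)
      have "nrm (d * b) \<le> rad m"
        using elim d by (simp add: nrm_mult integers_ring_def mult_left_le)
      moreover have "rad m < nrm a"
        using a unfolding mem_cball_iff by simp
      ultimately have "nrm (a + d * b) = nrm a"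
        by (intro nrm_add_eq) simp
      then show ?case
        by (simp add: ennreal_mult[symmetric] power2_eq_square)
    qed
    then have "(\<integral>\<^sup>+b. ennreal (nrm a) * ennreal (nrm (a + d * b)) \<partial>\<mu>R) = (\<integral>\<^sup>+b. ennreal (nrm a ^ 2) \<partial>\<mu>R)"
      by (rule nn_integral_cong_AE)
    then show ?thesis
      using \<mu>R.emeasure_space_1 by simp
  qed
  \<comment> \<open>Here a + d b = d (b + a/d) with a/d integral, so translation invariance makes
    the bracket uniform.\<close>
  have small: "(\<integral>\<^sup>+b. ennreal (nrm a) * ennreal (nrm (a + d * b)) \<partial>\<mu>R) = ennreal (nrm a) * ennreal (rad m * \<kappa>)"
    if a: "a \<in> cball 0 (rad m)" for a
  proof -
    have "nrm (a / d) \<le> 1"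
      using a d unfolding mem_cball_iff by (simp add: nrm_divide)
    then have ad: "a / d \<in> R"
      by (rule integers_ringI)
    have "nrm (a + d * b) = rad m * nrm (b + a / d)" for b
    proof -
      have "a + d * b = d * (b + a / d)"
        using d0 by (simp add: field_simps)
      then show ?thesis
        by (simp only: nrm_mult d)
    qed
    then have "(\<integral>\<^sup>+b. ennreal (nrm a) * ennreal (nrm (a + d * b)) \<partial>\<mu>R)
        = (\<integral>\<^sup>+b. (ennreal (nrm a) * ennreal (rad m)) * ennreal (nrm (b + a / d)) \<partial>\<mu>R)"
      by (simp add: ennreal_mult mult.assoc)
    also have "\<dots> = (ennreal (nrm a) * ennreal (rad m)) * (\<integral>\<^sup>+b. ennreal (nrm (b + a / d)) \<partial>\<mu>R)"
      by (rule nn_integral_cmult) measurable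
    also have "(\<integral>\<^sup>+b. ennreal (nrm (b + a / d)) \<partial>\<mu>R) = (\<integral>\<^sup>+b. ennreal (nrm b) \<partial>\<mu>R)"
      by (rule nn_integral_\<mu>R_translate[OF _ ad, where f = "\<lambda>b. ennreal (nrm b)"]) measurable
    finally show ?thesis
      using \<kappa>_pos by (simp add: nn_integral_nrm ennreal_mult mult.assoc)
  qed
  have "(\<integral>\<^sup>+a. \<integral>\<^sup>+b. ennreal (nrm a) * ennreal (nrm (a + d * b)) \<partial>\<mu>R \<partial>\<mu>R)
      = (\<integral>\<^sup>+a. (\<integral>\<^sup>+b. ennreal (nrm a) * ennreal (nrm (a + d * b)) \<partial>\<mu>R) * indicator R a \<partial>\<mu>)"
    by (rule nn_integral_\<mu>R) measurable
  also have "\<dots> = (\<integral>\<^sup>+a. ennreal (nrm a ^ 2) * indicator (R - cball 0 (rad m)) a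
      + ennreal (rad m * \<kappa>) * (ennreal (nrm a) * indicator (cball 0 (rad m)) a) \<partial>\<mu>)"
  proof (rule nn_integral_cong)
    fix a
    show "(\<integral>\<^sup>+b. ennreal (nrm a) * ennreal (nrm (a + d * b)) \<partial>\<mu>R) * indicator R a
      = ennreal (nrm a ^ 2) * indicator (R - cball 0 (rad m)) a
      + ennreal (rad m * \<kappa>) * (ennreal (nrm a) * indicator (cball 0 (rad m)) a)"
    proof (cases "a \<in> cball 0 (rad m)")
      case True
      then show ?thesis
        unfolding small[OF True] using subsetD[OF sub True] by (simp add: mult.commute del: mem_cball)
    next
      case False
      then show ?thesis
        unfolding big[OF False] by (cases "a \<in> R") (simp_all del: mem_cball)
    qed
  qed
  also have "\<dots> = ennreal (\<Sum>k<m. rad k ^ 2 * (rad k - rad (Suc k))) + ennreal (rad m * \<kappa>) * ennreal (\<kappa> * rad m ^ 2)"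
  proof -
    have "(\<integral>\<^sup>+a. ennreal (rad m * \<kappa>) * (ennreal (nrm a) * indicator (cball 0 (rad m)) a) \<partial>\<mu>)
        = ennreal (rad m * \<kappa>) * (\<integral>\<^sup>+a. ennreal (nrm a) * indicator (cball 0 (rad m)) a \<partial>\<mu>)"
      by (rule nn_integral_cmult) measurable
    then show ?thesis
      by (subst nn_integral_add) (measurable, simp only: nn_integral_nrm_power_shell nn_integral_nrm_cball)
  qed
  also have "\<dots> = ennreal (\<rho> (rad m))"
  proof -
    have "0 \<le> real q ^ 2 / (real q ^ 2 + real q + 1) * (1 - rad m ^ 3)"
      using rad_le_1[of m] by (simp add: power_le_one)
    moreover have "ennreal (rad m * \<kappa>) * ennreal (\<kappa> * rad m ^ 2) = ennreal (\<kappa> ^ 2 * rad m ^ 3)"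
      using \<kappa>_pos by (simp add: ennreal_mult[symmetric] power2_eq_square power3_eq_cube mult_ac)
    ultimately show ?thesis
      unfolding shell_sum_2 \<rho>_def by (simp add: ennreal_plus)
  qed
  finally show ?thesis .
qed

lemma nn_integral_indicator_fat:
  assumes U: "fat U"
  shows "(\<integral>\<^sup>+x. indicator U x \<partial>\<mu>R) = emeasure \<mu> U"
proof -
  note [measurable] = fat_borel[OF U]
  have "(\<integral>\<^sup>+x. indicator U x \<partial>\<mu>R) = (\<integral>\<^sup>+x. indicator U x * indicator R x \<partial>\<mu>)"
    by (rule nn_integral_\<mu>R) measurable
  also have "\<dots> = (\<integral>\<^sup>+x. indicator U x \<partial>\<mu>)"
    using fat_subset[OF U] by (intro nn_integral_cong) (auto simp: indicator_def)
  finally show ?thesis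
    by simp
qed

lemma nn_integral_nz:
  assumes U: "fat U"
  shows "(\<integral>\<^sup>+P. nz U P \<partial>PM (Suc n)) = ennreal \<kappa> * emeasure \<mu> U"
proof -
  note [measurable] = fat_borel[OF U]
  have "(\<integral>\<^sup>+P. nz U P \<partial>PM (Suc n)) = (\<integral>\<^sup>+x. (\<integral>\<^sup>+Q. ennreal (nrm (poly Q x)) \<partial>PM n) * indicator U x \<partial>\<mu>R)"
    using nn_integral_roots[OF U, of "\<lambda>_. 1"] by simp
  also have "\<dots> = (\<integral>\<^sup>+x. ennreal \<kappa> * indicator U x \<partial>\<mu>R)"
  proof (rule nn_integral_cong)
    fix x
    have "(\<integral>\<^sup>+Q. ennreal (nrm (poly Q x)) \<partial>PM n) = ennreal \<kappa>" if "x \<in> U"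
    proof -
      have "x \<in> R"
        using that fat_subset[OF U] by blast
      then show ?thesis
        using nn_integral_poly_PM[of "\<lambda>a. ennreal (nrm a)" x n] by (simp add: nn_integral_nrm)
    qed
    then show "(\<integral>\<^sup>+Q. ennreal (nrm (poly Q x)) \<partial>PM n) * indicator U x = ennreal \<kappa> * indicator U x"
      by (cases "x \<in> U") simp_all
  qed
  also have "\<dots> = ennreal \<kappa> * (\<integral>\<^sup>+x. indicator U x \<partial>\<mu>R)"
    by (rule nn_integral_cmult) measurable
  finally show ?thesis
    by (simp only: nn_integral_indicator_fat[OF U])
qed

text \<open>Extracting a root \<open>x\<close> in \<open>U\<close> leaves the count in
  \<open>V\<close> unchanged, as \<open>x\<close> is not in \<open>V\<close>. Extracting a root
  \<open>y\<close> in \<open>V\<close> multiplies the weight at \<open>x\<close> by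
  \<open>nrm (x - y)\<close>. Since this distance is constant, the remaining mean is the same for
  all pairs and the double integral factors.\<close>

lemma nn_integral_nz_nz:
  assumes U: "fat U" and V: "fat V"
    and dist: "\<And>x y. x \<in> U \<Longrightarrow> y \<in> V \<Longrightarrow> nrm (x - y) = rad m"
  shows "(\<integral>\<^sup>+P. nz U P * nz V P \<partial>PM (Suc (Suc (Suc n))))
    = ennreal (rad m * \<rho> (rad m)) * emeasure \<mu> U * emeasure \<mu> V"
proof -
  note [measurable] = fat_borel[OF U] fat_borel[OF V]
  have \<rho>0: "0 \<le> \<rho> (rad m)"
    unfolding \<rho>_def using rad_le_1[of m] by (simp add: power_le_one)
  have inner: "(\<integral>\<^sup>+Q. ennreal (nrm (poly Q x)) * nz V ([:-x, 1:] * Q) \<partial>PM (Suc (Suc n)))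
      = ennreal (rad m * \<rho> (rad m)) * emeasure \<mu> V" if x: "x \<in> U" for x
  proof -
    have xR: "x \<in> R"
      using x fat_subset[OF U] by blast
    have "x \<notin> V"
      using dist[of x x] x less_imp_neq[OF rad_pos[of m]] by auto
    have "(\<integral>\<^sup>+Q. ennreal (nrm (poly Q x)) * nz V ([:-x, 1:] * Q) \<partial>PM (Suc (Suc n)))
        = (\<integral>\<^sup>+Q. nz V Q * ennreal (nrm (poly Q x)) \<partial>PM (Suc (Suc n)))"
      unfolding nz_mult_linear[OF \<open>x \<notin> V\<close>] by (simp only: mult.commute)
    also have "\<dots> = (\<integral>\<^sup>+y. (\<integral>\<^sup>+T. ennreal (nrm (poly T y)) * ennreal (nrm (poly ([:-y, 1:] * T) x)) \<partial>PM (Suc n))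
        * indicator V y \<partial>\<mu>R)"
      by (rule nn_integral_roots[OF V, where G = "\<lambda>Q. ennreal (nrm (poly Q x))"]) measurable
    also have "\<dots> = (\<integral>\<^sup>+y. ennreal (rad m * \<rho> (rad m)) * indicator V y \<partial>\<mu>R)"
    proof (rule nn_integral_cong)
      fix y
      have "(\<integral>\<^sup>+T. ennreal (nrm (poly T y)) * ennreal (nrm (poly ([:-y, 1:] * T) x)) \<partial>PM (Suc n))
          = ennreal (rad m * \<rho> (rad m))" if y: "y \<in> V"
      proof -
        have yR: "y \<in> R"
          using y fat_subset[OF V] by blast
        have "nrm (poly ([:-y, 1:] * T) x) = rad m * nrm (poly T x)" for T
        proof -
          have "poly ([:-y, 1:] * T) x = (x - y) * poly T x"
            by (simp add: algebra_simps)
          then show ?thesis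
            by (simp only: nrm_mult dist[OF x y])
        qed
        then have "(\<integral>\<^sup>+T. ennreal (nrm (poly T y)) * ennreal (nrm (poly ([:-y, 1:] * T) x)) \<partial>PM (Suc n))
            = (\<integral>\<^sup>+T. ennreal (rad m) * (ennreal (nrm (poly T y)) * ennreal (nrm (poly T x))) \<partial>PM (Suc n))"
          by (simp add: ennreal_mult mult_ac)
        also have "\<dots> = ennreal (rad m) * (\<integral>\<^sup>+T. ennreal (nrm (poly T y)) * ennreal (nrm (poly T x)) \<partial>PM (Suc n))"
          by (rule nn_integral_cmult) measurable
        also have "\<dots> = ennreal (rad m) * ennreal (\<rho> (rad m))"
          by (simp only: nn_integral_two_points[OF yR xR] nn_integral_pair[OF dist[OF x y]])
        finally show ?thesis
          using \<rho>0 by (simp add: ennreal_mult)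
      qed
      then show "(\<integral>\<^sup>+T. ennreal (nrm (poly T y)) * ennreal (nrm (poly ([:-y, 1:] * T) x)) \<partial>PM (Suc n)) * indicator V y
          = ennreal (rad m * \<rho> (rad m)) * indicator V y"
        by (cases "y \<in> V") simp_all
    qed
    also have "\<dots> = ennreal (rad m * \<rho> (rad m)) * (\<integral>\<^sup>+y. indicator V y \<partial>\<mu>R)"
      by (rule nn_integral_cmult) measurable
    finally show ?thesis
      by (simp only: nn_integral_indicator_fat[OF V])
  qed
  have "(\<integral>\<^sup>+P. nz U P * nz V P \<partial>PM (Suc (Suc (Suc n))))
      = (\<integral>\<^sup>+x. (\<integral>\<^sup>+Q. ennreal (nrm (poly Q x)) * nz V ([:-x, 1:] * Q) \<partial>PM (Suc (Suc n))) * indicator U x \<partial>\<mu>R)"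
    using V by (intro nn_integral_roots U measurable_nz')
  also have "\<dots> = (\<integral>\<^sup>+x. (ennreal (rad m * \<rho> (rad m)) * emeasure \<mu> V) * indicator U x \<partial>\<mu>R)"
    by (rule nn_integral_cong) (use inner in \<open>auto simp: indicator_def\<close>)
  also have "\<dots> = (ennreal (rad m * \<rho> (rad m)) * emeasure \<mu> V) * (\<integral>\<^sup>+x. indicator U x \<partial>\<mu>R)"
    by (rule nn_integral_cmult) measurable
  finally show ?thesis
    by (simp only: nn_integral_indicator_fat[OF U] mult_ac)
qed

end

section \<open>Geometry of balls, transfer to the coefficient law, and the covariance\<close>

lemma num_zeros_eq: "num_zeros U P = enn2real (emeasure (count_space UNIV) {x \<in> U. poly P x = 0})"
proof (cases "finite {x \<in> U. poly P x = 0}")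
  case True
  then show ?thesis
    by (simp add: num_zeros_def zero_count_def)
next
  case False
  then show ?thesis
    by (simp add: num_zeros_def zero_count_def)
qed

lemma poly_of_coeffs_Suc_upd:
  "poly_of_coeffs (Suc n) (a(Suc n := c)) = poly_of_coeffs n a + monom c (Suc n)"
  by (rule poly_eqI) (simp add: coeff_poly_of_coeffs)

context nonarch_field
begin

text \<open>The point \<open>v\<close> is farther from the centre than \<open>x\<close> and
  \<open>u\<close>, so its distance to the centre equals its distance to \<open>u\<close>. The
  argument covers open and closed balls alike.\<close>

lemma ball_separation:
  assumes "is_ball U" "x \<in> U" "u \<in> U" "v \<notin> U"
  shows "nrm (x - u) < nrm (u - v)"
proof -
  obtain a r where "r > 0" and U: "U = ball a r \<or> U = cball a r"
    using assms(1) unfolding is_ball_def by blast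
  have xu: "nrm (x - u) \<le> max (nrm (x - a)) (nrm (u - a))"
    using nrm_triangle[of x u a] by (simp add: nrm_minus_commute[of a u])
  have va: "nrm (v - a) \<le> max (nrm (u - v)) (nrm (u - a))"
    using nrm_triangle[of v a u] by (simp add: nrm_minus_commute[of v u])
  from U show ?thesis
  proof
    assume U: "U = ball a r"
    have "nrm (x - a) < r" "nrm (u - a) < r" "\<not> nrm (v - a) < r"
      using assms(2-4) unfolding U mem_ball_iff by auto
    then show ?thesis
      using xu va by linarith
  next
    assume U: "U = cball a r"
    have "nrm (x - a) \<le> r" "nrm (u - a) \<le> r" "\<not> nrm (v - a) \<le> r"
      using assms(2-4) unfolding U mem_cball_iff by auto
    then show ?thesis
      using xu va by linarith
  qed
qed

text \<open>Replacing \<open>u\<close> by \<open>x\<close> inside \<open>U\<close> changes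
  \<open>u - v\<close> by less than its absolute value, and likewise for \<open>v\<close> and
  \<open>y\<close> inside \<open>V\<close>.\<close>

lemma nrm_diff_disjoint_balls:
  assumes U: "is_ball U" and V: "is_ball V" and disj: "U \<inter> V = {}"
    and "u \<in> U" "v \<in> V" "x \<in> U" "y \<in> V"
  shows "nrm (x - y) = nrm (u - v)"
proof -
  have nin: "v \<notin> U" "x \<notin> V"
    using assms by blast+
  have "nrm (u - v - (x - v)) < nrm (u - v)"
    using ball_separation[OF U \<open>x \<in> U\<close> \<open>u \<in> U\<close> nin(1)] nrm_minus_commute[of u x] by simp
  then have 1: "nrm (x - v) = nrm (u - v)"
    by (rule nrm_eq_if_close)
  have "nrm (x - v - (x - y)) < nrm (x - v)"
    using ball_separation[OF V \<open>y \<in> V\<close> \<open>v \<in> V\<close> nin(2)] nrm_minus_commute[of v x] by simp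
  then have "nrm (x - y) = nrm (x - v)"
    by (rule nrm_eq_if_close)
  then show ?thesis
    using 1 by simp
qed

end

context local_field
begin

lemma ball_fat:
  assumes "is_ball U" "U \<subseteq> R"
  shows "fat U"
proof -
  obtain a r where r: "r > 0" and U: "U = ball a r \<or> U = cball a r"
    using assms(1) unfolding is_ball_def by blast
  obtain k where k: "rad k < r"
    using rad_small r by blast
  have "y \<in> U" if "x \<in> U" "y \<in> cball x (rad k)" for x y
  proof -
    have yx: "nrm (y - a) \<le> max (nrm (y - x)) (nrm (x - a))"
      by (rule nrm_triangle)
    have "nrm (y - x) \<le> rad k"
      using that(2) unfolding mem_cball_iff .
    then have yr: "nrm (y - x) < r"
      using k by linarith
    from U show ?thesis
    proof
      assume U: "U = ball a r"
      then have "nrm (x - a) < r"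
        using that(1) unfolding U mem_ball_iff by simp
      then show ?thesis
        using yx yr unfolding U mem_ball_iff by linarith
    next
      assume U: "U = cball a r"
      then have "nrm (x - a) \<le> r"
        using that(1) unfolding U mem_cball_iff by simp
      then show ?thesis
        using yx yr unfolding U mem_cball_iff by linarith
    qed
  qed
  then show ?thesis
    using assms(2) unfolding fat_def by blast
qed

lemma emeasure_fat:
  assumes U: "fat U" and "u \<in> U"
  shows "\<exists>m>0. emeasure \<mu> U = ennreal m"
proof -
  note [measurable] = fat_borel[OF U]
  obtain k where k: "cball u (rad k) \<subseteq> U"
    using assms unfolding fat_def by blast
  have "ennreal (rad k) \<le> emeasure \<mu> U"
    unfolding emeasure_cball_rad[of u k, symmetric] by (rule emeasure_mono[OF k]) simp
  moreover have "emeasure \<mu> U \<le> 1"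
    unfolding emeasure_R[symmetric] by (rule emeasure_mono[OF fat_subset[OF U]]) simp
  ultimately obtain r where r: "emeasure \<mu> U = ennreal r" "ennreal (rad k) \<le> ennreal r" "0 \<le> r"
    by (cases "emeasure \<mu> U") (auto simp: top_unique)
  then have "0 < r"
    using less_le_trans[OF rad_pos[of k]] by (simp add: ennreal_le_iff)
  then show ?thesis
    using r(1) by blast
qed

lemma measurable_add_monom [measurable (raw)]:
  fixes g :: "'b \<Rightarrow> 'a"
  assumes [measurable]: "f \<in> M \<rightarrow>\<^sub>M poly_borel" "g \<in> borel_measurable M"
  shows "(\<lambda>\<omega>. f \<omega> + monom (g \<omega>) k) \<in> M \<rightarrow>\<^sub>M poly_borel"
proof (rule measurable_poly_borelI)
  fix i
  have "(\<lambda>\<omega>. coeff (f \<omega>) i + (if k = i then g \<omega> else 0)) \<in> borel_measurable M"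
    by (cases "k = i") simp_all
  then show "(\<lambda>\<omega>. coeff (f \<omega> + monom (g \<omega>) k) i) \<in> borel_measurable M"
    by simp
qed

text \<open>\<open>PM\<close> grows at the constant coefficient, whereas induction over the index
  set \<open>{..n}\<close> of the product measure adds the top one. This reconciles the two
  orders.\<close>

lemma nn_integral_PM_top:
  assumes "G \<in> borel_measurable poly_borel"
  shows "(\<integral>\<^sup>+P. G P \<partial>PM (Suc n)) = (\<integral>\<^sup>+P. \<integral>\<^sup>+a. G (P + monom a (Suc n)) \<partial>\<mu>R \<partial>PM n)"
  using assms
proof (induction n arbitrary: G)
  case 0
  note [measurable] = 0
  have "(\<integral>\<^sup>+P. G P \<partial>PM (Suc 0)) = (\<integral>\<^sup>+c. \<integral>\<^sup>+P. G (pCons c P) \<partial>PM 0 \<partial>\<mu>R)"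
    by (rule nn_integral_PM_Suc(2)) measurable
  also have "\<dots> = (\<integral>\<^sup>+c. \<integral>\<^sup>+a. G ([:c:] + monom a (Suc 0)) \<partial>\<mu>R \<partial>\<mu>R)"
    by (subst nn_integral_PM_0) (measurable, simp add: monom_Suc monom_0)
  also have "\<dots> = (\<integral>\<^sup>+P. \<integral>\<^sup>+a. G (P + monom a (Suc 0)) \<partial>\<mu>R \<partial>PM 0)"
    by (rule nn_integral_PM_0[symmetric]) measurable
  finally show ?case .
next
  case (Suc n)
  note [measurable] = Suc.prems
  have "(\<integral>\<^sup>+P. G P \<partial>PM (Suc (Suc n))) = (\<integral>\<^sup>+c. \<integral>\<^sup>+P. G (pCons c P) \<partial>PM (Suc n) \<partial>\<mu>R)"
    by (rule nn_integral_PM_Suc(2)) measurable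
  also have "\<dots> = (\<integral>\<^sup>+c. \<integral>\<^sup>+P. \<integral>\<^sup>+a. G (pCons c P + monom a (Suc (Suc n))) \<partial>\<mu>R \<partial>PM n \<partial>\<mu>R)"
  proof (rule nn_integral_cong)
    fix c
    have "(\<integral>\<^sup>+P. G (pCons c P) \<partial>PM (Suc n))
        = (\<integral>\<^sup>+P. \<integral>\<^sup>+a. G (pCons c (P + monom a (Suc n))) \<partial>\<mu>R \<partial>PM n)"
      by (rule Suc.IH) measurable
    then show "(\<integral>\<^sup>+P. G (pCons c P) \<partial>PM (Suc n))
        = (\<integral>\<^sup>+P. \<integral>\<^sup>+a. G (pCons c P + monom a (Suc (Suc n))) \<partial>\<mu>R \<partial>PM n)"
      by (simp add: monom_Suc[of _ "Suc n"])
  qed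
  also have "\<dots> = (\<integral>\<^sup>+P. \<integral>\<^sup>+a. G (P + monom a (Suc (Suc n))) \<partial>\<mu>R \<partial>PM (Suc n))"
    by (rule nn_integral_PM_Suc(2)[symmetric]) measurable
  finally show ?case .
qed

abbreviation \<nu>R :: "'a measure" where "\<nu>R \<equiv> restrict_space \<mu> R"

lemma prob_space_\<nu>R: "prob_space \<nu>R"
  by (rule prob_spaceI) (simp add: space_restrict_space emeasure_restrict_space emeasure_R)

lemma measurable_\<nu>R: "f \<in> borel \<rightarrow>\<^sub>M N \<Longrightarrow> f \<in> \<nu>R \<rightarrow>\<^sub>M N"
  by (rule measurable_restrict_space1) simp

lemma nn_integral_\<nu>R:
  assumes [measurable]: "f \<in> borel_measurable borel"
  shows "(\<integral>\<^sup>+a. f a \<partial>\<nu>R) = (\<integral>\<^sup>+a. f a \<partial>\<mu>R)"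
  by (subst nn_integral_restrict_space) (simp_all add: nn_integral_\<mu>R)

lemma measurable_poly_of_coeffs:
  "poly_of_coeffs n \<in> (\<Pi>\<^sub>M i\<in>{..n}. \<nu>R) \<rightarrow>\<^sub>M poly_borel"
proof (rule measurable_poly_borelI)
  fix i
  show "(\<lambda>a. coeff (poly_of_coeffs n a) i) \<in> borel_measurable (\<Pi>\<^sub>M i\<in>{..n}. \<nu>R)"
  proof (cases "i \<le> n")
    case True
    have "(\<lambda>a. a i) \<in> (\<Pi>\<^sub>M i\<in>{..n}. \<nu>R) \<rightarrow>\<^sub>M \<nu>R"
      using True by (intro measurable_component_singleton) simp
    moreover have "(\<lambda>x. x) \<in> \<nu>R \<rightarrow>\<^sub>M borel"
      by (rule measurable_\<nu>R) simp
    ultimately have "(\<lambda>a. a i) \<in> borel_measurable (\<Pi>\<^sub>M i\<in>{..n}. \<nu>R)"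
      by (rule measurable_compose)
    then show ?thesis
      using True by (simp add: coeff_poly_of_coeffs)
  qed (simp add: coeff_poly_of_coeffs)
qed

lemma nn_integral_poly_of_coeffs:
  assumes "G \<in> borel_measurable poly_borel"
  shows "(\<integral>\<^sup>+a. G (poly_of_coeffs n a) \<partial>(\<Pi>\<^sub>M i\<in>{..n}. \<nu>R)) = (\<integral>\<^sup>+P. G P \<partial>PM n)"
  using assms
proof (induction n arbitrary: G)
  interpret \<nu>R: prob_space \<nu>R by (rule prob_space_\<nu>R)
  interpret product_sigma_finite "\<lambda>i::nat. \<nu>R" ..
  case 0
  note [measurable] = 0
  have "{..0} = insert (0::nat) {}"
    by auto
  then have "(\<integral>\<^sup>+a. G (poly_of_coeffs 0 a) \<partial>(\<Pi>\<^sub>M i\<in>{..0}. \<nu>R))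
      = (\<integral>\<^sup>+a. (\<lambda>c. G [:c:]) (a 0) \<partial>(\<Pi>\<^sub>M i\<in>{0::nat}. \<nu>R))"
    by (simp add: poly_of_coeffs_def monom_0)
  also have "\<dots> = (\<integral>\<^sup>+c. G [:c:] \<partial>\<nu>R)"
    by (rule product_nn_integral_singleton) (rule measurable_\<nu>R, measurable)
  also have "\<dots> = (\<integral>\<^sup>+c. G [:c:] \<partial>\<mu>R)"
    by (rule nn_integral_\<nu>R) measurable
  also have "\<dots> = (\<integral>\<^sup>+P. G P \<partial>PM 0)"
    by (rule nn_integral_PM_0[symmetric]) measurable
  finally show ?case .
next
  interpret \<nu>R: prob_space \<nu>R by (rule prob_space_\<nu>R)
  interpret product_sigma_finite "\<lambda>i::nat. \<nu>R" ..
  case (Suc n)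
  note [measurable] = Suc.prems
  have "{..Suc n} = insert (Suc n) {..n}"
    by auto
  then have "(\<integral>\<^sup>+a. G (poly_of_coeffs (Suc n) a) \<partial>(\<Pi>\<^sub>M i\<in>{..Suc n}. \<nu>R))
      = (\<integral>\<^sup>+a. G (poly_of_coeffs (Suc n) a) \<partial>(\<Pi>\<^sub>M i\<in>insert (Suc n) {..n}. \<nu>R))"
    by (simp only:)
  also have "\<dots> = (\<integral>\<^sup>+a. \<integral>\<^sup>+c. G (poly_of_coeffs (Suc n) (a(Suc n := c))) \<partial>\<nu>R \<partial>(\<Pi>\<^sub>M i\<in>{..n}. \<nu>R))"
    using measurable_compose[OF measurable_poly_of_coeffs[of "Suc n"] Suc.prems] \<open>{..Suc n} = _\<close>
    by (intro product_nn_integral_insert) (simp_all only:, auto)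
  also have "\<dots> = (\<integral>\<^sup>+a. \<integral>\<^sup>+c. G (poly_of_coeffs n a + monom c (Suc n)) \<partial>\<mu>R \<partial>(\<Pi>\<^sub>M i\<in>{..n}. \<nu>R))"
    unfolding poly_of_coeffs_Suc_upd by (intro nn_integral_cong nn_integral_\<nu>R) measurable
  also have "\<dots> = (\<integral>\<^sup>+P. \<integral>\<^sup>+c. G (P + monom c (Suc n)) \<partial>\<mu>R \<partial>PM n)"
    by (rule Suc.IH[of "\<lambda>P. \<integral>\<^sup>+c. G (P + monom c (Suc n)) \<partial>\<mu>R"]) measurable
  also have "\<dots> = (\<integral>\<^sup>+P. G P \<partial>PM (Suc n))"
    by (rule nn_integral_PM_top[symmetric]) measurable
  finally show ?case .
qed

abbreviation law :: "nat \<Rightarrow> 'a poly measure" where "law n \<equiv> poly_measure \<mu> R n"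

lemma inj_on_poly_of_coeffs_law: "inj_on (poly_of_coeffs n) (space (\<Pi>\<^sub>M i\<in>{..n}. \<nu>R))"
  using inj_on_poly_of_coeffs by (simp add: space_PiM space_restrict_space)

lemma measurable_law:
  assumes "G \<in> poly_borel \<rightarrow>\<^sub>M N"
  shows "G \<in> law n \<rightarrow>\<^sub>M N"
  unfolding poly_measure_def
  by (rule measurable_embed_measure1) (rule measurable_compose[OF measurable_poly_of_coeffs assms])

lemma nn_integral_law:
  assumes "G \<in> borel_measurable poly_borel"
  shows "(\<integral>\<^sup>+P. G P \<partial>law n) = (\<integral>\<^sup>+P. G P \<partial>PM n)"
  using measurable_law[OF assms, of n]
  unfolding nn_integral_poly_of_coeffs[OF assms, symmetric] poly_measure_def
  by (rule nn_integral_embed_measure'[OF inj_on_poly_of_coeffs_law])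

lemma prob_space_law: "prob_space (law n)"
proof (rule prob_spaceI)
  have "emeasure (law n) (space (law n)) = (\<integral>\<^sup>+P. 1 \<partial>law n)"
    by simp
  also have "\<dots> = (\<integral>\<^sup>+P. 1 \<partial>PM n)"
    by (rule nn_integral_law) measurable
  finally show "emeasure (law n) (space (law n)) = 1"
    using PM.emeasure_space_1[of n] by simp
qed

text \<open>A finite integral forces \<open>Y\<close> to be finite almost everywhere, so
  \<open>enn2real\<close> changes it only on a null set. This absorbs the value 0 that
  \<open>num_zeros\<close> takes where the count is infinite.\<close>

lemma has_bochner_integral_law:
  assumes Y: "Y \<in> borel_measurable poly_borel" and I: "(\<integral>\<^sup>+P. Y P \<partial>PM n) = ennreal c" and c: "0 \<le> c"
  shows "has_bochner_integral (law n) (\<lambda>P. enn2real (Y P)) c"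
proof (rule has_bochner_integral_nn_integral)
  note [measurable] = measurable_law[OF Y]
  show "(\<lambda>P. enn2real (Y P)) \<in> borel_measurable (law n)"
    by measurable
  have I': "(\<integral>\<^sup>+P. Y P \<partial>law n) = ennreal c"
    using nn_integral_law[OF Y] I by simp
  then have "AE P in law n. Y P \<noteq> \<infinity>"
    by (intro nn_integral_PInf_AE) auto
  then have "AE P in law n. ennreal (enn2real (Y P)) = Y P"
    by eventually_elim (simp add: less_top)
  then have "(\<integral>\<^sup>+P. ennreal (enn2real (Y P)) \<partial>law n) = (\<integral>\<^sup>+P. Y P \<partial>law n)"
    by (rule nn_integral_cong_AE)
  then show "(\<integral>\<^sup>+P. ennreal (enn2real (Y P)) \<partial>law n) = ennreal c"
    using I' by simp
qed (use c in simp_all)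

lemma covariance_num_zeros:
  assumes U: "is_ball U" "U \<subseteq> R" "u \<in> U" and V: "is_ball V" "V \<subseteq> R" "v \<in> V"
    and disj: "U \<inter> V = {}" and n: "3 \<le> n"
  shows "integrable (law n) (num_zeros U) \<and> integrable (law n) (num_zeros V) \<and>
    integrable (law n) (\<lambda>P. num_zeros U P * num_zeros V P) \<and>
    integral\<^sup>L (law n) (num_zeros U) \<noteq> 0 \<and> integral\<^sup>L (law n) (num_zeros V) \<noteq> 0 \<and>
    covariance (law n) (num_zeros U) (num_zeros V)
      / (integral\<^sup>L (law n) (num_zeros U) * integral\<^sup>L (law n) (num_zeros V))
    = - 1 + (real q + 1)\<^sup>2 / ((real q)\<^sup>2 + real q + 1) * nrm (u - v)
      - real q / ((real q)\<^sup>2 + real q + 1) * nrm (u - v) ^ 4"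
proof -
  interpret L: prob_space "law n"
    by (rule prob_space_law)
  have fU: "fat U" and fV: "fat V"
    using U V by (simp_all add: ball_fat)
  obtain a where a: "0 < a" "emeasure \<mu> U = ennreal a"
    using emeasure_fat[OF fU U(3)] by blast
  obtain b where b: "0 < b" "emeasure \<mu> V = ennreal b"
    using emeasure_fat[OF fV V(3)] by blast
  \<comment> \<open>Each of the two extracted roots lowers the degree bound by one, and
    \<open>nn_integral_two_points\<close> needs a remaining bound of at least 1.\<close>
  obtain l where l: "n = Suc (Suc (Suc l))"
    using n by (metis Suc_le_D numeral_3_eq_3 Suc_le_mono)
  have "u - v \<noteq> 0"
    using U(3) V(3) disj by auto
  moreover have "nrm (u - v) \<le> 1"
    using integers_ring_diff[of u v] U V by (auto simp: integers_ring_def)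
  ultimately obtain m where m: "nrm (u - v) = rad m"
    using nrm_eq_rad by blast
  have dist: "nrm (x - y) = rad m" if "x \<in> U" "y \<in> V" for x y
    using nrm_diff_disjoint_balls[OF U(1) V(1) disj U(3) V(3) that] m by simp
  have \<rho>0: "0 \<le> \<rho> (rad m)"
    unfolding \<rho>_def using rad_le_1[of m] by (simp add: power_le_one)
  have X: "has_bochner_integral (law n) (num_zeros U) (\<kappa> * a)"
    unfolding num_zeros_eq[abs_def] nz_def[symmetric] using \<kappa>_pos a
    unfolding l by (intro has_bochner_integral_law measurable_nz'[OF fU])
      (simp_all only: nn_integral_nz[OF fU], simp_all add: ennreal_mult)
  have Y: "has_bochner_integral (law n) (num_zeros V) (\<kappa> * b)"
    unfolding num_zeros_eq[abs_def] nz_def[symmetric] using \<kappa>_pos b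
    unfolding l by (intro has_bochner_integral_law measurable_nz'[OF fV])
      (simp_all only: nn_integral_nz[OF fV], simp_all add: ennreal_mult)
  have "has_bochner_integral (law n) (\<lambda>P. enn2real (nz U P * nz V P)) (rad m * \<rho> (rad m) * a * b)"
  proof (rule has_bochner_integral_law)
    show "(\<lambda>P. nz U P * nz V P) \<in> borel_measurable poly_borel"
      by (intro borel_measurable_times_ennreal measurable_nz' fU fV)
    have "(\<integral>\<^sup>+P. nz U P * nz V P \<partial>PM n) = ennreal (rad m * \<rho> (rad m)) * ennreal a * ennreal b"
      unfolding l using nn_integral_nz_nz[OF fU fV dist] a b by simp
    then show "(\<integral>\<^sup>+P. nz U P * nz V P \<partial>PM n) = ennreal (rad m * \<rho> (rad m) * a * b)"
      using \<rho>0 a b by (simp add: ennreal_mult)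
  qed (use \<rho>0 a b in simp)
  then have XY: "has_bochner_integral (law n) (\<lambda>P. num_zeros U P * num_zeros V P) (rad m * \<rho> (rad m) * a * b)"
    by (simp add: enn2real_mult num_zeros_eq nz_def)
  have EX: "integral\<^sup>L (law n) (num_zeros U) = \<kappa> * a"
    and EY: "integral\<^sup>L (law n) (num_zeros V) = \<kappa> * b"
    using X Y by (simp_all add: has_bochner_integral_integral_eq)
  have "covariance (law n) (num_zeros U) (num_zeros V)
      = (\<integral>P. num_zeros U P * num_zeros V P - \<kappa> * b * num_zeros U P - \<kappa> * a * num_zeros V P + \<kappa> * a * (\<kappa> * b) \<partial>law n)"
    unfolding covariance_def EX EY by (rule Bochner_Integration.integral_cong) (simp_all add: algebra_simps)
  also have "\<dots> = rad m * \<rho> (rad m) * a * b - \<kappa> * b * (\<kappa> * a) - \<kappa> * a * (\<kappa> * b) + \<kappa> * a * (\<kappa> * b)"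
  proof (rule has_bochner_integral_integral_eq)
    have const: "has_bochner_integral (law n) (\<lambda>_. \<kappa> * a * (\<kappa> * b)) (\<kappa> * a * (\<kappa> * b))"
      using L.prob_space by (simp add: has_bochner_integral_iff)
    have X': "has_bochner_integral (law n) (\<lambda>P. \<kappa> * b * num_zeros U P) (\<kappa> * b * (\<kappa> * a))"
      by (rule has_bochner_integral_mult_right) (rule X)
    have Y': "has_bochner_integral (law n) (\<lambda>P. \<kappa> * a * num_zeros V P) (\<kappa> * a * (\<kappa> * b))"
      by (rule has_bochner_integral_mult_right) (rule Y)
    show "has_bochner_integral (law n)
      (\<lambda>P. num_zeros U P * num_zeros V P - \<kappa> * b * num_zeros U P - \<kappa> * a * num_zeros V P + \<kappa> * a * (\<kappa> * b))
      (rad m * \<rho> (rad m) * a * b - \<kappa> * b * (\<kappa> * a) - \<kappa> * a * (\<kappa> * b) + \<kappa> * a * (\<kappa> * b))"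
      by (rule has_bochner_integral_add[OF has_bochner_integral_diff[OF has_bochner_integral_diff[OF XY X'] Y'] const])
  qed
  also have "\<dots> = (rad m * \<rho> (rad m) - \<kappa> ^ 2) * (a * b)"
    by (simp add: algebra_simps power2_eq_square)
  finally have "covariance (law n) (num_zeros U) (num_zeros V) / ((\<kappa> * a) * (\<kappa> * b))
      = (rad m * \<rho> (rad m) - \<kappa> ^ 2) * (a * b) / (\<kappa> ^ 2 * (a * b))"
    by (simp add: power2_eq_square mult_ac)
  also have "\<dots> = rad m * \<rho> (rad m) / \<kappa> ^ 2 - 1"
    using a b \<kappa>_pos by (simp add: diff_divide_distrib)
  also have "\<dots> = - 1 + (real q + 1)\<^sup>2 / ((real q)\<^sup>2 + real q + 1) * rad m
      - real q / ((real q)\<^sup>2 + real q + 1) * rad m ^ 4"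
  proof -
    \<comment> \<open>Division by \<open>\<kappa> ^ 2\<close> turns the second moment into
      \<open>A\<close> and the coefficient of the cubic term into 1. After multiplication by
      \<open>rad m\<close>, the fourth power has coefficient \<open>1 - A\<close>, which is
      \<open>- B\<close>.\<close>
    have nz: "real q \<noteq> 0" "real q + 1 \<noteq> 0" "(real q)\<^sup>2 + real q + 1 \<noteq> 0"
      using q_ge_2 zero_le_power2[of "real q"] by linarith+
    have "(real q)\<^sup>2 / ((real q)\<^sup>2 + real q + 1) / \<kappa> ^ 2 = (real q + 1)\<^sup>2 / ((real q)\<^sup>2 + real q + 1)"
      unfolding \<kappa>_def using nz by (simp add: power_divide)
    moreover have "(c * x + \<kappa> ^ 2 * y) / \<kappa> ^ 2 = c / \<kappa> ^ 2 * x + y" for c x y :: real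
      using \<kappa>_pos by (simp add: add_divide_distrib)
    ultimately have "\<rho> (rad m) / \<kappa> ^ 2
        = (real q + 1)\<^sup>2 / ((real q)\<^sup>2 + real q + 1) * (1 - rad m ^ 3) + rad m ^ 3"
      unfolding \<rho>_def by (simp only:)
    moreover have "1 - (real q + 1)\<^sup>2 / ((real q)\<^sup>2 + real q + 1) = - real q / ((real q)\<^sup>2 + real q + 1)"
      using nz by (simp add: field_simps power2_eq_square)
    moreover define A where "A = (real q + 1)\<^sup>2 / ((real q)\<^sup>2 + real q + 1)"
    moreover define B where "B = real q / ((real q)\<^sup>2 + real q + 1)"
    ultimately have 1: "\<rho> (rad m) / \<kappa> ^ 2 = A * (1 - rad m ^ 3) + rad m ^ 3" and 2: "1 - A = - B"
      by simp_all
    have "rad m * \<rho> (rad m) / \<kappa> ^ 2 = rad m * (A * (1 - rad m ^ 3) + rad m ^ 3)"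
      unfolding 1[symmetric] by simp
    also have "\<dots> = A * rad m + (1 - A) * rad m ^ 4"
      by (simp add: algebra_simps power3_eq_cube power4_eq_xxxx)
    finally show ?thesis
      unfolding 2 A_def[symmetric] B_def[symmetric] by simp
  qed
  finally have "covariance (law n) (num_zeros U) (num_zeros V) / ((\<kappa> * a) * (\<kappa> * b))
      = - 1 + (real q + 1)\<^sup>2 / ((real q)\<^sup>2 + real q + 1) * nrm (u - v)
        - real q / ((real q)\<^sup>2 + real q + 1) * nrm (u - v) ^ 4"
    unfolding m .
  moreover have "\<kappa> * a \<noteq> 0" "\<kappa> * b \<noteq> 0"
    using a b \<kappa>_pos by auto
  ultimately show ?thesis
    using X Y XY unfolding EX EY by (simp add: integrable.intros)
qed

end

section \<open>Finite extensions of the p-adic numbers\<close>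

context padic_numbers
begin

sublocale K: nonarch_field absv
  by unfold_locales (fact abs_value_absv dist_absv)+

lemma p_gt_1: "1 < p"
  using prime_p prime_gt_1_nat by blast

lemma absv_p: "absv (of_nat p) = 1 / real p"
proof -
  have "absv (of_nat p) = rat_padic_abs p (of_nat p)"
    using absv_of_rat[of "of_nat p"] by simp
  moreover have "quotient_of (of_nat p) = (int p, 1)"
    using quotient_of_int[of "int p"] by (simp add: Rat.of_int_def)
  moreover have "multiplicity (int p) (int p) = 1"
    using prime_p p_gt_1 by (intro multiplicity_self) auto
  ultimately show ?thesis
    using p_gt_1 by (simp add: rat_padic_abs_def power_int_minus field_simps)
qed

lemma absv_of_int_le: "absv (of_int z) \<le> 1"
proof (cases "0 \<le> z")
  case True
  then show ?thesis
    using K.nrm_of_nat_le[of "nat z"] by simp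
next
  case False
  then show ?thesis
    using K.nrm_of_nat_le[of "nat (- z)"] by simp
qed

text \<open>In a Bezout relation u p + v z = 1 the first summand has absolute value below 1, so the
  second must carry the absolute value 1.\<close>

lemma absv_of_int_eq_1:
  assumes "\<not> int p dvd z"
  shows "absv (of_int z) = 1"
proof -
  have "coprime (int p) z"
    using assms prime_p by (intro prime_imp_coprime) auto
  then obtain u v where uv: "u * int p + v * z = 1"
    using bezout_int[of "int p" z] by (auto simp: coprime_iff_gcd_eq_1)
  have "of_int (u * int p + v * z) = (of_int u * of_nat p + of_int v * of_int z :: 'k)"
    by simp
  then have "1 = absv (of_int u * of_nat p + of_int v * of_int z)"
    unfolding uv by simp
  also have "\<dots> \<le> max (absv (of_int u * of_nat p)) (absv (of_int v * of_int z))"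
    by (rule K.nrm_add_le)
  finally have m: "1 \<le> max (absv (of_int u * of_nat p)) (absv (of_int v * of_int z))" .
  have "absv (of_int u * of_nat p) \<le> 1 * (1 / real p)"
    unfolding K.nrm_mult absv_p using absv_of_int_le[of u] by (intro mult_right_mono) auto
  also have "\<dots> < 1"
    using p_gt_1 by simp
  finally have "1 \<le> absv (of_int v * of_int z)"
    using m by linarith
  also have "\<dots> \<le> 1 * absv (of_int z)"
    unfolding K.nrm_mult using absv_of_int_le[of v] by (intro mult_right_mono) auto
  finally show ?thesis
    using absv_of_int_le[of z] by simp
qed

lemma absv_of_int_le_p: "int p dvd z \<Longrightarrow> absv (of_int z) \<le> 1 / real p"
proof -
  assume "int p dvd z"
  then obtain w where w: "z = int p * w" ..
  have "absv (of_int z) = 1 / real p * absv (of_int w)"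
    unfolding w by (simp add: K.nrm_mult absv_p)
  also have "\<dots> \<le> 1 / real p * 1"
    using absv_of_int_le by (intro mult_left_mono) auto
  finally show ?thesis
    by simp
qed

text \<open>By density \<open>x\<close> is within 1/p of a rational, whose absolute value is then at
  most 1; its denominator is prime to \<open>p\<close>, so the rational can be reduced modulo
  \<open>p\<close>.\<close>

lemma ex_digit:
  assumes x: "absv x \<le> 1"
  shows "\<exists>c<p. absv (x - of_nat c) \<le> 1 / real p"
proof -
  have "0 < 1 / real p"
    using p_gt_1 by simp
  moreover have "x \<in> closure \<rat>"
    by (simp add: Rats_dense)
  ultimately obtain y where y: "y \<in> \<rat>" "dist y x < 1 / real p"
    using closure_approachable[of x \<rat>] by blast
  obtain r where "y = of_rat r"
    using y(1) by (rule Rats_cases)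
  then have r: "absv (of_rat r - x) < 1 / real p"
    using y(2) unfolding dist_absv by simp
  obtain a b where ab: "quotient_of r = (a, b)"
    by (cases "quotient_of r")
  have b0: "b > 0" and cop: "coprime a b" and rab: "r = of_int a / of_int b"
    using quotient_of_denom_pos[OF ab] quotient_of_coprime[OF ab] quotient_of_div[OF ab] by auto
  have rK: "of_rat r = (of_int a / of_int b :: 'k)"
    unfolding rab by (simp add: of_rat_divide)
  have "absv (of_rat r) \<le> 1"
  proof -
    have "absv (of_rat r) \<le> max (absv (of_rat r - x)) (absv x)"
      using K.nrm_add_le[of "of_rat r - x" x] by simp
    moreover have "1 / real p < 1"
      using p_gt_1 by simp
    ultimately show ?thesis
      using r x by linarith
  qed
  then have le: "absv (of_int a) \<le> absv (of_int b)"
    using b0 unfolding rK K.nrm_divide by (simp add: divide_le_eq)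
  \<comment> \<open>If \<open>p\<close> divided \<open>b\<close>, lowest terms would give
    \<open>a\<close> absolute value 1 while that of \<open>b\<close> is at most 1/p, contradicting
    \<open>le\<close>.\<close>
  have pb: "\<not> int p dvd b"
  proof
    assume b: "int p dvd b"
    then have "\<not> int p dvd a"
      using cop prime_p coprime_common_divisor[of a b "int p"] p_gt_1 by auto
    then have "1 \<le> 1 / real p"
      using le absv_of_int_eq_1[of a] absv_of_int_le_p[OF b] by simp
    then show False
      using p_gt_1 by (simp add: field_simps)
  qed
  then have bb: "absv (of_int b) = 1"
    by (rule absv_of_int_eq_1)
  have "coprime (int p) b"
    using pb prime_p by (intro prime_imp_coprime) auto
  then obtain u v where uv: "u * int p + v * b = 1"
    using bezout_int[of "int p" b] by (auto simp: coprime_iff_gcd_eq_1)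
  \<comment> \<open>The residue of a/b modulo \<open>p\<close>: by \<open>uv\<close>,
    \<open>v\<close> is an inverse of \<open>b\<close> modulo \<open>p\<close>.\<close>
  define c where "c = (a * v) mod int p"
  have c: "0 \<le> c" "c < int p"
    using p_gt_1 by (auto simp: c_def)
  have "int p dvd a - b * c"
  proof -
    define k where "k = a * v div int p"
    have c_eq: "c = a * v - int p * k"
      unfolding c_def k_def by (rule minus_mult_div_eq_mod[symmetric])
    have "a - b * c = a * (1 - v * b) + int p * (b * k)"
      unfolding c_eq by (simp add: algebra_simps)
    also have "1 - v * b = u * int p"
      using uv by linarith
    finally have "a - b * c = int p * (a * u + b * k)"
      by (simp add: algebra_simps)
    then show ?thesis
      by (rule dvdI)
  qed
  then have "absv (of_int (a - b * c)) \<le> 1 / real p"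
    by (rule absv_of_int_le_p)
  moreover have "of_rat r - of_int c = (of_int (a - b * c) / of_int b :: 'k)"
    unfolding rK using b0 by (simp add: diff_divide_distrib)
  ultimately have "absv (of_rat r - of_int c) \<le> 1 / real p"
    by (simp add: K.nrm_divide bb del: of_int_diff of_int_mult)
  moreover have "absv (x - of_rat r) \<le> 1 / real p"
    using r K.nrm_minus_commute[of x "of_rat r"] by simp
  ultimately have "absv (x - of_int c) \<le> 1 / real p"
    using K.nrm_triangle[of x "of_int c" "of_rat r"] by linarith
  then have "absv (x - of_nat (nat c)) \<le> 1 / real p"
    using c(1) by simp
  moreover have "nat c < p"
    using c by linarith
  ultimately show ?thesis
    by blast
qed

lemma digit_unique:
  assumes "c < p" "d < p" "absv (of_nat c - of_nat d) \<le> 1 / real p"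
  shows "c = d"
proof -
  have "int p dvd int c - int d"
  proof (rule ccontr)
    assume "\<not> int p dvd int c - int d"
    then have "absv (of_int (int c - int d)) = 1"
      by (rule absv_of_int_eq_1)
    then have "1 \<le> 1 / real p"
      using assms(3) by simp
    then show False
      using p_gt_1 by (simp add: field_simps)
  qed
  moreover have "\<bar>int c - int d\<bar> < int p"
    using assms(1,2) by linarith
  ultimately have "int c - int d = 0"
    using zdvd_imp_le[of "int p" "\<bar>int c - int d\<bar>"] by fastforce
  then show ?thesis
    by simp
qed

text \<open>The net consists of p-adic expansions with \<open>k\<close> digits; the step splits off
  the lowest digit and rescales the remainder by 1/p.\<close>

lemma integers_net: "\<exists>N. finite N \<and> (\<forall>x. absv x \<le> 1 \<longrightarrow> (\<exists>y\<in>N. absv (x - y) \<le> (1 / real p) ^ k))"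
proof (induction k)
  case 0
  show ?case
    by (rule exI[of _ "{0}"]) simp
next
  case (Suc k)
  then obtain N where N: "finite N" "\<And>x. absv x \<le> 1 \<Longrightarrow> \<exists>y\<in>N. absv (x - y) \<le> (1 / real p) ^ k"
    by blast
  have p0: "(of_nat p :: 'k) \<noteq> 0"
    using p_gt_1 by simp
  define N' where "N' = (\<lambda>(c, y). of_nat c + of_nat p * y :: 'k) ` ({..<p} \<times> N)"
  have "\<exists>y\<in>N'. absv (x - y) \<le> (1 / real p) ^ Suc k" if x: "absv x \<le> 1" for x
  proof -
    obtain c where c: "c < p" "absv (x - of_nat c) \<le> 1 / real p"
      using ex_digit[OF x] by blast
    have "absv ((x - of_nat c) / of_nat p) \<le> 1"
      using c(2) p_gt_1 unfolding K.nrm_divide absv_p by (simp add: field_simps)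
    then obtain y where y: "y \<in> N" "absv ((x - of_nat c) / of_nat p - y) \<le> (1 / real p) ^ k"
      using N(2) by blast
    have "x - (of_nat c + of_nat p * y) = of_nat p * ((x - of_nat c) / of_nat p - y)"
      using p0 by (simp add: field_simps)
    then have "absv (x - (of_nat c + of_nat p * y)) = 1 / real p * absv ((x - of_nat c) / of_nat p - y)"
      by (simp only: K.nrm_mult absv_p)
    also have "\<dots> \<le> 1 / real p * (1 / real p) ^ k"
      using y(2) by (intro mult_left_mono) auto
    finally show ?thesis
      using c(1) y(1) unfolding N'_def by (intro bexI[of _ "of_nat c + of_nat p * y"]) auto
  qed
  moreover have "finite N'"
    using N(1) unfolding N'_def by simp
  ultimately show ?case
    by blast
qed

lemma compact_padic_integers: "compact (integers_ring absv)"
  unfolding compact_eq_totally_bounded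
proof (intro conjI allI impI)
  show "complete (integers_ring absv)"
    using closed_cball subset_UNIV complete_padic
    unfolding K.integers_ring_eq_cball by (rule complete_closed_subset)
  fix e :: real assume "0 < e"
  then obtain k where k: "(1 / real p) ^ k < e"
    using real_arch_pow_inv[of e "1 / real p"] p_gt_1 by auto
  obtain N where N: "finite N" "\<And>x. absv x \<le> 1 \<Longrightarrow> \<exists>y\<in>N. absv (x - y) \<le> (1 / real p) ^ k"
    using integers_net by blast
  have "integers_ring absv \<subseteq> (\<Union>x\<in>N. ball x e)"
  proof
    fix x assume "x \<in> integers_ring absv"
    then obtain y where "y \<in> N" "absv (x - y) \<le> (1 / real p) ^ k"
      using N(2) unfolding integers_ring_def by blast
    then have "y \<in> N" "x \<in> ball y e"
      unfolding K.mem_ball_iff using k by auto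
    then show "x \<in> (\<Union>x\<in>N. ball x e)"
      by blast
  qed
  then show "\<exists>N. finite N \<and> integers_ring absv \<subseteq> (\<Union>x\<in>N. ball x e)"
    using N(1) by blast
qed

end

section \<open>The lattice of a basis and the factor by which \<open>p\<close> scales the Haar
  measure\<close>

locale padic_haar = padic_extension p absv emb nrm
  for p :: nat and absv :: "'k::{field_char_0, metric_space} \<Rightarrow> real"
    and emb :: "'k \<Rightarrow> 'a::{field, metric_space}" and nrm :: "'a \<Rightarrow> real" +
  fixes \<mu> :: "'a measure"
  assumes haar_mu: "haar_measure \<mu>" and mu_integers: "emeasure \<mu> (integers_ring nrm) = 1"
begin

sublocale haar_field nrm \<mu>
  by unfold_locales (fact abs_value_nrm dist_nrm haar_mu)+

lemma emb_0: "emb 0 = 0"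
  using emb_add[of 0 0] by (simp only: add_0_right add_cancel_right_right)

lemma emb_diff: "emb (x - y) = emb x - emb y"
  using emb_add[of "x - y" y] by (simp add: eq_diff_eq)

lemma emb_of_nat: "emb (of_nat m) = of_nat m"
  by (induction m) (simp_all add: emb_0 emb_add emb_one)

lemma emb_power: "emb (x ^ k) = emb x ^ k"
  by (induction k) (simp_all add: emb_one emb_mult)

lemma of_nat_neq_0_ext:
  assumes "0 < m"
  shows "of_nat m \<noteq> (0::'a)"
proof
  assume "of_nat m = (0::'a)"
  then have "nrm (emb (of_nat m)) = 0"
    by (simp add: emb_of_nat)
  moreover obtain s where s: "s > 0" "\<And>x. nrm (emb x) = absv x powr s"
    using nrm_extends by blast
  ultimately have "absv (of_nat m) powr s = 0"
    by (simp only:)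
  then have "absv (of_nat m) = 0"
    by simp
  then show False
    using assms by simp
qed

lemma of_nat_p_neq_0: "of_nat p \<noteq> (0::'a)"
  using of_nat_neq_0_ext p_gt_1 by simp

lemma nrm_p_less_1: "nrm (of_nat p) < 1"
proof -
  obtain s where s: "s > 0" "\<And>x. nrm (emb x) = absv x powr s"
    using nrm_extends by blast
  have "nrm (of_nat p) = (1 / real p) powr s"
    using s(2)[of "of_nat p"] by (simp only: emb_of_nat absv_p)
  also have "\<dots> < 1 powr s"
    using s(1) p_gt_1 by (intro powr_less_mono2) auto
  finally show ?thesis
    by simp
qed

lemma tendsto_emb:
  assumes "(f \<longlongrightarrow> a) F"
  shows "((\<lambda>x. emb (f x)) \<longlongrightarrow> emb a) F"
proof -
  obtain s where s: "s > 0" "\<And>x. nrm (emb x) = absv x powr s"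
    using nrm_extends by blast
  have "((\<lambda>x. absv (f x - a) powr s) \<longlongrightarrow> 0) F"
  proof (rule tendsto_zero_powrI)
    show "((\<lambda>x. absv (f x - a)) \<longlongrightarrow> 0) F"
      using assms by (simp only: K.tendsto_iff_nrm)
  qed (use s(1) in auto)
  then have "((\<lambda>x. nrm (emb (f x) - emb a)) \<longlongrightarrow> 0) F"
    by (simp only: emb_diff[symmetric] s(2))
  then show ?thesis
    by (simp only: tendsto_iff_nrm)
qed

text \<open>The span of \<open>A\<close> over the p-adic integers.\<close>

definition lat :: "'a set \<Rightarrow> 'a set" where
  "lat A = {\<Sum>b\<in>A. emb (c b) * b | c. \<forall>b\<in>A. absv (c b) \<le> 1}"

lemma lat_insert:
  assumes "finite A" "b \<notin> A"
  shows "lat (insert b A) = (\<lambda>z. emb (fst z) * b + snd z) ` (integers_ring absv \<times> lat A)"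
proof (intro equalityI subsetI)
  fix x assume "x \<in> lat (insert b A)"
  then obtain c where c: "\<forall>a\<in>insert b A. absv (c a) \<le> 1" "x = (\<Sum>a\<in>insert b A. emb (c a) * a)"
    unfolding lat_def by blast
  have "x = emb (c b) * b + (\<Sum>a\<in>A. emb (c a) * a)"
    using assms c(2) by simp
  moreover have "(\<Sum>a\<in>A. emb (c a) * a) \<in> lat A" "c b \<in> integers_ring absv"
    using c(1) unfolding lat_def integers_ring_def by blast+
  ultimately show "x \<in> (\<lambda>z. emb (fst z) * b + snd z) ` (integers_ring absv \<times> lat A)"
    by (intro image_eqI[of _ _ "(c b, \<Sum>a\<in>A. emb (c a) * a)"]) auto
next
  fix x assume "x \<in> (\<lambda>z. emb (fst z) * b + snd z) ` (integers_ring absv \<times> lat A)"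
  then obtain e c where c: "absv e \<le> 1" "\<forall>a\<in>A. absv (c a) \<le> 1" "x = emb e * b + (\<Sum>a\<in>A. emb (c a) * a)"
    unfolding lat_def integers_ring_def by auto
  have "x = (\<Sum>a\<in>insert b A. emb ((c(b := e)) a) * a)"
    using assms c(3) by (auto intro!: sum.cong)
  moreover have "\<forall>a\<in>insert b A. absv ((c(b := e)) a) \<le> 1"
    using c(1,2) by simp
  ultimately show "x \<in> lat (insert b A)"
    unfolding lat_def by blast
qed

lemma compact_lat: "finite A \<Longrightarrow> compact (lat A)"
proof (induction A rule: finite_induct)
  case empty
  have "lat {} = {0}"
    unfolding lat_def by auto
  then show ?case
    by simp
next
  case (insert b A)
  have "continuous_on (integers_ring absv \<times> lat A) (\<lambda>z. emb (fst z) * b + snd z)"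
    unfolding continuous_on_def
    by (intro ballI tendsto_nrm_add tendsto_nrm_mult tendsto_emb tendsto_const tendsto_fst tendsto_snd tendsto_ident_at)
  then have "compact ((\<lambda>z. emb (fst z) * b + snd z) ` (integers_ring absv \<times> lat A))"
    using compact_padic_integers insert.IH by (intro compact_continuous_image compact_Times)
  then show ?case
    using lat_insert[OF insert.hyps] by simp
qed

lemma ex_basis:
  "\<exists>B. finite B \<and> card B = ext_degree emb \<and> (\<forall>x. \<exists>c. x = (\<Sum>b\<in>B. emb (c b) * b)) \<and>
    (\<forall>c. (\<Sum>b\<in>B. emb (c b) * b) = 0 \<longrightarrow> (\<forall>b\<in>B. c b = 0))"
proof -
  obtain B where "finite_dimensional_vector_space (ext_scale emb) B"
    using finite_ext by blast
  then interpret V: finite_dimensional_vector_space "ext_scale emb" B .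
  have "\<exists>c. x = (\<Sum>b\<in>B. emb (c b) * b)" for x
  proof -
    have "x \<in> V.span B"
      using V.span_Basis by simp
    then show ?thesis
      unfolding V.span_finite[OF V.finite_Basis] by (auto simp: ext_scale_def)
  qed
  moreover have "c b = 0" if "(\<Sum>b\<in>B. emb (c b) * b) = 0" "b \<in> B" for c b
    using V.independentD[OF V.independent_Basis V.finite_Basis order_refl, of c b] that
    by (simp add: ext_scale_def)
  moreover have "card B = ext_degree emb"
    unfolding ext_degree_def by simp
  ultimately show ?thesis
    using V.finite_Basis by (intro exI[of _ B]) blast
qed

definition bas :: "'a set" where
  "bas = (SOME B. finite B \<and> card B = ext_degree emb \<and> (\<forall>x. \<exists>c. x = (\<Sum>b\<in>B. emb (c b) * b)) \<and>
    (\<forall>c. (\<Sum>b\<in>B. emb (c b) * b) = 0 \<longrightarrow> (\<forall>b\<in>B. c b = 0)))"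

lemma finite_bas: "finite bas"
  and card_bas: "card bas = ext_degree emb"
  and bas_span: "\<exists>c. x = (\<Sum>b\<in>bas. emb (c b) * b)"
  and bas_independent: "(\<Sum>b\<in>bas. emb (c b) * b) = 0 \<Longrightarrow> b \<in> bas \<Longrightarrow> c b = 0"
  using someI_ex[OF ex_basis] unfolding bas_def[symmetric] by blast+

abbreviation L where "L \<equiv> lat bas"

lemma add_subgroup_L: "add_subgroup L"
  unfolding add_subgroup_def
proof (intro conjI ballI)
  show "0 \<in> L"
    unfolding lat_def by (auto intro!: exI[of _ "\<lambda>_. 0"] simp: emb_0)
  fix x y assume "x \<in> L" "y \<in> L"
  then obtain c d where cd: "\<forall>b\<in>bas. absv (c b) \<le> 1" "x = (\<Sum>b\<in>bas. emb (c b) * b)"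
      "\<forall>b\<in>bas. absv (d b) \<le> 1" "y = (\<Sum>b\<in>bas. emb (d b) * b)"
    unfolding lat_def by blast
  have "x - y = (\<Sum>b\<in>bas. emb (c b - d b) * b)"
    unfolding cd by (simp add: emb_diff left_diff_distrib sum_subtractf)
  moreover have "\<forall>b\<in>bas. absv (c b - d b) \<le> 1"
  proof
    fix b assume "b \<in> bas"
    then show "absv (c b - d b) \<le> 1"
      using cd(1,3) K.nrm_diff_le[of "c b" "d b"] by fastforce
  qed
  ultimately show "x - y \<in> L"
    unfolding lat_def by (intro CollectI exI[of _ "\<lambda>b. c b - d b"]) simp
qed

lemma borel_L: "L \<in> sets borel"
  by (intro borel_closed compact_imp_closed compact_lat finite_bas)

lemma L_absorbing: "\<exists>j. of_nat p ^ j * x \<in> L"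
proof -
  obtain c where c: "x = (\<Sum>b\<in>bas. emb (c b) * b)"
    using bas_span by blast
  obtain j where j: "(\<Sum>b\<in>bas. absv (c b)) < real p ^ j"
    using real_arch_pow[of "real p"] p_gt_1 by auto
  have "of_nat p ^ j * x = (\<Sum>b\<in>bas. emb (of_nat p ^ j * c b) * b)"
    unfolding c by (simp add: sum_distrib_left emb_mult emb_power emb_of_nat mult.assoc)
  moreover have "absv (of_nat p ^ j * c b) \<le> 1" if "b \<in> bas" for b
  proof -
    have "absv (c b) \<le> (\<Sum>b\<in>bas. absv (c b))"
      using finite_bas that by (intro member_le_sum) auto
    then have "absv (c b) \<le> real p ^ j"
      using j by simp
    then show ?thesis
      using p_gt_1 by (simp add: K.nrm_mult K.nrm_power absv_p power_one_over)
  qed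
  ultimately show ?thesis
    unfolding lat_def by (intro exI[of _ j] CollectI exI[of _ "\<lambda>b. of_nat p ^ j * c b"]) simp
qed

text \<open>Independence of \<open>bas\<close> makes coordinates unique, so membership in
  \<open>p L\<close> can be tested on any given coordinates.\<close>

lemma mem_scale_L_iff:
  "(\<Sum>b\<in>bas. emb (c b) * b) \<in> (*) (of_nat p) ` L \<longleftrightarrow> (\<forall>b\<in>bas. absv (c b) \<le> 1 / real p)"
proof
  have p0: "(of_nat p :: 'k) \<noteq> 0"
    using p_gt_1 by simp
  assume "(\<Sum>b\<in>bas. emb (c b) * b) \<in> (*) (of_nat p) ` L"
  then obtain d where d: "\<forall>b\<in>bas. absv (d b) \<le> 1"
      "(\<Sum>b\<in>bas. emb (c b) * b) = of_nat p * (\<Sum>b\<in>bas. emb (d b) * b)"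
    unfolding lat_def by blast
  have "(\<Sum>b\<in>bas. emb (c b - of_nat p * d b) * b) = (\<Sum>b\<in>bas. emb (c b) * b) - of_nat p * (\<Sum>b\<in>bas. emb (d b) * b)"
    by (simp add: emb_diff emb_mult emb_of_nat left_diff_distrib sum_subtractf sum_distrib_left mult.assoc)
  then have "(\<Sum>b\<in>bas. emb (c b - of_nat p * d b) * b) = 0"
    using d(2) by simp
  then have c: "c b = of_nat p * d b" if "b \<in> bas" for b
    using bas_independent[of "\<lambda>b. c b - of_nat p * d b", OF _ that] by simp
  show "\<forall>b\<in>bas. absv (c b) \<le> 1 / real p"
  proof
    fix b assume b: "b \<in> bas"
    have "1 / real p * absv (d b) \<le> 1 / real p * 1"
      using d(1) b by (intro mult_left_mono) auto
    then show "absv (c b) \<le> 1 / real p"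
      unfolding c[OF b] K.nrm_mult absv_p by simp
  qed
next
  have p0: "(of_nat p :: 'k) \<noteq> 0"
    using p_gt_1 by simp
  assume c: "\<forall>b\<in>bas. absv (c b) \<le> 1 / real p"
  have "(\<Sum>b\<in>bas. emb (c b) * b) = of_nat p * (\<Sum>b\<in>bas. emb (c b / of_nat p) * b)"
  proof -
    have "emb (c b) = of_nat p * emb (c b / of_nat p)" for b
      using emb_mult[of "of_nat p" "c b / of_nat p"] p0 by (simp add: emb_of_nat)
    then show ?thesis
      by (simp add: sum_distrib_left mult.assoc)
  qed
  moreover have "(\<Sum>b\<in>bas. emb (c b / of_nat p) * b) \<in> L"
  proof -
    have "\<forall>b\<in>bas. absv (c b / of_nat p) \<le> 1"
      using c p_gt_1 unfolding K.nrm_divide absv_p by (simp add: field_simps)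
    then show ?thesis
      unfolding lat_def by (intro CollectI exI[of _ "\<lambda>b. c b / of_nat p"]) simp
  qed
  ultimately show "(\<Sum>b\<in>bas. emb (c b) * b) \<in> (*) (of_nat p) ` L"
    by blast
qed

text \<open>Representatives of \<open>L\<close> modulo \<open>p L\<close>: one digit below
  \<open>p\<close> for each basis element.\<close>

definition dig :: "('a \<Rightarrow> nat) \<Rightarrow> 'a" where
  "dig f = (\<Sum>b\<in>bas. emb (of_nat (f b)) * b)"

lemma L_cosets:
  "L = (\<Union>f\<in>bas \<rightarrow>\<^sub>E {..<p}. (+) (dig f) ` (*) (of_nat p) ` L)"
proof (intro equalityI subsetI)
  fix x assume "x \<in> L"
  then obtain c where c: "\<forall>b\<in>bas. absv (c b) \<le> 1" "x = (\<Sum>b\<in>bas. emb (c b) * b)"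
    unfolding lat_def by blast
  have "\<forall>b\<in>bas. \<exists>m<p. absv (c b - of_nat m) \<le> 1 / real p"
    using c(1) ex_digit by blast
  then obtain g where g: "\<And>b. b \<in> bas \<Longrightarrow> g b < p \<and> absv (c b - of_nat (g b)) \<le> 1 / real p"
    by metis
  define f where "f = restrict g bas"
  have f: "f \<in> bas \<rightarrow>\<^sub>E {..<p}"
    using g unfolding f_def by auto
  have "x - dig f = (\<Sum>b\<in>bas. emb (c b - of_nat (f b)) * b)"
    unfolding c(2) dig_def by (simp add: emb_diff left_diff_distrib sum_subtractf)
  also have "\<dots> \<in> (*) (of_nat p) ` L"
    unfolding mem_scale_L_iff using g by (simp add: f_def)
  finally show "x \<in> (\<Union>f\<in>bas \<rightarrow>\<^sub>E {..<p}. (+) (dig f) ` (*) (of_nat p) ` L)"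
    using f unfolding UN_iff translate_iff by blast
next
  fix x assume "x \<in> (\<Union>f\<in>bas \<rightarrow>\<^sub>E {..<p}. (+) (dig f) ` (*) (of_nat p) ` L)"
  then obtain f where f: "f \<in> bas \<rightarrow>\<^sub>E {..<p}" "x - dig f \<in> (*) (of_nat p) ` L"
    unfolding UN_iff translate_iff by blast
  have dig: "dig g \<in> L" for g
    unfolding lat_def dig_def
    by (intro CollectI exI[of _ "\<lambda>b. of_nat (g b)"]) (simp add: K.nrm_of_nat_le)
  have "(*) (of_nat p) ` L \<subseteq> L"
  proof
    fix y assume y: "y \<in> (*) (of_nat p) ` L"
    obtain c where c: "y = (\<Sum>b\<in>bas. emb (c b) * b)"
      using bas_span by blast
    have "\<forall>b\<in>bas. absv (c b) \<le> 1 / real p"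
      using y unfolding c mem_scale_L_iff .
    moreover have "1 / real p \<le> 1"
      using p_gt_1 by simp
    ultimately have "\<forall>b\<in>bas. absv (c b) \<le> 1"
      by fastforce
    then show "y \<in> L"
      unfolding lat_def c by (intro CollectI exI[of _ c]) simp
  qed
  then have "(x - dig f) + dig f \<in> L"
    using f(2) dig by (intro add_subgroupD(3)[OF add_subgroup_L]) blast+
  then show "x \<in> L"
    by simp
qed

lemma L_cosets_disjoint:
  "disjoint_family_on (\<lambda>f. (+) (dig f) ` (*) (of_nat p) ` L) (bas \<rightarrow>\<^sub>E {..<p})"
  unfolding disjoint_family_on_def
proof (intro ballI impI, rule ccontr)
  fix f g assume f: "f \<in> bas \<rightarrow>\<^sub>E {..<p}" and g: "g \<in> bas \<rightarrow>\<^sub>E {..<p}" and "f \<noteq> g"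
    and "(+) (dig f) ` (*) (of_nat p) ` L \<inter> (+) (dig g) ` (*) (of_nat p) ` L \<noteq> {}"
  then obtain x where x: "x - dig f \<in> (*) (of_nat p) ` L" "x - dig g \<in> (*) (of_nat p) ` L"
    unfolding disjoint_iff translate_iff by blast
  have "(x - dig g) - (x - dig f) \<in> (*) (of_nat p) ` L"
    by (rule add_subgroupD(2)[OF add_subgroup_scale[OF add_subgroup_L] x(2,1)])
  moreover have "(x - dig g) - (x - dig f) = (\<Sum>b\<in>bas. emb (of_nat (f b) - of_nat (g b)) * b)"
    unfolding dig_def by (simp add: emb_diff left_diff_distrib sum_subtractf)
  ultimately have "\<forall>b\<in>bas. absv (of_nat (f b) - of_nat (g b)) \<le> 1 / real p"
    using mem_scale_L_iff[of "\<lambda>b. of_nat (f b) - of_nat (g b)"] by simp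
  then have "f b = g b" if "b \<in> bas" for b
    using f g that by (intro digit_unique) auto
  then have "f = g"
    using f g by (intro PiE_ext)
  then show False
    using \<open>f \<noteq> g\<close> by simp
qed

text \<open>Multiplied by \<open>c\<close>, the digit decomposition still has
  \<open>p ^ ext_degree emb\<close> cosets. This is where the degree of the extension enters the
  measure.\<close>

lemma emeasure_scale_L:
  assumes "c \<noteq> 0"
  shows "emeasure \<mu> ((*) c ` L) = of_nat (p ^ ext_degree emb) * emeasure \<mu> ((*) (of_nat p) ` (*) c ` L)"
proof -
  have fin: "finite (bas \<rightarrow>\<^sub>E {..<p})"
    using finite_bas by (intro finite_PiE) auto
  have card: "card (bas \<rightarrow>\<^sub>E {..<p}) = p ^ ext_degree emb"
    using finite_bas by (simp add: card_PiE card_bas)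
  have comm: "(*) c ` (*) (of_nat p) ` L = (*) (of_nat p) ` (*) c ` L"
    unfolding image_image by (simp add: mult_ac)
  have *: "(+) (c * dig f) ` (*) c ` (*) (of_nat p) ` L = (*) c ` (+) (dig f) ` (*) (of_nat p) ` L" for f
    by (simp add: image_image distrib_left)
  have un: "(*) c ` L = (\<Union>f\<in>bas \<rightarrow>\<^sub>E {..<p}. (+) (c * dig f) ` (*) c ` (*) (of_nat p) ` L)"
    unfolding * by (subst L_cosets) blast
  have "inj ((*) c)"
    using assms by (simp add: inj_def)
  then have disj: "disjoint_family_on (\<lambda>f. (+) (c * dig f) ` (*) c ` (*) (of_nat p) ` L) (bas \<rightarrow>\<^sub>E {..<p})"
    using L_cosets_disjoint unfolding * disjoint_family_on_def by (simp add: image_Int[symmetric])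
  have "emeasure \<mu> (\<Union>f\<in>bas \<rightarrow>\<^sub>E {..<p}. (+) (c * dig f) ` (*) c ` (*) (of_nat p) ` L)
      = of_nat (card (bas \<rightarrow>\<^sub>E {..<p})) * emeasure \<mu> ((*) c ` (*) (of_nat p) ` L)"
    using fin disj by (intro emeasure_cosets borel_scale borel_L assms of_nat_p_neq_0)
  then have "emeasure \<mu> ((*) c ` L) = of_nat (p ^ ext_degree emb) * emeasure \<mu> ((*) c ` (*) (of_nat p) ` L)"
    unfolding un[symmetric] card .
  then show ?thesis
    unfolding comm .
qed

text \<open>Clearing denominators, the sets \<open>R \<inter> p^(-j) L\<close> exhaust
  \<open>R\<close>, which has measure 1, so they cannot all be null.\<close>

lemma ex_lattice:
  obtains c where "c \<noteq> 0" "emeasure \<mu> (R \<inter> (*) c ` L) \<noteq> 0"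
proof -
  define c where "c j = inverse (of_nat p ^ j :: 'a)" for j
  have c: "c j \<noteq> 0" for j
    using of_nat_p_neq_0 by (simp add: c_def)
  have [measurable]: "R \<inter> (*) (c j) ` L \<in> sets borel" for j
    using borel_R borel_scale[OF borel_L c] by (rule sets.Int)
  have "R = (\<Union>j. R \<inter> (*) (c j) ` L)"
  proof (intro equalityI subsetI)
    fix x assume x: "x \<in> R"
    obtain j where "of_nat p ^ j * x \<in> L"
      using L_absorbing by blast
    then have "c j * (of_nat p ^ j * x) \<in> (*) (c j) ` L"
      by (rule imageI)
    moreover have "c j * (of_nat p ^ j * x) = x"
      using of_nat_p_neq_0 by (simp add: c_def mult.assoc[symmetric])
    ultimately show "x \<in> (\<Union>j. R \<inter> (*) (c j) ` L)"
      using x by auto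
  qed blast
  then have "emeasure \<mu> (\<Union>j. R \<inter> (*) (c j) ` L) \<noteq> 0"
    using mu_integers by simp
  moreover have "emeasure \<mu> (\<Union>j. R \<inter> (*) (c j) ` L) = 0"
    if "\<And>j. emeasure \<mu> (R \<inter> (*) (c j) ` L) = 0"
    using that by (rule emeasure_UN_eq_0) auto
  ultimately have "\<exists>j. emeasure \<mu> (R \<inter> (*) (c j) ` L) \<noteq> 0"
    by blast
  then show ?thesis
    using that c by blast
qed

text \<open>The set \<open>H = R \<inter> c L\<close> is compact and of positive measure, hence of
  finite index in \<open>R\<close> and in \<open>c L\<close>. The first index gives compactness of
  \<open>R\<close>; together they transfer the scaling factor of \<open>p\<close> from
  \<open>c L\<close> to \<open>R\<close>.\<close>

lemma compact_R: "compact R"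
  and emeasure_p_R: "of_nat (p ^ ext_degree emb) * emeasure \<mu> ((*) (of_nat p) ` R) = 1"
proof -
  obtain c where c: "c \<noteq> 0" "emeasure \<mu> (R \<inter> (*) c ` L) \<noteq> 0"
    by (rule ex_lattice)
  define G where "G = (*) c ` L"
  define H where "H = R \<inter> G"
  have cG: "compact G"
    unfolding G_def
    by (intro compact_continuous_image continuous_on_mult_left_nrm compact_lat finite_bas)
  have cH: "compact H"
    unfolding H_def integers_ring_eq_cball by (intro closed_Int_compact closed_cball cG)
  have G: "add_subgroup G" "G \<in> sets borel" "emeasure \<mu> G < \<infinity>"
  proof -
    show "add_subgroup G" "G \<in> sets borel"
      unfolding G_def by (intro add_subgroup_scale add_subgroup_L borel_scale borel_L c(1))+
  qed (rule emeasure_compact[OF cG])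
  have R: "add_subgroup R" "R \<in> sets borel" "emeasure \<mu> R < \<infinity>"
    using add_subgroup_R borel_R mu_integers by auto
  have H: "add_subgroup H" "H \<in> sets borel" "H \<subseteq> R" "H \<subseteq> G" "emeasure \<mu> H \<noteq> 0"
  proof -
    show "add_subgroup H"
      using add_subgroupD(1,2)[OF R(1)] add_subgroupD(1,2)[OF G(1)]
      unfolding add_subgroup_def H_def by blast
    show "H \<in> sets borel"
      unfolding H_def using R(2) G(2) by (rule sets.Int)
    show "emeasure \<mu> H \<noteq> 0"
      using c(2) unfolding H_def G_def .
  qed (auto simp: H_def)
  \<comment> \<open>\<open>R\<close> is now a finite union of translates of the compact set
    \<open>H\<close>.\<close>
  obtain T where T: "finite T" "T \<subseteq> R" "R = (\<Union>t\<in>T. (+) t ` H)" "disjoint_family_on (\<lambda>t. (+) t ` H) T"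
    by (rule finite_index[OF R H(1,2,3,5)])
  have "compact (\<Union>t\<in>T. (+) t ` H)"
    using T(1) by (intro compact_UN compact_continuous_image continuous_on_add_left_nrm cH)
  then show "compact R"
    unfolding T(3)[symmetric] .
  define p' where "p' = (of_nat p :: 'a)"
  define N :: ennreal where "N = of_nat (p ^ ext_degree emb)"
  have p': "p' \<noteq> 0"
    using of_nat_p_neq_0 by (simp add: p'_def)
  have 1: "emeasure \<mu> ((*) p' ` R) * emeasure \<mu> H = emeasure \<mu> ((*) p' ` H)"
    using emeasure_scale_ratio[OF R H(1,2,3,5) p'] mu_integers by simp
  have 2: "emeasure \<mu> ((*) p' ` G) * emeasure \<mu> H = emeasure \<mu> ((*) p' ` H) * emeasure \<mu> G"
    by (rule emeasure_scale_ratio[OF G H(1,2,4,5) p'])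
  have 3: "emeasure \<mu> G = N * emeasure \<mu> ((*) p' ` G)"
    unfolding G_def N_def p'_def by (rule emeasure_scale_L[OF c(1)])
  have HG: "emeasure \<mu> H \<le> emeasure \<mu> G"
    using H(4) G(2) by (intro emeasure_mono) auto
  define h where "h = emeasure \<mu> H"
  define g where "g = emeasure \<mu> ((*) p' ` G)"
  define r where "r = emeasure \<mu> ((*) p' ` R)"
  have h: "h \<noteq> 0" "h \<noteq> top"
    using H(5) HG G(3) unfolding h_def by (auto simp: top_unique)
  have g: "g \<noteq> 0" "g \<noteq> top"
  proof -
    show "g \<noteq> 0"
      using h(1) HG 3 unfolding h_def g_def by auto
    have "compact ((*) p' ` G)"
      by (intro compact_continuous_image continuous_on_mult_left_nrm cG)
    then show "g \<noteq> top"
      using emeasure_compact[of "(*) p' ` G"] unfolding g_def by simp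
  qed
  \<comment> \<open>Facts 1 to 3 combine to g h = (r h) (N g). Cancelling h g in
    \<open>ennreal\<close> needs it nonzero and finite, whence the preceding bounds.\<close>
  have "(h * g) * 1 = g * h"
    by (simp add: mult.commute)
  also have "\<dots> = (r * h) * (N * g)"
    using 2 unfolding 1[symmetric] 3 unfolding h_def g_def r_def .
  also have "\<dots> = (h * g) * (N * r)"
    by (simp only: mult_ac)
  finally have "(h * g) * 1 = (h * g) * (N * r)" .
  moreover have "h * g \<noteq> 0" "h * g \<noteq> top"
    using h g by (auto simp: ennreal_mult_eq_top_iff)
  ultimately have "1 = N * r"
    using ennreal_mult_cancel_left[of "h * g" 1 "N * r"] by simp
  then show "of_nat (p ^ ext_degree emb) * emeasure \<mu> ((*) (of_nat p) ` R) = 1"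
    unfolding N_def r_def p'_def by simp
qed

text \<open>With |p| = |\<pi>|^e, the measure of \<open>p R\<close> is q^(-e) by counting residue
  classes and p^(-d) by counting lattice cosets, where d is \<open>ext_degree emb\<close>. The
  normalization makes |p| equal to p^(-d) as well, so |\<pi>|^e = q^(-e).\<close>

lemma ex_uniformizer_residue:
  obtains \<pi> where "\<pi> \<noteq> 0" "nrm \<pi> < 1" "\<forall>x. nrm x < 1 \<longrightarrow> nrm x \<le> nrm \<pi>"
    "2 \<le> residue_card nrm" "nrm \<pi> = 1 / real (residue_card nrm)"
    "\<forall>x k. emeasure \<mu> (cball x (nrm \<pi> ^ k)) = ennreal (1 / real (residue_card nrm) ^ k)"
proof -
  define q where "q = residue_card nrm"
  obtain \<pi> where \<pi>: "\<pi> \<noteq> 0" "nrm \<pi> < 1" "\<And>x. nrm x < 1 \<Longrightarrow> nrm x \<le> nrm \<pi>"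
    using ex_maximal_nrm[OF compact_R of_nat_p_neq_0 nrm_p_less_1] by blast
  \<comment> \<open>Since \<open>p R\<close> is contained in the maximal ideal and has positive
    measure, the ideal has positive measure, as the residue count requires.\<close>
  have "nrm (of_nat p) \<le> nrm \<pi>"
    by (rule \<pi>(3)[OF nrm_p_less_1])
  then have "(*) (of_nat p) ` R \<subseteq> (*) \<pi> ` R"
    unfolding scale_R_eq_cball[OF \<pi>(1)] scale_R_eq_cball[OF of_nat_p_neq_0] by (rule subset_cball)
  then have "emeasure \<mu> ((*) (of_nat p) ` R) \<le> emeasure \<mu> ((*) \<pi> ` R)"
    using borel_scale[OF borel_R \<pi>(1)] by (intro emeasure_mono) auto
  moreover have "emeasure \<mu> ((*) (of_nat p) ` R) \<noteq> 0"
    using emeasure_p_R by auto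
  ultimately have pos: "emeasure \<mu> ((*) \<pi> ` R) \<noteq> 0"
    by auto
  have q: "2 \<le> q"
    unfolding q_def by (rule emeasure_cball_power(1)[OF \<pi> mu_integers pos])
  have ball: "emeasure \<mu> (cball x (nrm \<pi> ^ k)) = ennreal (1 / real q ^ k)" for x k
    unfolding q_def by (rule emeasure_cball_power(2)[OF \<pi> mu_integers pos])
  obtain e where e: "nrm (of_nat p) = nrm \<pi> ^ e"
    using nrm_eq_power[OF \<pi> of_nat_p_neq_0 less_imp_le[OF nrm_p_less_1]] by blast
  have "e \<noteq> 0"
    using e nrm_p_less_1 by (intro notI) simp
  have "ennreal (real (p ^ ext_degree emb)) * ennreal (1 / real q ^ e) = 1"
    using emeasure_p_R ball[of 0 e]
    unfolding scale_R_eq_cball[OF of_nat_p_neq_0] e by (simp add: ennreal_of_nat_eq_real_of_nat)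
  moreover have "ennreal (real (p ^ ext_degree emb) * (1 / real q ^ e))
      = ennreal (real (p ^ ext_degree emb)) * ennreal (1 / real q ^ e)"
    by (rule ennreal_mult) simp_all
  ultimately have "ennreal (real (p ^ ext_degree emb) * (1 / real q ^ e)) = ennreal 1"
    by (simp only: ennreal_1)
  moreover have "0 \<le> real (p ^ ext_degree emb) * (1 / real q ^ e)"
    by (intro mult_nonneg_nonneg divide_nonneg_nonneg zero_le_power) simp_all
  ultimately have "real (p ^ ext_degree emb) * (1 / real q ^ e) = 1"
    using ennreal_inj[of "real (p ^ ext_degree emb) * (1 / real q ^ e)" 1] zero_le_one by blast
  \<comment> \<open>The two evaluations of the measure of \<open>p R\<close> agree; the exponent
    \<open>e\<close> is nonzero, so e-th roots may be taken below.\<close>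
  then have pq: "real p ^ ext_degree emb = real q ^ e"
    using q by (simp add: field_simps)
  have "nrm \<pi> ^ e = inverse (real p ^ ext_degree emb)"
    using nrm_normalized unfolding e by (simp only: power_int_minus power_int_of_nat)
  then have "nrm \<pi> ^ e = (1 / real q) ^ e"
    unfolding pq by (simp add: power_one_over inverse_eq_divide)
  then have "nrm \<pi> = 1 / real q"
    by (rule power_eq_imp_eq_base) (use \<open>e \<noteq> 0\<close> in simp_all)
  then have eq: "nrm \<pi> = 1 / real (residue_card nrm)"
    unfolding q_def .
  show ?thesis
    by (rule that[of \<pi>]) (assumption | rule allI impI \<pi> eq q[unfolded q_def] ball[unfolded q_def])+
qed

end

theorem theoremF:
  fixes p n :: nat
    and absv :: "'k::{field_char_0, metric_space} \<Rightarrow> real"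
    and emb :: "'k \<Rightarrow> 'a::{field, metric_space}"
    and nrm :: "'a \<Rightarrow> real"
    and \<mu> :: "'a measure"
    and U V :: "'a set"
    and u v :: 'a
  assumes "padic_extension p absv emb nrm"
    and "haar_measure \<mu>" and "emeasure \<mu> (integers_ring nrm) = 1"
    and "is_ball U" and "is_ball V"
    and "U \<subseteq> integers_ring nrm" and "V \<subseteq> integers_ring nrm"
    and "U \<inter> V = {}"
    and "u \<in> U" and "v \<in> V"
    and "n \<ge> 3"
  shows "let M = poly_measure \<mu> (integers_ring nrm) n;
             q = real (residue_card nrm)
         in integrable M (num_zeros U) \<and> integrable M (num_zeros V) \<and>
            integrable M (\<lambda>P. num_zeros U P * num_zeros V P) \<and>
            integral\<^sup>L M (num_zeros U) \<noteq> 0 \<and> integral\<^sup>L M (num_zeros V) \<noteq> 0 \<and>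
            covariance M (num_zeros U) (num_zeros V)
              / (integral\<^sup>L M (num_zeros U) * integral\<^sup>L M (num_zeros V))
            = - 1 + (q + 1)\<^sup>2 / (q\<^sup>2 + q + 1) * nrm (u - v)
              - q / (q\<^sup>2 + q + 1) * nrm (u - v) ^ 4"
proof -
  interpret F: padic_haar p absv emb nrm \<mu>
    by (intro padic_haar.intro padic_haar_axioms.intro assms)
  obtain \<pi> where \<pi>: "\<pi> \<noteq> 0" "nrm \<pi> < 1" "\<forall>x. nrm x < 1 \<longrightarrow> nrm x \<le> nrm \<pi>"
    and q: "2 \<le> residue_card nrm" and \<pi>_q: "nrm \<pi> = 1 / real (residue_card nrm)"
    and ball: "\<forall>x k. emeasure \<mu> (cball x (nrm \<pi> ^ k)) = ennreal (1 / real (residue_card nrm) ^ k)"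
    by (rule F.ex_uniformizer_residue)
  interpret local_field nrm \<mu> "residue_card nrm"
  proof unfold_locales
    show "compact (integers_ring nrm)"
      by (rule F.compact_R)
    show "of_nat m \<noteq> (0::'a)" if "0 < m" for m
      using that by (rule F.of_nat_neq_0_ext)
    show "2 \<le> residue_card nrm"
      by (rule q)
    show "\<exists>k. nrm x = 1 / real (residue_card nrm) ^ k" if "x \<noteq> 0" "nrm x \<le> 1" for x
      using F.nrm_eq_power[OF \<pi>(1,2) \<pi>(3)[rule_format] that] by (simp only: \<pi>_q power_one_over)
    show "\<exists>\<pi>. nrm \<pi> = 1 / real (residue_card nrm)"
      using \<pi>_q by (rule exI[of _ \<pi>])
    show "emeasure \<mu> (cball x (1 / real (residue_card nrm) ^ k)) = ennreal (1 / real (residue_card nrm) ^ k)" for x k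
      using ball[rule_format, of x k] by (simp only: \<pi>_q power_one_over)
  qed
  show ?thesis
    unfolding Let_def
    by (rule covariance_num_zeros[OF assms(4,6,9,5,7,10,8,11)])
qed

end
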